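(* Let $t$ be a trace of $k\ge 2$ processes and let $n=|\mathcal{E}(t)|$. Let $e_1,e_2\in\mathcal{E}(t)$ be two conflicting (read/write) events of $t$. The algorithm $\mathsf{RaceDecision}$ requires $O(n^2\cdot\log n)$ time and soundly reports whether $(e_1,e_2)$ is a predictable race of $t$ (i.e. if it returns True, then $(e_1,e_2)$ is a predictable race of $t$). If $k=2$, $\mathsf{RaceDecision}$ is also complete (i.e. if $(e_1,e_2)$ is a predictable race of $t$, it returns True). If $\mathsf{RaceDecision}$ reports a race, a witness trace can be constructed in $O(n\cdot\log n)$ time.
   Context: **Events.** There are $k$ processes, a set of global variables and a set of locks. Each event $e$ belongs to one process $p(e)$, accesses one location $\mathsf{loc}(e)$, and is of exactly one of four types: a write $w(x)$ or read $r(x)$ of a global variable $x$, or an acquire $\mathsf{acq}(\ell)$ or release $\mathsf{rel}(\ell)$ of a lock $\ell$. Two distinct events are *conflicting*, written $e_1\Join e_2$, if they access the same location and either both are read/write events and at least one is a write, or both are lock events. **Event sequences.** Let $t$ be a finite sequence of distinct events. $\mathcal{E}(t)$ is its set of events; $e_1<_t e_2$ means that $e_1$ appears before $e_2$ in $t$; $e_1<_{\mathsf{PO}}e_2$ means $e_1<_t e_2$ and $p(e_1)=p(e_2)$; $\le_{\mathsf{PO}}$ is its reflexive closure. $t|q$ is the subsequence of events of process $q$, and $\circ$ is concatenation. For an acquire event $a$ of $t$, $\mathsf{match}_t(a)$ is the earliest release event $\rho$ of $t$ on the same lock with $a<_t\rho$ ($\bot$ if there is none); if it exists it is required to belong to $p(a)$.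 For a release event $\rho$, $\mathsf{match}_t(\rho)$ is the acquire event $a$ with $\mathsf{match}_t(a)=\rho$, which is required to exist. **Traces.** $t$ is a *trace* if (1) for every read $r$ of $t$ there is a write $w$ of $t$ with $\mathsf{loc}(w)=\mathsf{loc}(r)$ and $w<_t r$; and (2) for any two acquires $a_1<_t a_2$ of $t$ on the same lock, $\mathsf{match}_t(a_1)$ exists in $t$ and $\mathsf{match}_t(a_1)<_t a_2$. The *observation function* $\mathcal{O}_t$ maps each read $r$ of $t$ to the last write to $\mathsf{loc}(r)$ preceding $r$ in $t$. Standing assumption: the input trace $t$ starts with a write event to every global variable. A trace $t'$ is a *correct reordering* of $t$ if $t'|q$ is a prefix of $t|q$ for every process $q$, and $\mathcal{O}_{t'}(r)=\mathcal{O}_t(r)$ for every read $r$ of $t'$. **Predictable races.** A trace *exhibits the race* $(e_1,e_2)$ if $e_1,e_2$ are conflicting read/write events of different processes that are consecutive in the trace, $e_1$ immediately before $e_2$. The trace $t$ has a *predictable race* on $(e_1,e_2)$, $e_1,e_2\in\mathcal{E}(t)$, if there is a correct reordering $t'$ of $t$ such that $t^*=t'\circ e_1\circ e_2$ is a trace (of the program, so that $e_1$ and $e_2$ are the next events of their processes after $t'$: $(t'|p(e_i))\circ e_i$ is a prefix of $t|p(e_i)$ for $i=1,2$) that exhibits the race $(e_1,e_2)$. Such a $t^*$ is a *witness trace*. **Feasible sets.** $X\subseteq\mathcal{E}(t)$ is *feasible* for $t$ if: $e\le_{\mathsf{PO}}e'\in X$ implies $e\in X$; $\mathcal{O}_t(r)\in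 X$ for every read $r\in X$; $\mathsf{match}_t(\rho)\in X$ for every release $\rho\in X$; and any two distinct acquires in $X$ whose matching releases are not in $X$ access different locks. **Closed partial orders.** For partial orders over $X$, $Q\sqsubseteq P$ ($Q$ refines $P$) means that $e\le_P e'$ implies $e\le_Q e'$. $P$ over a feasible $X$ *respects* $t$ if (1) $P\sqsubseteq\mathsf{PO}|X$; (2) $\mathcal{O}_t(r)<_P r$ for every read $r\in X$; (3) for every acquire $a\in X$ with $\mathsf{match}_t(a)\notin X$ (including $\mathsf{match}_t(a)=\bot$) and every release $\rho\in X$ on the same lock, $\rho<_P a$. $P$ is *closed* if it respects $t$ and: (observation-closed) for every read $r\in X$ with $w=\mathcal{O}_t(r)$ and every write $w'\in X\setminus\{w\}$ with $w'\Join r$, $w'<_P r$ implies $w'<_P w$, and $w<_P w'$ implies $r<_P w'$; (lock-closed) for any two distinct releases $\rho_1,\rho_2\in X$ on the same lock with $a_i=\mathsf{match}_t(\rho_i)$, $a_1\le_P\rho_2$ implies $\rho_1\le_P a_2$. The *closure* of $P$ is the smallest (weakest) closed partial order over $X$ refining $P$; it is $\bot$ if none exists. **Relative causal cones.** For $e\in\mathcal{E}(t)$ and a process $q$, $\mathsf{RCone}_t(e,q)$ is the smallest set $C$ such that: (1) $e'\in C$ whenever $e'<_{\mathsf{PO}}e$; (2) $e''\in C$ whenever $e''\le_{\mathsf{PO}}e'\in C$; (3) $\mathcal{O}_t(r)\in C$ for every read $r\in C$; (4) for every acquire $a\in C$ with $p(a)\ne p(e)$ and $p(a)\ne q$, $\mathsf{match}_t(a)\in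 C$ (when it exists). **Algorithm $\mathsf{RaceDecision}(t,e_1,e_2)$.** 1. Let $X=\mathsf{RCone}_t(e_1,p(e_2))\cup\mathsf{RCone}_t(e_2,p(e_1))$. If $\{e_1,e_2\}\cap X\neq\emptyset$ or $X$ is not feasible, return False. 2. Let $P$ be the weakest partial order over $X$ that respects $t$, and let $Q=\mathsf{Closure}(t,P,X)$ be the closure of $P$. If $Q=\bot$ (a cycle is created), return False. 3. Nondeterministically choose $i\in\{1,2\}$ (in practice, both are tried). 4. While there are $\bar e_1,\bar e_2\in X$, neither belonging to process $p(e_i)$, with $\bar e_1\Join\bar e_2$, $\bar e_1,\bar e_2$ unordered by $Q$, and $\bar e_1<_t\bar e_2$: let $Q\gets\mathsf{InsertAndClose}(Q,\bar e_1\to\bar e_2)$, i.e. order $\bar e_1\to\bar e_2$ in $Q$ and close $Q$; if $Q=\bot$ (a cycle is created), return False. 5. Return True. **Subroutines and complexity conventions.** $\mathsf{Closure}$ computes the closure of a partial order (or $\bot$) in $O(n^2\log n)$ time, and any sequence of $s$ operations $\mathsf{InsertAndClose}$ takes $O(n^2\log n+s\log n)$ time in total. The number of processes $k$ and the number of variables and locks are treated as constants in the $O$-notation.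
   Formalization: Soundness and witness construction exclude: e1 a read, e2 the initial write of its variable, and no write to it in X (false there: t = w(x), r(x) on two processes, e1 = r, e2 = w). Testing whether Q orders two events is assumed to take O(log n) time. *)

theory Defs
  imports Complex_Main "HOL-Library.Sublist" "HOL-Library.Landau_Symbols"
begin

section \<open>Events and traces\<close>

text \<open>Processes, global variables and locks are named by natural numbers; the bounds on the names
  are part of \<open>race_input\<close> below.  The identifier lets a process perform the same action
  several times as distinct events.\<close>

datatype action = Write nat | Read nat | Acquire nat | Release nat

datatype location = Var nat | Lock nat

datatype event = Event (ident: nat) (proc: nat) (act: action)

fun action_loc :: "action \<Rightarrow> location" where
  "action_loc (Write x) = Var x"
| "action_loc (Read x) = Var x"
| "action_loc (Acquire l) = Lock l"
| "action_loc (Release l) = Lock l"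

definition loc :: "event \<Rightarrow> location" where
  "loc e = action_loc (act e)"

definition is_write :: "event \<Rightarrow> bool" where
  "is_write e \<longleftrightarrow> (\<exists>x. act e = Write x)"

definition is_read :: "event \<Rightarrow> bool" where
  "is_read e \<longleftrightarrow> (\<exists>x. act e = Read x)"

definition is_acquire :: "event \<Rightarrow> bool" where
  "is_acquire e \<longleftrightarrow> (\<exists>l. act e = Acquire l)"

definition is_release :: "event \<Rightarrow> bool" where
  "is_release e \<longleftrightarrow> (\<exists>l. act e = Release l)"

definition is_access :: "event \<Rightarrow> bool" where
  "is_access e \<longleftrightarrow> is_read e \<or> is_write e"

definition is_lock_event :: "event \<Rightarrow> bool" where
  "is_lock_event e \<longleftrightarrow> is_acquire e \<or> is_release e"

definition conflicting :: "event \<Rightarrow> event \<Rightarrow> bool" where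
  "conflicting e e' \<longleftrightarrow> e \<noteq> e' \<and> loc e = loc e' \<and>
     ((is_access e \<and> is_access e' \<and> (is_write e \<or> is_write e')) \<or>
      (is_lock_event e \<and> is_lock_event e'))"

definition before :: "event list \<Rightarrow> event \<Rightarrow> event \<Rightarrow> bool" where
  "before t e e' \<longleftrightarrow> (\<exists>i j. i < j \<and> j < length t \<and> t ! i = e \<and> t ! j = e')"

definition po :: "event list \<Rightarrow> event \<Rightarrow> event \<Rightarrow> bool" where
  "po t e e' \<longleftrightarrow> before t e e' \<and> proc e = proc e'"

definition po_eq :: "event list \<Rightarrow> event \<Rightarrow> event \<Rightarrow> bool" where
  "po_eq t e e' \<longleftrightarrow> po t e e' \<or> (e = e' \<and> e \<in> set t)"

definition proj :: "event list \<Rightarrow> nat \<Rightarrow> event list" where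
  "proj t q = filter (\<lambda>e. proc e = q) t"

text \<open>The partial functions \<open>match\<close> and \<open>O\<close> are given by their graphs:
  \<open>matches t a \<rho>\<close> says that \<open>match(a)\<close> exists and is \<open>\<rho>\<close>, equivalently that \<open>match(\<rho>) = a\<close>,
  and \<open>observes t r w\<close> says that \<open>O(r) = w\<close>.\<close>

definition matches :: "event list \<Rightarrow> event \<Rightarrow> event \<Rightarrow> bool" where
  "matches t a \<rho> \<longleftrightarrow> is_acquire a \<and> is_release \<rho> \<and> loc \<rho> = loc a \<and> before t a \<rho> \<and>
     \<not> (\<exists>\<rho>'. is_release \<rho>' \<and> loc \<rho>' = loc a \<and> before t a \<rho>' \<and> before t \<rho>' \<rho>)"

definition observes :: "event list \<Rightarrow> event \<Rightarrow> event \<Rightarrow> bool" where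
  "observes t r w \<longleftrightarrow> is_read r \<and> is_write w \<and> loc w = loc r \<and> before t w r \<and>
     \<not> (\<exists>w'. is_write w' \<and> loc w' = loc r \<and> before t w w' \<and> before t w' r)"

definition is_trace :: "event list \<Rightarrow> bool" where
  "is_trace t \<longleftrightarrow> distinct t \<and>
     (\<forall>a \<rho>. matches t a \<rho> \<longrightarrow> proc \<rho> = proc a) \<and>
     (\<forall>\<rho>\<in>set t. is_release \<rho> \<longrightarrow> (\<exists>a. matches t a \<rho>)) \<and>
     (\<forall>r\<in>set t. is_read r \<longrightarrow> (\<exists>w. is_write w \<and> loc w = loc r \<and> before t w r)) \<and>
     (\<forall>a1 a2. is_acquire a1 \<longrightarrow> is_acquire a2 \<longrightarrow> loc a1 = loc a2 \<longrightarrow> before t a1 a2 \<longrightarrow>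
        (\<exists>\<rho>. matches t a1 \<rho> \<and> before t \<rho> a2))"

definition correct_reordering :: "event list \<Rightarrow> event list \<Rightarrow> bool" where
  "correct_reordering t t' \<longleftrightarrow> is_trace t' \<and> (\<forall>q. prefix (proj t' q) (proj t q)) \<and>
     (\<forall>r\<in>set t'. is_read r \<longrightarrow> (\<forall>w. observes t' r w \<longleftrightarrow> observes t r w))"


section \<open>Predictable races\<close>

definition exhibits_race :: "event list \<Rightarrow> event \<Rightarrow> event \<Rightarrow> bool" where
  "exhibits_race t e1 e2 \<longleftrightarrow> conflicting e1 e2 \<and> is_access e1 \<and> is_access e2 \<and>
     proc e1 \<noteq> proc e2 \<and> (\<exists>u v. t = u @ [e1, e2] @ v)"

definition witness_trace :: "event list \<Rightarrow> event \<Rightarrow> event \<Rightarrow> event list \<Rightarrow> bool" where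
  "witness_trace t e1 e2 ts \<longleftrightarrow> (\<exists>t'. correct_reordering t t' \<and> ts = t' @ [e1, e2] \<and>
     prefix (proj t' (proc e1) @ [e1]) (proj t (proc e1)) \<and>
     prefix (proj t' (proc e2) @ [e2]) (proj t (proc e2)) \<and>
     is_trace ts \<and> exhibits_race ts e1 e2)"

definition predictable_race :: "event list \<Rightarrow> event \<Rightarrow> event \<Rightarrow> bool" where
  "predictable_race t e1 e2 \<longleftrightarrow> e1 \<in> set t \<and> e2 \<in> set t \<and> (\<exists>ts. witness_trace t e1 e2 ts)"


section \<open>Feasible sets and closed partial orders\<close>

definition feasible :: "event list \<Rightarrow> event set \<Rightarrow> bool" where
  "feasible t X \<longleftrightarrow> X \<subseteq> set t \<and>
     (\<forall>e e'. po_eq t e e' \<longrightarrow> e' \<in> X \<longrightarrow> e \<in> X) \<and>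
     (\<forall>r w. r \<in> X \<longrightarrow> observes t r w \<longrightarrow> w \<in> X) \<and>
     (\<forall>a \<rho>. \<rho> \<in> X \<longrightarrow> matches t a \<rho> \<longrightarrow> a \<in> X) \<and>
     (\<forall>a1\<in>X. \<forall>a2\<in>X. is_acquire a1 \<longrightarrow> is_acquire a2 \<longrightarrow> a1 \<noteq> a2 \<longrightarrow>
        \<not> (\<exists>\<rho>\<in>X. matches t a1 \<rho>) \<longrightarrow> \<not> (\<exists>\<rho>\<in>X. matches t a2 \<rho>) \<longrightarrow> loc a1 \<noteq> loc a2)"

text \<open>A partial order is a reflexive relation on its carrier (\<open>partial_order_on\<close>), so \<open>Q\<close> refines
  \<open>P\<close> iff \<open>P \<subseteq> Q\<close>, and weakest means least for inclusion.\<close>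

definition strictly :: "event rel \<Rightarrow> event \<Rightarrow> event \<Rightarrow> bool" where
  "strictly P a b \<longleftrightarrow> (a, b) \<in> P \<and> a \<noteq> b"

definition respect_conditions :: "event list \<Rightarrow> event set \<Rightarrow> event rel \<Rightarrow> bool" where
  "respect_conditions t X P \<longleftrightarrow>
     (\<forall>e\<in>X. \<forall>e'\<in>X. po_eq t e e' \<longrightarrow> (e, e') \<in> P) \<and>
     (\<forall>r\<in>X. \<forall>w. observes t r w \<longrightarrow> strictly P w r) \<and>
     (\<forall>a\<in>X. \<forall>\<rho>\<in>X. is_acquire a \<longrightarrow> is_release \<rho> \<longrightarrow> loc \<rho> = loc a \<longrightarrow>
        \<not> (\<exists>\<rho>'\<in>X. matches t a \<rho>') \<longrightarrow> strictly P \<rho> a)"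

definition respects_trace :: "event list \<Rightarrow> event set \<Rightarrow> event rel \<Rightarrow> bool" where
  "respects_trace t X P \<longleftrightarrow> partial_order_on X P \<and> respect_conditions t X P"

definition observation_closed :: "event list \<Rightarrow> event set \<Rightarrow> event rel \<Rightarrow> bool" where
  "observation_closed t X P \<longleftrightarrow>
     (\<forall>r\<in>X. \<forall>w w'. observes t r w \<longrightarrow> w' \<in> X - {w} \<longrightarrow> is_write w' \<longrightarrow> conflicting w' r \<longrightarrow>
        (strictly P w' r \<longrightarrow> strictly P w' w) \<and> (strictly P w w' \<longrightarrow> strictly P r w'))"

definition lock_closed :: "event list \<Rightarrow> event set \<Rightarrow> event rel \<Rightarrow> bool" where
  "lock_closed t X P \<longleftrightarrow>
     (\<forall>\<rho>1\<in>X. \<forall>\<rho>2\<in>X. \<forall>a1 a2. \<rho>1 \<noteq> \<rho>2 \<longrightarrow> loc \<rho>1 = loc \<rho>2 \<longrightarrow>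
        matches t a1 \<rho>1 \<longrightarrow> matches t a2 \<rho>2 \<longrightarrow> (a1, \<rho>2) \<in> P \<longrightarrow> (\<rho>1, a2) \<in> P)"

definition closed_order :: "event list \<Rightarrow> event set \<Rightarrow> event rel \<Rightarrow> bool" where
  "closed_order t X P \<longleftrightarrow> respects_trace t X P \<and> observation_closed t X P \<and> lock_closed t X P"

text \<open>\<open>None\<close> plays the role of \<open>\<bottom>\<close>.\<close>

definition least_rel :: "(event rel \<Rightarrow> bool) \<Rightarrow> event rel option" where
  "least_rel \<Phi> = (if \<exists>R. \<Phi> R \<and> (\<forall>R'. \<Phi> R' \<longrightarrow> R \<subseteq> R')
                  then Some (THE R. \<Phi> R \<and> (\<forall>R'. \<Phi> R' \<longrightarrow> R \<subseteq> R')) else None)"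

definition weakest_respecting :: "event list \<Rightarrow> event set \<Rightarrow> event rel option" where
  "weakest_respecting t X = least_rel (respects_trace t X)"

text \<open>The relation \<open>R\<close> may be a partial order or merely a set of orderings that is to be respected:
  \<open>None\<close> results in particular if \<open>R\<close> has a cycle.\<close>

definition order_closure :: "event list \<Rightarrow> event set \<Rightarrow> event rel \<Rightarrow> event rel option" where
  "order_closure t X R = least_rel (\<lambda>Q. closed_order t X Q \<and> R \<subseteq> Q)"

definition insert_and_close ::
  "event list \<Rightarrow> event set \<Rightarrow> event rel \<Rightarrow> event \<Rightarrow> event \<Rightarrow> event rel option" where
  "insert_and_close t X Q a b = order_closure t X (insert (a, b) Q)"


section \<open>The algorithm\<close>

inductive_set rcone :: "event list \<Rightarrow> event \<Rightarrow> nat \<Rightarrow> event set"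
  for t :: "event list" and e :: event and q :: nat where
  pred: "po t e' e \<Longrightarrow> e' \<in> rcone t e q"
| down: "e' \<in> rcone t e q \<Longrightarrow> po_eq t e'' e' \<Longrightarrow> e'' \<in> rcone t e q"
| obs: "r \<in> rcone t e q \<Longrightarrow> observes t r w \<Longrightarrow> w \<in> rcone t e q"
| lock: "a \<in> rcone t e q \<Longrightarrow> proc a \<noteq> proc e \<Longrightarrow> proc a \<noteq> q \<Longrightarrow> matches t a \<rho> \<Longrightarrow>
    \<rho> \<in> rcone t e q"

definition open_pair ::
  "event list \<Rightarrow> event set \<Rightarrow> nat \<Rightarrow> event rel \<Rightarrow> event \<Rightarrow> event \<Rightarrow> bool" where
  "open_pair t X q Q a b \<longleftrightarrow> a \<in> X \<and> b \<in> X \<and> proc a \<noteq> q \<and> proc b \<noteq> q \<and> conflicting a b \<and>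
     (a, b) \<notin> Q \<and> (b, a) \<notin> Q \<and> before t a b"

text \<open>Runs of the while loop that starts with \<open>Q\<close> and leaves out the process \<open>q\<close>.  A run that
  returns True is recorded by \<open>Some (X, Q')\<close>, where \<open>Q'\<close> is the order held at the end, and
  a run that returns False by \<open>None\<close>.\<close>

inductive saturate ::
  "event list \<Rightarrow> event set \<Rightarrow> nat \<Rightarrow> event rel \<Rightarrow> (event set \<times> event rel) option \<Rightarrow> bool"
  for t :: "event list" and X :: "event set" and q :: nat where
  exit: "\<nexists>a b. open_pair t X q Q a b \<Longrightarrow> saturate t X q Q (Some (X, Q))"
| cycle: "open_pair t X q Q a b \<Longrightarrow> insert_and_close t X Q a b = None \<Longrightarrow> saturate t X q Q None"
| step: "open_pair t X q Q a b \<Longrightarrow> insert_and_close t X Q a b = Some Q' \<Longrightarrow>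
    saturate t X q Q' res \<Longrightarrow> saturate t X q Q res"

text \<open>\<open>race_decision t e1 e2 i res\<close>: some run that chooses \<open>i\<close> ends with the outcome \<open>res\<close>,
  encoded as for \<open>saturate\<close>.\<close>

definition race_decision ::
  "event list \<Rightarrow> event \<Rightarrow> event \<Rightarrow> nat \<Rightarrow> (event set \<times> event rel) option \<Rightarrow> bool" where
  "race_decision t e1 e2 i res \<longleftrightarrow> i \<in> {1, 2} \<and>
     (let X = rcone t e1 (proc e2) \<union> rcone t e2 (proc e1) in
      if {e1, e2} \<inter> X \<noteq> {} \<or> \<not> feasible t X then res = None
      else case weakest_respecting t X of
          None \<Rightarrow> res = None
        | Some P \<Rightarrow> (case order_closure t X P of
              None \<Rightarrow> res = None
            | Some Q \<Rightarrow> saturate t X (proc (if i = 1 then e1 else e2)) Q res))"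

definition starts_with_writes :: "nat \<Rightarrow> event list \<Rightarrow> bool" where
  "starts_with_writes nv t \<longleftrightarrow> act ` set (take nv t) = Write ` {..<nv}"

text \<open>Nothing makes the initial write to \<open>x\<close> precede a read of \<open>x\<close> by another process.  If \<open>e1\<close> is
  such a read and \<open>e2\<close> the initial write itself, then \<open>e1\<close> can be scheduled right before \<open>e2\<close>
  only after some other write to \<open>x\<close>.  The algorithm does not look for such a write, and answers
  True for example on the trace consisting of a write to \<open>x\<close> by process 0 and a read of \<open>x\<close>
  by process 1, with \<open>e1\<close> the read and \<open>e2\<close> the write: there the only candidate for a
  witness starts with a read and hence is not a trace.  The following predicate excludes that
  situation and holds in all other cases.\<close>

definition read_is_initialised ::
  "nat \<Rightarrow> event list \<Rightarrow> event set \<Rightarrow> event \<Rightarrow> event \<Rightarrow> bool" where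
  "read_is_initialised nv t X e1 e2 \<longleftrightarrow>
     (is_read e1 \<longrightarrow> e2 \<in> set (take nv t) \<longrightarrow> (\<exists>w\<in>X. is_write w \<and> loc w = loc e1))"

definition within_bounds :: "nat \<Rightarrow> nat \<Rightarrow> nat \<Rightarrow> event \<Rightarrow> bool" where
  "within_bounds k nv nl e \<longleftrightarrow> proc e < k \<and>
     (case loc e of Var x \<Rightarrow> x < nv | Lock l \<Rightarrow> l < nl)"

definition race_input ::
  "nat \<Rightarrow> nat \<Rightarrow> nat \<Rightarrow> event list \<Rightarrow> event \<Rightarrow> event \<Rightarrow> bool" where
  "race_input k nv nl t e1 e2 \<longleftrightarrow> k \<ge> 2 \<and> is_trace t \<and> (\<forall>e\<in>set t. within_bounds k nv nl e) \<and>
     starts_with_writes nv t \<and> e1 \<in> set t \<and> e2 \<in> set t \<and>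
     is_access e1 \<and> is_access e2 \<and> conflicting e1 e2"


section \<open>Programs and their running time\<close>

text \<open>A unit-cost random access machine: finitely many named arrays of natural numbers, with
  addition and truncated subtraction as the only arithmetic, a scalar being cell 0 of an array.
  One partial order is held outside of the arrays, and the program reaches it only through
  the subroutines.  Events are addressed by their position in the input trace.\<close>

datatype exp = Num nat | Cell string exp | Plus exp exp | Minus exp exp

datatype test = Less exp exp | Equal exp exp | Neg test | Conj test test

datatype com =
    Skip
  | Assign string exp exp
  | Seq com com
  | Cond test com com
  | While test com
  | Closure string exp string string string
  | InsertAndClose exp exp string
  | Query exp exp string

type_synonym memory = "string \<Rightarrow> nat \<Rightarrow> nat"

fun val :: "memory \<Rightarrow> exp \<Rightarrow> nat" where
  "val m (Num c) = c"
| "val m (Cell A e) = m A (val m e)"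
| "val m (Plus e e') = val m e + val m e'"
| "val m (Minus e e') = val m e - val m e'"

fun holds :: "memory \<Rightarrow> test \<Rightarrow> bool" where
  "holds m (Less e e') \<longleftrightarrow> val m e < val m e'"
| "holds m (Equal e e') \<longleftrightarrow> val m e = val m e'"
| "holds m (Neg b) \<longleftrightarrow> \<not> holds m b"
| "holds m (Conj b b') \<longleftrightarrow> holds m b \<and> holds m b'"

text \<open>The last four fields only count; no command reads them.\<close>

record state =
  mem :: memory
  held :: "(event set \<times> event rel) option"
  steps :: nat
  closures :: nat
  insertions :: nat
  queries :: nat

definition tick :: "nat \<Rightarrow> state \<Rightarrow> state" where
  "tick m s = s\<lparr>steps := steps s + m\<rparr>"

definition store :: "string \<Rightarrow> nat \<Rightarrow> nat \<Rightarrow> state \<Rightarrow> state" where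
  "store A j x s = s\<lparr>mem := (mem s)(A := (mem s A)(j := x))\<rparr>"

definition hold :: "(event set \<times> event rel) option \<Rightarrow> string \<Rightarrow> state \<Rightarrow> state" where
  "hold res A s = store A 0 (if res = None then 0 else 1) (s\<lparr>held := res\<rparr>)"

definition marked_events :: "event list \<Rightarrow> memory \<Rightarrow> string \<Rightarrow> event set" where
  "marked_events t m A = {t ! j | j. j < length t \<and> m A j \<noteq> 0}"

definition listed_edges :: "event list \<Rightarrow> memory \<Rightarrow> nat \<Rightarrow> string \<Rightarrow> string \<Rightarrow> event rel" where
  "listed_edges t m len A B = {(t ! m A j, t ! m B j) | j. j < len}"

text \<open>\<open>Closure A n B C D\<close> computes the closure of a partial order \<open>P\<close> over \<open>X\<close>, where \<open>A\<close> marks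
  the positions of the events in \<open>X\<close> and \<open>P\<close> is generated by the first \<open>n\<close> edges with source
  positions in \<open>B\<close> and target positions in \<open>C\<close>.  The program must make sure that \<open>X\<close> is feasible
  and that the generated relation meets the conditions for respecting \<open>t\<close>; otherwise
  it is stuck.  A cycle among the edges makes the closure \<open>\<bottom>\<close>.  Reading an edge costs one step.
  Whether a subroutine returned \<open>\<bottom>\<close>, and the answer to a query, is put in cell 0 of the last
  argument.  Execution is deterministic.\<close>

inductive exec :: "event list \<Rightarrow> com \<Rightarrow> state \<Rightarrow> state \<Rightarrow> bool" for t :: "event list" where
  Skip: "exec t Skip s (tick 1 s)"
| Assign: "exec t (Assign A i e) s (tick 1 (store A (val (mem s) i) (val (mem s) e) s))"
| Seq: "exec t c s s1 \<Longrightarrow> exec t c' s1 s2 \<Longrightarrow> exec t (Seq c c') s s2"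
| Cond: "exec t (if holds (mem s) b then c else c') (tick 1 s) s1 \<Longrightarrow> exec t (Cond b c c') s s1"
| WhileFalse: "\<not> holds (mem s) b \<Longrightarrow> exec t (While b c) s (tick 1 s)"
| WhileTrue: "holds (mem s) b \<Longrightarrow> exec t c (tick 1 s) s1 \<Longrightarrow> exec t (While b c) s1 s2 \<Longrightarrow>
    exec t (While b c) s s2"
| Closure: "X = marked_events t (mem s) A \<Longrightarrow> len = val (mem s) n \<Longrightarrow>
    \<forall>j<len. mem s B j < length t \<and> mem s C j < length t \<Longrightarrow>
    R = listed_edges t (mem s) len B C \<Longrightarrow> R \<subseteq> X \<times> X \<Longrightarrow> P = R\<^sup>+ \<union> Id_on X \<Longrightarrow>
    feasible t X \<Longrightarrow> respect_conditions t X P \<Longrightarrow>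
    exec t (Closure A n B C D) s
      (tick (1 + len) (hold (map_option (Pair X) (order_closure t X P)) D
        (s\<lparr>closures := closures s + 1\<rparr>)))"
| InsertAndClose: "held s = Some (X, Q) \<Longrightarrow> i = val (mem s) ei \<Longrightarrow> j = val (mem s) ej \<Longrightarrow>
    i < length t \<Longrightarrow> j < length t \<Longrightarrow> t ! i \<in> X \<Longrightarrow> t ! j \<in> X \<Longrightarrow>
    exec t (InsertAndClose ei ej D) s
      (tick 1 (hold (map_option (Pair X) (insert_and_close t X Q (t ! i) (t ! j))) D
        (s\<lparr>insertions := insertions s + 1\<rparr>)))"
| Query: "held s = Some (X, Q) \<Longrightarrow> i = val (mem s) ei \<Longrightarrow> j = val (mem s) ej \<Longrightarrow>
    i < length t \<Longrightarrow> j < length t \<Longrightarrow>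
    exec t (Query ei ej D) s
      (tick 1 (store D 0 (if (t ! i, t ! j) \<in> Q then 1 else 0) (s\<lparr>queries := queries s + 1\<rparr>)))"

definition scalar :: "nat \<Rightarrow> nat \<Rightarrow> nat" where
  "scalar x = (\<lambda>j. if j = 0 then x else 0)"

definition table :: "(event \<Rightarrow> nat) \<Rightarrow> event list \<Rightarrow> nat \<Rightarrow> nat" where
  "table f t = (\<lambda>j. if j < length t then f (t ! j) else 0)"

fun action_code :: "action \<Rightarrow> nat" where
  "action_code (Write x) = 0"
| "action_code (Read x) = 1"
| "action_code (Acquire l) = 2"
| "action_code (Release l) = 3"

fun loc_code :: "location \<Rightarrow> nat" where
  "loc_code (Var x) = x"
| "loc_code (Lock l) = l"

definition input_memory ::
  "nat \<Rightarrow> nat \<Rightarrow> nat \<Rightarrow> event list \<Rightarrow> nat \<Rightarrow> nat \<Rightarrow> nat \<Rightarrow> memory" where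
  "input_memory k nv nl t j1 j2 i = (\<lambda>A j. 0)
     (''n'' := scalar (length t), ''processes'' := scalar k, ''variables'' := scalar nv,
      ''locks'' := scalar nl, ''e1'' := scalar j1, ''e2'' := scalar j2, ''i'' := scalar i,
      ''proc'' := table proc t, ''type'' := table (\<lambda>e. action_code (act e)) t,
      ''loc'' := table (\<lambda>e. loc_code (loc e)) t)"

definition start_state :: "memory \<Rightarrow> (event set \<times> event rel) option \<Rightarrow> state" where
  "start_state m h =
     \<lparr>mem = m, held = h, steps = 0, closures = 0, insertions = 0, queries = 0\<rparr>"

definition output_events :: "event list \<Rightarrow> state \<Rightarrow> event list" where
  "output_events t s = map (\<lambda>j. t ! mem s ''out'' j) [0..<mem s ''len'' 0]"

text \<open>\<open>tc n\<close> is the time of one closure, \<open>ti n s\<close> the total time of \<open>s\<close> operations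
  \<open>InsertAndClose\<close>, and \<open>tq n\<close> the time to look up whether two events are ordered.\<close>

definition subroutine_times :: "(nat \<Rightarrow> nat) \<Rightarrow> (nat \<Rightarrow> nat \<Rightarrow> nat) \<Rightarrow> (nat \<Rightarrow> nat) \<Rightarrow> bool" where
  "subroutine_times tc ti tq \<longleftrightarrow>
     (\<lambda>n. real (tc n)) \<in> O(\<lambda>n. real n ^ 2 * ln (real n)) \<and>
     (\<exists>c. \<forall>n\<ge>2. \<forall>s. real (ti n s) \<le> c * (real n ^ 2 * ln (real n) + real s * ln (real n))) \<and>
     (\<forall>n. ti n 0 = 0) \<and>
     (\<lambda>n. real (tq n)) \<in> O(\<lambda>n. ln (real n))"

definition running_time ::
  "(nat \<Rightarrow> nat) \<Rightarrow> (nat \<Rightarrow> nat \<Rightarrow> nat) \<Rightarrow> (nat \<Rightarrow> nat) \<Rightarrow> nat \<Rightarrow> state \<Rightarrow> nat" where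
  "running_time tc ti tq n s =
     steps s + closures s * tc n + ti n (insertions s) + queries s * tq n"

end

theory Submission
  imports Defs "HOL-Real_Asymp.Real_Asymp"
begin

text \<open>Let \<open>Q\<close> be the closed order at the end of a successful run that leaves out the process \<open>q\<close>,
  and linearize \<open>Q\<close> so that events of \<open>q\<close> come as late as possible: an event of \<open>q\<close> precedes an
  event of another process only if \<open>Q\<close> says so.  Conflicting events that \<open>Q\<close> leaves unordered then
  appear with the event of \<open>q\<close> last.  If the linearization broke an observation or a critical
  section, two pairs unordered by \<open>Q\<close> would be involved, and one and the same process (or event)
  would have to be \<open>q\<close> for the one pair and different from \<open>q\<close> for the other.  Hence the
      linearization
  is a correct reordering.

  With two processes the cones are exactly the events of any witness without its last two, whose
  order is closed, and the events outside of \<open>q\<close> are totally ordered from the start; so no run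
      fails.

  The decision program is dominated by loops over all pairs of events.  The linearization is
  computed greedily from the least remaining events of the processes, with a number of
  queries per event that depends on the number of processes only.\<close>

section \<open>Traces\<close>

text \<open>The delay of \<open>q\<close> explains the form of the loop: conflicting pairs that
  involve \<open>q\<close> may stay unordered, since the linearization settles them, whereas pairs
  that avoid \<open>q\<close> must all be ordered by \<open>Q\<close>. A reading \<open>e1\<close>
  is an obstacle of its own, since no event of \<open>X\<close> has to write its variable. Initial
  writes of processes other than those of \<open>e1\<close> and \<open>e2\<close> can be appended
  for this purpose, and those of the two processes lie in the cones; only if \<open>e2\<close> is
  itself the initial write can nothing be supplied, whence \<open>read_is_initialised\<close>. A
  closure exists as soon as some closed order extends the given edges, because closed orders are
  stable under nonempty intersections. One pass over all pairs exhausts the loop, because orders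
  only grow and an ordered pair never becomes open again. The pass makes O(n^2) queries and
  insertions, of total cost O(n^2 log n). The witness is cheaper because a minimal remaining event
  is found among at most \<open>k\<close> heads.\<close>

lemma before_in_set: "before t a b \<Longrightarrow> a \<in> set t \<and> b \<in> set t"
  by (auto simp: before_def)

lemma before_nth:
  assumes "distinct t" "i < length t" "j < length t"
  shows "before t (t ! i) (t ! j) \<longleftrightarrow> i < j"
  using assms by (auto simp: before_def nth_eq_iff_index_eq)

lemma before_trans: "distinct t \<Longrightarrow> before t a b \<Longrightarrow> before t b c \<Longrightarrow> before t a c"
  unfolding before_def by (metis dual_order.strict_trans nth_eq_iff_index_eq order.strict_trans)

lemma before_irrefl: "distinct t \<Longrightarrow> \<not> before t a a"
  by (auto simp: before_def nth_eq_iff_index_eq)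

lemma before_asym: "distinct t \<Longrightarrow> before t a b \<Longrightarrow> \<not> before t b a"
  using before_trans before_irrefl by blast

lemma before_total: "a \<in> set t \<Longrightarrow> b \<in> set t \<Longrightarrow> a \<noteq> b \<Longrightarrow> before t a b \<or> before t b a"
  by (metis before_def in_set_conv_nth nat_neq_iff)

lemma before_Nil [simp]: "\<not> before [] a b"
  by (auto simp: before_def)

lemma before_Cons: "before (x # xs) a b \<longleftrightarrow> (a = x \<and> b \<in> set xs) \<or> before xs a b"
proof
  assume "before (x # xs) a b"
  then obtain i j where "i < j" "j < length (x # xs)" "(x # xs) ! i = a" "(x # xs) ! j = b"
    by (auto simp: before_def)
  then show "(a = x \<and> b \<in> set xs) \<or> before xs a b"
    by (cases i; cases j) (auto simp: before_def)
next
  assume "(a = x \<and> b \<in> set xs) \<or> before xs a b"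
  then show "before (x # xs) a b"
  proof
    assume "a = x \<and> b \<in> set xs"
    then obtain j where "j < length xs" "xs ! j = b" "a = x" by (auto simp: in_set_conv_nth)
    then show ?thesis unfolding before_def by (intro exI[of _ 0] exI[of _ "Suc j"]) auto
  next
    assume "before xs a b"
    then obtain i j where "i < j" "j < length xs" "xs ! i = a" "xs ! j = b"
      by (auto simp: before_def)
    then show ?thesis unfolding before_def by (intro exI[of _ "Suc i"] exI[of _ "Suc j"]) auto
  qed
qed

lemma before_append:
  "before (xs @ ys) a b \<longleftrightarrow> before xs a b \<or> before ys a b \<or> (a \<in> set xs \<and> b \<in> set ys)"
  by (induction xs) (auto simp: before_Cons)

lemma before_filter: "before (filter P xs) a b \<longleftrightarrow> before xs a b \<and> P a \<and> P b"
  by (induction xs) (auto simp: before_Cons dest: before_in_set)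

lemma before_proj: "before (proj t q) a b \<longleftrightarrow> before t a b \<and> proc a = q \<and> proc b = q"
  by (simp add: proj_def before_filter)

lemma sorted_wrt_before: "sorted_wrt G xs \<Longrightarrow> before xs a b \<Longrightarrow> G a b"
  by (induction xs) (auto simp: before_Cons)

text \<open>For duplicate-free lists a prefix is a down-set of the longer list that keeps its order.
  This trades the recursive predicate \<open>prefix\<close> for the conditions on program order that
  correct reorderings are about.\<close>

lemma prefix_by_before:
  assumes "distinct xs" "distinct ys" "set xs \<subseteq> set ys"
    and "\<And>a b. before ys a b \<Longrightarrow> b \<in> set xs \<Longrightarrow> a \<in> set xs"
    and "\<And>a b. before ys a b \<Longrightarrow> a \<in> set xs \<Longrightarrow> b \<in> set xs \<Longrightarrow> before xs a b"
  shows "prefix xs ys"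
  using assms
proof (induction ys arbitrary: xs)
  case Nil
  then show ?case by simp
next
  case (Cons y ys)
  show ?case
  proof (cases xs)
    case Nil
    then show ?thesis by simp
  next
    case (Cons x xs')
    \<comment> \<open>The head \<open>y\<close> precedes every other element of
      \<open>y # ys\<close>, so it belongs to the nonempty down-set \<open>xs\<close>.\<close>
    have y: "y \<in> set xs" using Cons Cons.prems(3,4) by (fastforce simp: before_Cons)
    have "x = y"
    proof (rule ccontr)
      assume "x \<noteq> y"
      then have "before (y # ys) y x" using Cons Cons.prems(3) by (auto simp: before_Cons)
      then have "before xs y x" using Cons.prems(5) y Cons by auto
      then show False using Cons Cons.prems(1) \<open>x \<noteq> y\<close> by (auto simp: before_Cons dest:
          before_in_set)
    qed
    moreover have "prefix xs' ys"
    proof (rule Cons.IH)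
      show "distinct xs'" "distinct ys" "set xs' \<subseteq> set ys"
        using Cons Cons.prems(1-3) \<open>x = y\<close> by auto
      fix a b assume ab: "before ys a b"
      then have "a \<in> set ys" by (auto dest: before_in_set)
      then have "a \<noteq> y" using Cons.prems(2) by auto
      { assume "b \<in> set xs'"
        then show "a \<in> set xs'"
          using Cons.prems(4)[of a b] ab \<open>a \<noteq> y\<close> \<open>x = y\<close> Cons by (auto simp: before_Cons) }
      assume "a \<in> set xs'" "b \<in> set xs'"
      then show "before xs' a b"
        using Cons.prems(5)[of a b] ab \<open>a \<noteq> y\<close> \<open>x = y\<close> Cons by (auto simp: before_Cons)
    qed
    ultimately show ?thesis using Cons by simp
  qed
qed

lemma prefix_proj_by_before:
  assumes "distinct u" "distinct t" "set u \<subseteq> set t"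
    and "\<And>a b. po t a b \<Longrightarrow> b \<in> set u \<Longrightarrow> a \<in> set u"
    and "\<And>a b. po t a b \<Longrightarrow> a \<in> set u \<Longrightarrow> b \<in> set u \<Longrightarrow> before u a b"
  shows "prefix (proj u q) (proj t q)"
proof (rule prefix_by_before)
  fix a b assume ab: "before (proj t q) a b"
  then have "po t a b" by (auto simp: before_proj po_def)
  have q: "proc a = q" "proc b = q" using ab by (auto simp: before_proj)
  { assume "b \<in> set (proj u q)"
    then show "a \<in> set (proj u q)" using q assms(4)[OF \<open>po t a b\<close>] by (auto simp: proj_def) }
  assume "a \<in> set (proj u q)" "b \<in> set (proj u q)"
  then show "before (proj u q) a b"
    using q assms(5)[OF \<open>po t a b\<close>] unfolding before_proj by (auto simp: proj_def)
qed (use assms(1-3) in \<open>auto simp: proj_def\<close>)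

text \<open>An event of the prefix does not occur a second time, so its predecessors in
  \<open>ys\<close> are confined to \<open>xs\<close>.\<close>

lemma prefix_before:
  assumes "prefix xs ys" "distinct ys" "b \<in> set xs"
  shows "before ys a b \<longleftrightarrow> before xs a b"
proof -
  obtain zs where ys: "ys = xs @ zs" using assms(1) by (auto simp: prefix_def)
  then have "b \<notin> set zs" using assms(2,3) by auto
  then show ?thesis unfolding ys before_append using before_in_set by blast
qed

section \<open>Observed writes and matching lock events\<close>

lemma observes_unique: "distinct t \<Longrightarrow> observes t r w \<Longrightarrow> observes t r w' \<Longrightarrow> w = w'"
  unfolding observes_def by (metis before_in_set before_total)

lemma matches_unique: "distinct t \<Longrightarrow> matches t a \<rho> \<Longrightarrow> matches t a \<rho>' \<Longrightarrow> \<rho> = \<rho>'"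
  unfolding matches_def by (metis before_in_set before_total)

lemma matches_in_set: "matches t a \<rho> \<Longrightarrow> a \<in> set t \<and> \<rho> \<in> set t"
  by (auto simp: matches_def dest: before_in_set)

lemma event_kinds:
  "is_acquire e \<Longrightarrow> \<not> is_release e" "is_access e \<Longrightarrow> \<not> is_acquire e" "is_access e \<Longrightarrow> \<not> is_release e"
  "is_read e \<Longrightarrow> \<not> is_write e"
  by (auto simp: is_acquire_def is_release_def is_access_def is_read_def is_write_def)

lemma trace_distinct: "is_trace t \<Longrightarrow> distinct t"
  by (simp add: is_trace_def)

lemma trace_match_proc: "is_trace t \<Longrightarrow> matches t a \<rho> \<Longrightarrow> proc \<rho> = proc a"
  unfolding is_trace_def by blast

lemma trace_match_po: "is_trace t \<Longrightarrow> matches t a \<rho> \<Longrightarrow> po t a \<rho>"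
  using trace_match_proc by (auto simp: po_def matches_def)

lemma trace_release_matched:
  "is_trace t \<Longrightarrow> \<rho> \<in> set t \<Longrightarrow> is_release \<rho> \<Longrightarrow> \<exists>a. matches t a \<rho>"
  unfolding is_trace_def by blast

text \<open>The trace condition provides some matching release of the earlier acquire; uniqueness of
  matches identifies it with the given one.\<close>

lemma trace_mutex:
  assumes "is_trace t" "matches t a \<rho>" "is_acquire a'" "loc a' = loc a" "before t a a'"
  shows "before t \<rho> a'"
proof -
  have "is_acquire a" using assms(2) by (simp add: matches_def)
  then obtain \<rho>' where "matches t a \<rho>'" "before t \<rho>' a'"
    using assms(1,3,4,5) unfolding is_trace_def by metis
  then show ?thesis using matches_unique assms(1,2) trace_distinct by blast
qed

text \<open>Of two acquires that share a release, the later one would come after that release by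
  mutual exclusion, and before it by being matched with it.\<close>

lemma trace_acquire_unique:
  assumes "is_trace t" "matches t a \<rho>" "matches t a' \<rho>"
  shows "a = a'"
proof (rule ccontr)
  assume ne: "a \<noteq> a'"
  have d: "distinct t" using assms(1) by (rule trace_distinct)
  have *: False if "matches t b \<rho>" "matches t b' \<rho>" "before t b b'" for b b'
  proof -
    have "before t \<rho> b'" using trace_mutex[OF assms(1) that(1) _ _ that(3)] that(1,2)
      by (auto simp: matches_def)
    moreover have "before t b' \<rho>" using that by (auto simp: matches_def)
    ultimately show False using d before_asym by blast
  qed
  show False using before_total[of a t a'] ne matches_in_set assms(2,3) * by blast
qed

lemma trace_read_observes:
  assumes "is_trace t" "r \<in> set t" "is_read r"
  shows "\<exists>w. observes t r w"
proof -
  \<comment> \<open>The trace condition only gives some earlier write; the one with the largest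
    position is the observed one.\<close>
  let ?W = "{i. i < length t \<and> is_write (t ! i) \<and> loc (t ! i) = loc r \<and> before t (t ! i) r}"
  have d: "distinct t" using assms(1) by (rule trace_distinct)
  obtain w where "is_write w" "loc w = loc r" "before t w r"
    using assms unfolding is_trace_def by blast
  then have "?W \<noteq> {}" using before_in_set[of t w r] by (auto simp: in_set_conv_nth)
  moreover have "finite ?W" by simp
  ultimately have M: "Max ?W \<in> ?W" by (rule Max_in[rotated])
  have "observes t r (t ! Max ?W)"
    unfolding observes_def
  proof (intro conjI notI)
    show "is_read r" "is_write (t ! Max ?W)" "loc (t ! Max ?W) = loc r" "before t (t ! Max ?W) r"
      using M assms(3) by auto
    assume "\<exists>w'. is_write w' \<and> loc w' = loc r \<and> before t (t ! Max ?W) w' \<and> before t w' r"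
    then obtain w' where w': "is_write w'" "loc w' = loc r" "before t (t ! Max ?W) w'"
        "before t w' r"
      by blast
    then obtain j where j: "j < length t" "t ! j = w'" by (metis before_in_set in_set_conv_nth)
    then have "j \<in> ?W" using w' by auto
    then have "j \<le> Max ?W" by simp
    moreover have "Max ?W < j" using w'(3) j before_nth[OF d, of "Max ?W" j] M by auto
    ultimately show False by simp
  qed
  then show ?thesis by blast
qed

text \<open>An access neither matches nor separates lock events, so \<open>matches\<close> is
  unchanged by appending it, and only the condition on reads has something new to check.\<close>

lemma trace_snoc_access:
  assumes "is_trace u" "is_access e" "e \<notin> set u"
    and "is_read e \<Longrightarrow> \<exists>w\<in>set u. is_write w \<and> loc w = loc e"
  shows "is_trace (u @ [e])"
proof -
  have b: "before (u @ [e]) a c \<longleftrightarrow> before u a c \<or> (a \<in> set u \<and> c = e)" for a c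
    by (auto simp: before_append before_Cons)
  have ne: "\<not> before u e c" "\<not> before u c e" for c using assms(3) before_in_set by blast+
  have l: "\<not> is_release e" "\<not> is_acquire e" using assms(2) event_kinds by blast+
  have m: "matches (u @ [e]) a \<rho> \<longleftrightarrow> matches u a \<rho>" for a \<rho>
    unfolding matches_def b using l by blast
  show ?thesis
    unfolding is_trace_def m b
  proof (intro conjI allI impI ballI)
    show "distinct (u @ [e])" using assms(1,3) trace_distinct by auto
    show "proc \<rho> = proc a" if "matches u a \<rho>" for a \<rho> using trace_match_proc assms(1) that .
    show "\<exists>a. matches u a \<rho>" if "\<rho> \<in> set (u @ [e])" "is_release \<rho>" for \<rho>
      using that l trace_release_matched[OF assms(1)] by auto
    show "\<exists>w. is_write w \<and> loc w = loc r \<and> (before u w r \<or> w \<in> set u \<and> r = e)"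
      if "r \<in> set (u @ [e])" "is_read r" for r
    proof (cases "r = e")
      case True
      then show ?thesis using assms(4) that(2) by blast
    next
      case False
      then show ?thesis using assms(1) that unfolding is_trace_def by auto
    qed
    show "\<exists>\<rho>. matches u a1 \<rho> \<and> (before u \<rho> a2 \<or> \<rho> \<in> set u \<and> a2 = e)"
      if "is_acquire a1" "is_acquire a2" "loc a1 = loc a2" "before u a1 a2 \<or> a1 \<in> set u \<and> a2 = e"
      for a1 a2
      using assms(1) that l unfolding is_trace_def by metis
  qed
qed

lemma trace_append_writes:
  assumes "is_trace u" "distinct (u @ es)" "\<forall>e\<in>set es. is_write e"
  shows "is_trace (u @ es)"
  using assms(2,3)
proof (induction es rule: rev_induct)
  case Nil
  then show ?case using assms(1) by simp
next
  case (snoc e es)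
  then have "is_trace (u @ es)" by simp
  then have "is_trace ((u @ es) @ [e])"
    using snoc.prems by (intro trace_snoc_access) (auto simp: is_access_def dest: event_kinds)
  then show ?case by simp
qed

section \<open>Closed orders\<close>

lemma least_rel_Some:
  "least_rel \<Phi> = Some R \<longleftrightarrow> \<Phi> R \<and> (\<forall>R'. \<Phi> R' \<longrightarrow> R \<subseteq> R')"
proof -
  have u: "R1 = R2" if "\<Phi> R1 \<and> (\<forall>R'. \<Phi> R' \<longrightarrow> R1 \<subseteq> R')" "\<Phi> R2 \<and> (\<forall>R'. \<Phi> R' \<longrightarrow> R2 \<subseteq> R')" for R1 R2
    using that by blast
  show ?thesis
  proof
    assume l: "least_rel \<Phi> = Some R"
    then obtain R0 where R0: "\<Phi> R0 \<and> (\<forall>R'. \<Phi> R' \<longrightarrow> R0 \<subseteq> R')"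
      unfolding least_rel_def by (auto split: if_splits)
    then have "(THE R. \<Phi> R \<and> (\<forall>R'. \<Phi> R' \<longrightarrow> R \<subseteq> R')) = R0" using u by (intro the_equality)
    then show "\<Phi> R \<and> (\<forall>R'. \<Phi> R' \<longrightarrow> R \<subseteq> R')" using l R0 unfolding least_rel_def by (auto split:
        if_splits)
  next
    assume R: "\<Phi> R \<and> (\<forall>R'. \<Phi> R' \<longrightarrow> R \<subseteq> R')"
    then have "(THE R. \<Phi> R \<and> (\<forall>R'. \<Phi> R' \<longrightarrow> R \<subseteq> R')) = R" using u by (intro the_equality)
    then show "least_rel \<Phi> = Some R" using R unfolding least_rel_def by auto
  qed
qed

text \<open>The intersection of all solutions is the least one. Nonemptiness of \<open>F\<close>
  matters: the empty family has intersection \<open>UNIV\<close>, which is not a relation over the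
  carrier.\<close>

lemma least_rel_exists:
  assumes "\<Phi> R" and "\<And>F. F \<noteq> {} \<Longrightarrow> (\<And>R. R \<in> F \<Longrightarrow> \<Phi> R) \<Longrightarrow> \<Phi> (\<Inter>F)"
  shows "\<exists>R'. least_rel \<Phi> = Some R'"
proof -
  have "\<Phi> (\<Inter>{R. \<Phi> R})" using assms by (intro assms(2)) auto
  then have "least_rel \<Phi> = Some (\<Inter>{R. \<Phi> R})" unfolding least_rel_Some by blast
  then show ?thesis by blast
qed

lemma partial_order_Inter:
  assumes "F \<noteq> {}" "\<And>R. R \<in> F \<Longrightarrow> partial_order_on X R"
  shows "partial_order_on X (\<Inter>F)"
proof -
  obtain R0 where "R0 \<in> F" using assms(1) by blast
  have *: "R \<subseteq> X \<times> X" "refl_on X R" "trans R" "antisym R" if "R \<in> F" for R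
    using assms(2)[OF that] by (auto simp: partial_order_on_def preorder_on_def)
  have "trans (\<Inter>F)" using *(3) unfolding trans_def by blast
  moreover have "antisym (\<Inter>F)" using *(4)[OF \<open>R0 \<in> F\<close>] \<open>R0 \<in> F\<close> unfolding antisym_def by blast
  moreover have "refl_on X (\<Inter>F)" using *(2) unfolding refl_on_def by blast
  moreover have "\<Inter>F \<subseteq> X \<times> X" using *(1)[OF \<open>R0 \<in> F\<close>] \<open>R0 \<in> F\<close> by blast
  ultimately show ?thesis by (simp add: partial_order_on_def preorder_on_def)
qed

lemma respects_trace_Inter:
  assumes "F \<noteq> {}" "\<And>R. R \<in> F \<Longrightarrow> respects_trace t X R"
  shows "respects_trace t X (\<Inter>F)"
proof -
  have c: "respect_conditions t X R" if "R \<in> F" for R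
    using assms(2)[OF that] unfolding respects_trace_def by blast
  have "respect_conditions t X (\<Inter>F)"
    unfolding respect_conditions_def
  proof (intro conjI ballI allI impI)
    fix a b assume "a \<in> X" "b \<in> X" "po_eq t a b"
    then show "(a, b) \<in> \<Inter>F" using c unfolding respect_conditions_def by blast
  next
    fix r w assume "r \<in> X" "observes t r w"
    then have "strictly R w r" if "R \<in> F" for R using c[OF that] unfolding respect_conditions_def
        by blast
    then show "strictly (\<Inter>F) w r" using assms(1) unfolding strictly_def by blast
  next
    fix a \<rho> assume "a \<in> X" "\<rho> \<in> X" "is_acquire a" "is_release \<rho>" "loc \<rho> = loc a"
      "\<not> (\<exists>\<rho>'\<in>X. matches t a \<rho>')"
    then have "strictly R \<rho> a" if "R \<in> F" for R
      using c[OF that] unfolding respect_conditions_def by blast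
    then show "strictly (\<Inter>F) \<rho> a" using assms(1) unfolding strictly_def by blast
  qed
  then show ?thesis
    using partial_order_Inter assms unfolding respects_trace_def by blast
qed

text \<open>Every clause of closedness derives order facts from order facts or from facts about
  \<open>t\<close>, and such clauses are inherited by intersections. The disequality in
  \<open>strictly\<close> does not mention the order, so it passes through as well.\<close>

lemma closed_order_Inter:
  assumes "F \<noteq> {}" "\<And>R. R \<in> F \<Longrightarrow> closed_order t X R"
  shows "closed_order t X (\<Inter>F)"
proof -
  have "observation_closed t X (\<Inter>F)"
    unfolding observation_closed_def
  proof (intro ballI allI impI conjI)
    fix r w w' assume r: "r \<in> X" "observes t r w" "w' \<in> X - {w}" "is_write w'" "conflicting w' r"
    have R: "(strictly R w' r \<longrightarrow> strictly R w' w) \<and> (strictly R w w' \<longrightarrow> strictly R r w')" if "R \<in> F"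
        for R
      using assms(2)[OF that] r unfolding closed_order_def observation_closed_def by blast
    have I: "strictly (\<Inter>F) a b \<longleftrightarrow> (\<forall>R\<in>F. strictly R a b)" for a b
      using assms(1) unfolding strictly_def by blast
    show "strictly (\<Inter>F) w' w" if "strictly (\<Inter>F) w' r" using that R unfolding I by blast
    show "strictly (\<Inter>F) r w'" if "strictly (\<Inter>F) w w'" using that R unfolding I by blast
  qed
  moreover have "lock_closed t X (\<Inter>F)"
    unfolding lock_closed_def
  proof (intro ballI allI impI)
    fix \<rho>1 \<rho>2 a1 a2 assume r: "\<rho>1 \<in> X" "\<rho>2 \<in> X" "\<rho>1 \<noteq> \<rho>2" "loc \<rho>1 = loc \<rho>2" "matches t a1 \<rho>1"
      "matches t a2 \<rho>2" "(a1, \<rho>2) \<in> \<Inter>F"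
    have "(\<rho>1, a2) \<in> R" if "R \<in> F" for R
      using assms(2)[OF that] r that unfolding closed_order_def lock_closed_def by blast
    then show "(\<rho>1, a2) \<in> \<Inter>F" by blast
  qed
  moreover have "respects_trace t X (\<Inter>F)"
    using respects_trace_Inter assms unfolding closed_order_def by blast
  ultimately show ?thesis by (simp add: closed_order_def)
qed

lemma order_closure_Some:
  "order_closure t X R = Some Q \<longleftrightarrow>
     closed_order t X Q \<and> R \<subseteq> Q \<and> (\<forall>Q'. closed_order t X Q' \<longrightarrow> R \<subseteq> Q' \<longrightarrow> Q \<subseteq> Q')"
  unfolding order_closure_def least_rel_Some by blast

text \<open>A single closed order above \<open>R\<close> rules out \<bottom>; this is how failure of
  the closure is excluded in the proof of completeness.\<close>

lemma order_closure_exists: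
  assumes "closed_order t X Q" "R \<subseteq> Q"
  shows "\<exists>Q'. order_closure t X R = Some Q'"
  unfolding order_closure_def
proof (rule least_rel_exists)
  fix F assume "F \<noteq> {}" "\<And>Q. Q \<in> F \<Longrightarrow> closed_order t X Q \<and> R \<subseteq> Q"
  then show "closed_order t X (\<Inter>F) \<and> R \<subseteq> \<Inter>F" using closed_order_Inter by blast
qed (use assms in auto)

text \<open>Every closed order respects the trace, so the detour through the weakest respecting order in
  the algorithm does not change the closure that is computed.\<close>

lemma race_decision_closure:
  assumes X: "X = rcone t e1 (proc e2) \<union> rcone t e2 (proc e1)"
  shows "race_decision t e1 e2 i res \<longleftrightarrow> i \<in> {1, 2} \<and>
    (if {e1, e2} \<inter> X \<noteq> {} \<or> \<not> feasible t X then res = None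
     else case order_closure t X {} of None \<Rightarrow> res = None
       | Some Q \<Rightarrow> saturate t X (proc (if i = 1 then e1 else e2)) Q res)"
proof -
  have "(case weakest_respecting t X of None \<Rightarrow> None | Some P \<Rightarrow> order_closure t X P)
    = order_closure t X {}" (is "?l = ?r")
  proof (cases "weakest_respecting t X")
    case None
    have "order_closure t X {} = None"
    proof (rule ccontr)
      assume "order_closure t X {} \<noteq> None"
      then obtain Q where "respects_trace t X Q" by (auto simp: order_closure_Some closed_order_def)
      then have "\<exists>R. weakest_respecting t X = Some R"
        unfolding weakest_respecting_def by (rule least_rel_exists) (auto intro:
            respects_trace_Inter)
      then show False using None by simp
    qed
    then show ?thesis using None by simp
  next
    case (Some P)
    then have "P \<subseteq> Q" if "closed_order t X Q" for Q
      using that unfolding weakest_respecting_def least_rel_Some closed_order_def by blast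
    then have "(\<lambda>Q. closed_order t X Q \<and> P \<subseteq> Q) = (\<lambda>Q. closed_order t X Q \<and> {} \<subseteq> Q)" by blast
    then show ?thesis using Some by (simp add: order_closure_def)
  qed
  then have "(case weakest_respecting t X of None \<Rightarrow> res = None
        | Some P \<Rightarrow> (case order_closure t X P of None \<Rightarrow> res = None | Some Q \<Rightarrow> S Q)) \<longleftrightarrow>
     (case order_closure t X {} of None \<Rightarrow> res = None | Some Q \<Rightarrow> S Q)" for S
    by (cases "weakest_respecting t X") (auto split: option.splits)
  then show ?thesis unfolding race_decision_def X Let_def by simp
qed

text \<open>Closedness survives the loop because each insertion ends with a closure, and a
  successful run can only stop at the exit rule.\<close>

lemma saturate_Some:
  assumes "saturate t X q Q0 res" "res = Some (X', Q)" "closed_order t X Q0"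
  shows "X' = X \<and> closed_order t X Q \<and> (\<nexists>a b. open_pair t X q Q a b)"
  using assms
  by (induction rule: saturate.induct) (auto simp: insert_and_close_def order_closure_Some)

lemma partial_order_onD:
  assumes "partial_order_on X Q"
  shows "(a, b) \<in> Q \<Longrightarrow> a \<in> X \<and> b \<in> X" "a \<in> X \<Longrightarrow> (a, a) \<in> Q"
    "(a, b) \<in> Q \<Longrightarrow> (b, c) \<in> Q \<Longrightarrow> (a, c) \<in> Q" "(a, b) \<in> Q \<Longrightarrow> (b, a) \<in> Q \<Longrightarrow> a = b"
  using assms unfolding partial_order_on_def preorder_on_def refl_on_def trans_def antisym_def
      by blast+

text \<open>Observation closedness appears here with membership in \<open>Q\<close> in place of
  \<open>strictly\<close>: a write differs from the read \<open>r\<close>, and \<open>w'\<close>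
  differs from \<open>w\<close> by assumption, so the strict and the reflexive form agree.\<close>

lemma closed_orderD:
  assumes "closed_order t X Q"
  shows "partial_order_on X Q"
    and "a \<in> X \<Longrightarrow> b \<in> X \<Longrightarrow> po t a b \<Longrightarrow> (a, b) \<in> Q"
    and "r \<in> X \<Longrightarrow> observes t r w \<Longrightarrow> (w, r) \<in> Q"
    and "a \<in> X \<Longrightarrow> \<rho> \<in> X \<Longrightarrow> is_acquire a \<Longrightarrow> is_release \<rho> \<Longrightarrow> loc \<rho> = loc a \<Longrightarrow>
      \<not> (\<exists>\<rho>'\<in>X. matches t a \<rho>') \<Longrightarrow> (\<rho>, a) \<in> Q"
    and "r \<in> X \<Longrightarrow> observes t r w \<Longrightarrow> w' \<in> X \<Longrightarrow> w' \<noteq> w \<Longrightarrow> is_write w' \<Longrightarrow> loc w' = loc r \<Longrightarrow>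
      (w', r) \<in> Q \<Longrightarrow> (w', w) \<in> Q"
    and "r \<in> X \<Longrightarrow> observes t r w \<Longrightarrow> w' \<in> X \<Longrightarrow> w' \<noteq> w \<Longrightarrow> is_write w' \<Longrightarrow> loc w' = loc r \<Longrightarrow>
      (w, w') \<in> Q \<Longrightarrow> (r, w') \<in> Q"
    and "\<rho>1 \<in> X \<Longrightarrow> \<rho>2 \<in> X \<Longrightarrow> \<rho>1 \<noteq> \<rho>2 \<Longrightarrow> loc \<rho>1 = loc \<rho>2 \<Longrightarrow> matches t a1 \<rho>1 \<Longrightarrow> matches t a2 \<rho>2 \<Longrightarrow>
      (a1, \<rho>2) \<in> Q \<Longrightarrow> (\<rho>1, a2) \<in> Q"
proof -
  note d = assms[unfolded closed_order_def respects_trace_def respect_conditions_def]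
  show "partial_order_on X Q" using d by blast
  show "(a, b) \<in> Q" if "a \<in> X" "b \<in> X" "po t a b" using d that unfolding po_eq_def by blast
  show "(w, r) \<in> Q" if "r \<in> X" "observes t r w" using d that unfolding strictly_def by blast
  show "(\<rho>, a) \<in> Q" if "a \<in> X" "\<rho> \<in> X" "is_acquire a" "is_release \<rho>" "loc \<rho> = loc a"
    "\<not> (\<exists>\<rho>'\<in>X. matches t a \<rho>')" using d that unfolding strictly_def by blast
  { assume r: "r \<in> X" "observes t r w" "w' \<in> X" "w' \<noteq> w" "is_write w'" "loc w' = loc r"
    then have "is_read r" by (simp add: observes_def)
    then have ne: "w' \<noteq> r" using r event_kinds by blast
    then have c: "conflicting w' r" using r \<open>is_read r\<close> by (auto simp: conflicting_def
        is_access_def)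
    have *: "(strictly Q w' r \<longrightarrow> strictly Q w' w) \<and> (strictly Q w w' \<longrightarrow> strictly Q r w')"
      using d r c unfolding observation_closed_def by blast
    show "(w', w) \<in> Q" if "(w', r) \<in> Q" using * that ne by (auto simp: strictly_def)
    show "(r, w') \<in> Q" if "(w, w') \<in> Q" using * that r by (auto simp: strictly_def) }
  show "(\<rho>1, a2) \<in> Q" if "\<rho>1 \<in> X" "\<rho>2 \<in> X" "\<rho>1 \<noteq> \<rho>2" "loc \<rho>1 = loc \<rho>2" "matches t a1 \<rho>1"
      "matches t a2 \<rho>2"
      "(a1, \<rho>2) \<in> Q"
    using d that unfolding lock_closed_def by blast
qed

lemma feasibleD:
  assumes "feasible t X"
  shows "X \<subseteq> set t" "po t a b \<Longrightarrow> b \<in> X \<Longrightarrow> a \<in> X" "r \<in> X \<Longrightarrow> observes t r w \<Longrightarrow> w \<in> X"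
    "\<rho> \<in> X \<Longrightarrow> matches t a \<rho> \<Longrightarrow> a \<in> X"
    "a1 \<in> X \<Longrightarrow> a2 \<in> X \<Longrightarrow> is_acquire a1 \<Longrightarrow> is_acquire a2 \<Longrightarrow> a1 \<noteq> a2 \<Longrightarrow> loc a1 = loc a2 \<Longrightarrow>
      (\<exists>\<rho>\<in>X. matches t a1 \<rho>) \<or> (\<exists>\<rho>\<in>X. matches t a2 \<rho>)"
  using assms unfolding feasible_def po_eq_def by blast+

text \<open>A condition on any \<open>a\<close> placed somewhere before \<open>b\<close>, not only
  on neighbours, so that \<open>sorted_wrt\<close> turns it into a property of the whole
  linearization.\<close>

definition late_after :: "nat \<Rightarrow> event rel \<Rightarrow> event \<Rightarrow> event \<Rightarrow> bool" where
  "late_after q Q a b \<longleftrightarrow> (b, a) \<notin> Q \<and> (proc a = q \<and> proc b \<noteq> q \<longrightarrow> (a, b) \<in> Q)"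

section \<open>Linearizations of closed orders\<close>

locale linearization =
  fixes t :: "event list" and X :: "event set" and Q :: "event rel" and q :: nat
      and L :: "event list"
  assumes trace: "is_trace t" and feas: "feasible t X" and closed: "closed_order t X Q"
    and saturated: "\<nexists>a b. open_pair t X q Q a b"
    and dist: "distinct L" and set_L: "set L = X" and late: "sorted_wrt (late_after q Q) L"
begin

lemma late_before: "before L a b \<Longrightarrow> late_after q Q a b"
  using sorted_wrt_before[OF late] .

lemma before_of_order:
  assumes "(a, b) \<in> Q" "a \<noteq> b"
  shows "before L a b"
proof -
  have "a \<in> set L" "b \<in> set L"
    using partial_order_onD(1)[OF closed_orderD(1)[OF closed] assms(1)] set_L by auto
  then show ?thesis using before_total assms late_before unfolding late_after_def by blast
qed

lemma X_subset: "X \<subseteq> set t"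
  using feasibleD(1)[OF feas] .

text \<open>Four cases on whether the events belong to \<open>q\<close>: if both do, program order
  decides; if neither does, saturation; if only \<open>a\<close> does, the delay of \<open>q\<close>
  allows this order only when \<open>Q\<close> contains it. What remains is the second
  alternative.\<close>

lemma conflicting_before:
  assumes "conflicting a b" "before L a b"
  shows "(a, b) \<in> Q \<or> (proc a \<noteq> q \<and> proc b = q)"
proof (cases "proc b = q")
  case b: True
  show ?thesis
  proof (cases "proc a = q")
    case True
    have X: "a \<in> X" "b \<in> X" using before_in_set[OF assms(2)] set_L by auto
    have "a \<noteq> b" using assms(1) by (simp add: conflicting_def)
    then have "po t a b \<or> po t b a" using X X_subset before_total True b unfolding po_def
        by (metis subset_iff)
    then show ?thesis
      using closed_orderD(2)[OF closed] X late_before[OF assms(2)] unfolding late_after_def by blast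
  qed (use b in simp)
next
  case b: False
  have X: "a \<in> X" "b \<in> X" using before_in_set[OF assms(2)] set_L by auto
  have ne: "a \<noteq> b" using assms(1) by (simp add: conflicting_def)
  have la: "late_after q Q a b" using late_before assms(2) .
  show ?thesis
  proof (cases "proc a = q")
    case False
    have "conflicting b a" using assms(1) by (auto simp: conflicting_def)
    then have "(a, b) \<in> Q \<or> (b, a) \<in> Q"
      using saturated X ne b False assms(1) before_total[of a t b] X_subset
      unfolding open_pair_def by blast
    then show ?thesis using la by (simp add: late_after_def)
  qed (use b la in \<open>simp add: late_after_def\<close>)
qed

text \<open>An intruding write \<open>w'\<close> is not put after \<open>w\<close> or before
  \<open>r\<close> by \<open>Q\<close>, since observation closedness would then push it out of the
  interval. So \<open>w'\<close> lies in \<open>q\<close> as the later event of the one unordered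
  pair, and outside of \<open>q\<close> as the earlier event of the other.\<close>

lemma observes_linear:
  assumes "r \<in> X" "observes t r w"
  shows "observes L r w"
proof -
  have w: "is_read r" "is_write w" "loc w = loc r" using assms(2) by (auto simp: observes_def)
  have "w \<noteq> r" using w event_kinds by blast
  have "before L w r" using before_of_order[OF closed_orderD(3)[OF closed assms] \<open>w \<noteq> r\<close>] .
  moreover have False if w': "is_write w'" "loc w' = loc r" "before L w w'" "before L w' r" for w'
  proof -
    have X: "w' \<in> X" using before_in_set[OF w'(3)] set_L by auto
    have ne: "w' \<noteq> w" using before_irrefl dist w'(3) by auto
    have c: "conflicting w w'" "conflicting w' r"
      using w w' ne event_kinds by (auto simp: conflicting_def is_access_def)
    have n: "(w', w) \<notin> Q" "(r, w') \<notin> Q"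
      using late_before w'(3,4) by (auto simp: late_after_def)
    have "(w', r) \<notin> Q" "(w, w') \<notin> Q"
      using closed_orderD(5,6)[OF closed assms X ne w'(1,2)] n by auto
    then show False using conflicting_before[OF c(1) w'(3)] conflicting_before[OF c(2) w'(4)]
        by blast
  qed
  ultimately show ?thesis using w unfolding observes_def by blast
qed

lemma matched_before:
  assumes "\<rho> \<in> X" "matches t a \<rho>"
  shows "a \<in> X" "before L a \<rho>"
proof -
  show "a \<in> X" using feasibleD(4)[OF feas assms] .
  have "a \<noteq> \<rho>" using assms(2) event_kinds by (auto simp: matches_def)
  then show "before L a \<rho>"
    using before_of_order closed_orderD(2)[OF closed \<open>a \<in> X\<close> assms(1) trace_match_po[OF trace
        assms(2)]]
    by blast
qed

text \<open>In overlapping critical sections each acquire precedes the release of the other section.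
  Lock closedness keeps both pairs out of \<open>Q\<close>, as either would separate the sections.
  Hence \<rho>2 belongs to \<open>q\<close> by the one pair and \<open>a2\<close> does not by the
  other, although matched lock events share their process.\<close>

lemma mutex_linear:
  assumes "\<rho>1 \<in> X" "\<rho>2 \<in> X" "matches t a1 \<rho>1" "matches t a2 \<rho>2" "loc a1 = loc a2" "before L a1 a2"
  shows "before L \<rho>1 a2"
proof (rule ccontr)
  assume n: "\<not> before L \<rho>1 a2"
  have k: "is_acquire a1" "is_acquire a2" "is_release \<rho>1" "is_release \<rho>2" "loc \<rho>1 = loc a1"
      "loc \<rho>2 = loc a2"
    using assms(3,4) by (auto simp: matches_def)
  have ne: "\<rho>1 \<noteq> a2" "a1 \<noteq> \<rho>2" using k event_kinds by blast+
  have "a1 \<noteq> a2" using assms(6) before_irrefl dist by auto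
  then have rne: "\<rho>1 \<noteq> \<rho>2" using trace_acquire_unique[OF trace] assms(3,4) by blast
  have b1: "before L a2 \<rho>1"
    using n before_total[of \<rho>1 L a2] ne assms(1) matched_before(1)[OF assms(2,4)] set_L by blast
  have b2: "before L a1 \<rho>2"
    using before_trans[OF dist assms(6) matched_before(2)[OF assms(2,4)]] .
  have c: "conflicting a1 \<rho>2" "conflicting a2 \<rho>1"
    using k ne assms(5) by (auto simp: conflicting_def is_lock_event_def)
  have "(a1, \<rho>2) \<notin> Q"
    using closed_orderD(7)[OF closed assms(1,2) rne _ assms(3,4)] k assms(5) late_before[OF b1]
    by (auto simp: late_after_def)
  then have 1: "proc \<rho>2 = q" using conflicting_before[OF c(1) b2] by blast
  have "(a2, \<rho>1) \<notin> Q"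
    using closed_orderD(7)[OF closed assms(2,1) rne[symmetric] _ assms(4,3)] k assms(5)
        late_before[OF b2]
    by (auto simp: late_after_def)
  then have "proc a2 \<noteq> q" using conflicting_before[OF c(2) b1] by blast
  then show False using 1 trace_match_proc[OF trace assms(4)] by simp
qed

lemma unmatched_after:
  assumes "a \<in> X" "is_acquire a" "\<not> (\<exists>\<rho>\<in>X. matches t a \<rho>)" "\<rho> \<in> X" "is_release \<rho>" "loc \<rho> = loc a"
  shows "before L \<rho> a"
  using before_of_order closed_orderD(4)[OF closed assms(1,4,2,5,6,3)] assms(2,5) event_kinds
      by blast

text \<open>A release of the lock between \<open>a\<close> and \<rho> would end another critical
  section of \<open>X\<close>, and completed sections of \<open>X\<close> do not overlap in
  \<open>L\<close>.\<close>

lemma matches_linear_intro: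
  assumes "\<rho> \<in> X" "matches t a \<rho>"
  shows "matches L a \<rho>"
proof -
  have False if r: "is_release \<rho>'" "loc \<rho>' = loc a" "before L a \<rho>'" "before L \<rho>' \<rho>" for \<rho>'
  proof -
    have X: "\<rho>' \<in> X" using before_in_set[OF r(3)] set_L by auto
    then obtain a' where a': "matches t a' \<rho>'"
      using trace_release_matched[OF trace _ r(1)] X_subset by blast
    have ne: "a \<noteq> a'"
      using matches_unique[OF trace_distinct[OF trace]] assms(2) a' r(4) before_irrefl dist by blast
    have l: "loc a = loc a'" using a' r(2) by (auto simp: matches_def)
    have "before L a a' \<or> before L a' a"
      using before_total ne matched_before(1)[OF assms] matched_before(1)[OF X a'] set_L by blast
    then show False
    proof
      assume "before L a a'"
      then have "before L \<rho> a'" using mutex_linear[OF assms(1) X assms(2) a' l] by blast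
      then have "before L \<rho> \<rho>'" using before_trans[OF dist] matched_before(2)[OF X a'] by blast
      then show False using before_asym[OF dist] r(4) by blast
    next
      assume "before L a' a"
      then have "before L \<rho>' a" using mutex_linear[OF X assms(1) a' assms(2) l[symmetric]] by blast
      then show False using before_asym[OF dist] r(3) by blast
    qed
  qed
  then show ?thesis using assms(2) matched_before(2)[OF assms] unfolding matches_def by blast
qed

text \<open>Conversely, an acquire whose section stays open in \<open>X\<close> comes after all
  releases of its lock, so \<open>L\<close> offers no release to match it.\<close>

lemma matches_linear: "matches L a \<rho> \<longleftrightarrow> matches t a \<rho> \<and> \<rho> \<in> X"
proof
  assume m: "matches L a \<rho>"
  then have k: "is_acquire a" "is_release \<rho>" "loc \<rho> = loc a" "before L a \<rho>"
      by (auto simp: matches_def)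
  have X: "a \<in> X" "\<rho> \<in> X" using before_in_set[OF k(4)] set_L by auto
  show "matches t a \<rho> \<and> \<rho> \<in> X"
  proof (cases "\<exists>\<rho>'\<in>X. matches t a \<rho>'")
    case True
    then show ?thesis using matches_unique[OF dist m] matches_linear_intro by blast
  next
    case False
    then show ?thesis using unmatched_after[OF X(1) k(1) False X(2) k(2,3)] before_asym[OF dist]
        k(4) by blast
  qed
qed (use matches_linear_intro in blast)

lemma trace_linear: "is_trace L"
  unfolding is_trace_def
proof (intro conjI allI impI ballI)
  show "proc \<rho> = proc a" if "matches L a \<rho>" for a \<rho>
    using that matches_linear trace_match_proc[OF trace] by blast
  show "\<exists>a. matches L a \<rho>" if "\<rho> \<in> set L" "is_release \<rho>" for \<rho>
    using that set_L X_subset trace_release_matched[OF trace _ that(2)] matches_linear by blast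
  show "\<exists>w. is_write w \<and> loc w = loc r \<and> before L w r" if r: "r \<in> set L" "is_read r" for r
  proof -
    obtain w where "observes t r w"
      using trace_read_observes[OF trace _ r(2)] r(1) set_L X_subset by blast
    then have "observes L r w" using observes_linear r(1) set_L by blast
    then show ?thesis by (auto simp: observes_def)
  qed
  show "\<exists>\<rho>. matches L a1 \<rho> \<and> before L \<rho> a2"
    if a: "is_acquire a1" "is_acquire a2" "loc a1 = loc a2" "before L a1 a2" for a1 a2
  proof -
    have X: "a1 \<in> X" "a2 \<in> X" using before_in_set[OF a(4)] set_L by auto
    have ne: "a1 \<noteq> a2" using a(4) before_irrefl dist by auto
    show ?thesis
    proof (cases "\<exists>\<rho>\<in>X. matches t a1 \<rho>")
      case True
      then obtain \<rho> where r: "\<rho> \<in> X" "matches t a1 \<rho>" by blast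
      have "before L \<rho> a2"
      proof (cases "\<exists>\<rho>\<in>X. matches t a2 \<rho>")
        case True
        then show ?thesis using mutex_linear[OF r(1) _ r(2) _ a(3,4)] by blast
      next
        case False
        then show ?thesis
          using unmatched_after[OF X(2) a(2) False r(1)] r(2) a(3) by (auto simp: matches_def)
      qed
      then show ?thesis using r matches_linear by blast
    next
      case False
      \<comment> \<open>Feasibility leaves at most one open section per lock, so \<open>a2\<close>
        is matched within \<open>X\<close>; its release, and with it \<open>a2\<close>, would
        precede the open \<open>a1\<close>.\<close>
      then obtain \<rho> where r: "\<rho> \<in> X" "matches t a2 \<rho>"
        using feasibleD(5)[OF feas X a(1,2) ne a(3)] by blast
      have "before L \<rho> a1"
        using unmatched_after[OF X(1) a(1) False r(1)] r(2) a(3) by (auto simp: matches_def)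
      then have "before L a2 a1" using before_trans[OF dist] matched_before(2)[OF r] by blast
      then show ?thesis using before_asym[OF dist] a(4) by blast
    qed
  qed
qed (rule dist)

end

section \<open>Initial writes and the assembly of a witness\<close>

lemma starts_with_writesD:
  assumes "starts_with_writes nv t"
  shows "e \<in> set (take nv t) \<Longrightarrow> is_write e"
    and "x < nv \<Longrightarrow> \<exists>w\<in>set (take nv t). act w = Write x"
    and "nv \<le> length t"
proof -
  have *: "act ` set (take nv t) = Write ` {..<nv}" using assms
      by (simp add: starts_with_writes_def)
  show "is_write e" if "e \<in> set (take nv t)"
  proof -
    have "act e \<in> Write ` {..<nv}" using that * by blast
    then show ?thesis by (auto simp: is_write_def)
  qed
  show "\<exists>w\<in>set (take nv t). act w = Write x" if "x < nv"
  proof -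
    have "Write x \<in> act ` set (take nv t)" using that * by blast
    then show ?thesis by (metis imageE)
  qed
  \<comment> \<open>\<open>Write\<close> is injective, so \<open>nv\<close> different actions occur
    among the first \<open>nv\<close> positions, which must therefore all exist.\<close>
  have "card (Write ` {..<nv}) = nv" by (subst card_image) (auto simp: inj_on_def)
  then have "nv \<le> card (set (take nv t))" using card_image_le[of "set (take nv t)" act] * by simp
  also have "\<dots> \<le> length (take nv t)" by (rule card_length)
  finally show "nv \<le> length t" by simp
qed

lemma before_take:
  assumes "distinct t"
  shows "a \<in> set (take m t) \<Longrightarrow> b \<in> set t \<Longrightarrow> b \<notin> set (take m t) \<Longrightarrow> before t a b"
    and "before t a b \<Longrightarrow> b \<in> set (take m t) \<Longrightarrow> before (take m t) a b"
proof -
  show "before t a b" if "a \<in> set (take m t)" "b \<in> set t" "b \<notin> set (take m t)"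
  proof -
    have "b \<in> set (drop m t)" using that by (metis Un_iff append_take_drop_id set_append)
    then have "before (take m t @ drop m t) a b" using that(1) unfolding before_append by blast
    then show ?thesis by simp
  qed
  show "before (take m t) a b" if "before t a b" "b \<in> set (take m t)"
    using that prefix_before[OF take_is_prefix assms that(2)] by simp
qed

definition cone_union :: "event list \<Rightarrow> event \<Rightarrow> event \<Rightarrow> event set" where
  "cone_union t e1 e2 = rcone t e1 (proc e2) \<union> rcone t e2 (proc e1)"

lemma cone_union_pred: "po t e' e \<Longrightarrow> e \<in> {e1, e2} \<Longrightarrow> e' \<in> cone_union t e1 e2"
  unfolding cone_union_def using rcone.pred by blast

text \<open>The initial writes appended after the linearization \<open>L\<close> make sure that \<open>e1\<close>, if it is a
  read, has some write to observe; no event of \<open>L\<close> can see them.\<close>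

definition late_writes :: "nat \<Rightarrow> event list \<Rightarrow> event set \<Rightarrow> event \<Rightarrow> event \<Rightarrow> event list" where
  "late_writes nv t X e1 e2 = filter (\<lambda>e. e \<notin> X \<and> proc e \<noteq> proc e1 \<and> proc e \<noteq> proc e2) (take nv t)"

text \<open>All program-order predecessors of \<open>e1\<close> and \<open>e2\<close> lie in
  \<open>X\<close>, while neither event occurs in \<open>L\<close> or among the late writes, so both
  are enabled at the end. What else has to be checked are prefixes per process, unchanged
  observations, and a write in front of a reading \<open>e1\<close> or \<open>e2\<close>.\<close>

lemma linearization_witness:
  assumes inp: "race_input k nv nl t e1 e2" and X: "X = cone_union t e1 e2"
    and nX: "e1 \<notin> X" "e2 \<notin> X" and init: "read_is_initialised nv t X e1 e2"
    and lin: "linearization t X Q q L"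
  shows "witness_trace t e1 e2 (L @ late_writes nv t X e1 e2 @ [e1, e2])"
proof -
  interpret linearization t X Q q L by (rule lin)
  let ?U = "late_writes nv t X e1 e2" and ?u = "L @ late_writes nv t X e1 e2"
  have d: "distinct t" using trace trace_distinct by blast
  have e: "e1 \<in> set t" "e2 \<in> set t" "is_access e1" "is_access e2" "conflicting e1 e2"
    and sw: "starts_with_writes nv t" and wb: "within_bounds k nv nl e1"
    using inp by (auto simp: race_input_def)
  have ne: "e1 \<noteq> e2" using e(5) by (simp add: conflicting_def)
  \<comment> \<open>Within one process, the earlier of the two events would be a predecessor of the
    later one and hence lie in its cone.\<close>
  have pne: "proc e1 \<noteq> proc e2"
  proof
    assume "proc e1 = proc e2"
    then have "po t e1 e2 \<or> po t e2 e1" using before_total[OF e(1,2) ne] by (auto simp: po_def)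
    then show False using cone_union_pred[of t] nX X by blast
  qed
  have U: "a \<in> set ?U \<longleftrightarrow> a \<in> set (take nv t) \<and> a \<notin> X \<and> proc a \<noteq> proc e1 \<and> proc a \<noteq> proc e2" for a
    by (auto simp: late_writes_def)
  have U_write: "is_write a" if "a \<in> set ?U" for a using that U starts_with_writesD(1)[OF sw]
      by blast
  have du: "distinct ?u" using dist d set_L U unfolding late_writes_def by auto
  have sub: "set ?u \<subseteq> set t" using X_subset set_L U by (auto dest: in_set_takeD)
  have eu: "e1 \<notin> set ?u" "e2 \<notin> set ?u" using nX set_L U by auto
  have down: "a \<in> set ?u" if "po t a b" "b \<in> set ?u" for a b
  proof (cases "b \<in> X")
    case True
    then show ?thesis using feasibleD(2)[OF feas that(1)] set_L by simp
  next
    case False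
    then have b: "b \<in> set ?U" using that(2) set_L by auto
    \<comment> \<open>The initial writes form a prefix of \<open>t\<close>, so a predecessor of one
      of them is itself an initial write.\<close>
    have "before (take nv t) a b" using before_take(2)[OF d] b that(1) U by (auto simp: po_def)
    then have "a \<in> set (take nv t)" using before_in_set by blast
    then show ?thesis using b that(1) set_L by (auto simp: U po_def)
  qed
  have ord: "before ?u a b" if "po t a b" "a \<in> set ?u" "b \<in> set ?u" for a b
  proof (cases "b \<in> X")
    case True
    then have "a \<in> X" using feasibleD(2)[OF feas that(1)] by simp
    then have "(a, b) \<in> Q" using closed_orderD(2)[OF closed] True that(1) by blast
    moreover have "a \<noteq> b" using that(1) before_irrefl[OF d] by (auto simp: po_def)
    ultimately show ?thesis using before_of_order by (simp add: before_append)
  next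
    case False
    then have b: "b \<in> set ?U" using that(3) set_L by auto
    show ?thesis
    proof (cases "a \<in> X")
      case True
      then show ?thesis using b set_L by (simp add: before_append)
    next
      case False
      then have a: "a \<in> set ?U" using that(2) set_L by auto
      have "before (take nv t) a b" using before_take(2)[OF d] b that(1) U by (auto simp: po_def)
      then have "before ?U a b" using a b U by (simp add: late_writes_def before_filter)
      then show ?thesis by (simp add: before_append)
    qed
  qed
  have pre: "prefix (proj ?u p) (proj t p)" for p
    by (rule prefix_proj_by_before[OF du d sub]) (use down ord in auto)
  have pre_e: "prefix (proj ?u (proc ev) @ [ev]) (proj t (proc ev))" if ev: "ev \<in> {e1, e2}" for ev
  proof -
    have evu: "ev \<notin> set ?u" "ev \<in> set t" using ev eu e by auto
    have "prefix (proj (?u @ [ev]) (proc ev)) (proj t (proc ev))"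
    proof (rule prefix_proj_by_before)
      show "distinct (?u @ [ev])" using du evu by simp
      show "set (?u @ [ev]) \<subseteq> set t" using sub evu by simp
      fix a b assume ab: "po t a b"
      { assume "b \<in> set (?u @ [ev])"
        then show "a \<in> set (?u @ [ev])"
          using down[OF ab] cone_union_pred[OF ab, of e1 e2] X set_L ev by auto }
      assume in_u: "a \<in> set (?u @ [ev])" "b \<in> set (?u @ [ev])"
      have "a \<noteq> b" using ab before_irrefl[OF d] by (auto simp: po_def)
      show "before (?u @ [ev]) a b"
      proof (cases "b = ev")
        case True
        then show ?thesis using in_u \<open>a \<noteq> b\<close> unfolding before_append by simp
      next
        case False
        then have b: "b \<in> set ?u" using in_u by simp
        then have "a \<in> set ?u" using down[OF ab] by blast
        then show ?thesis using ord[OF ab _ b] unfolding before_append by blast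
      qed
    qed (rule d)
    then show ?thesis by (simp add: proj_def)
  qed
  have obs: "observes ?u r w \<longleftrightarrow> observes t r w" if r: "r \<in> set ?u" "is_read r" for r w
  proof -
    \<comment> \<open>Late events are writes behind all of \<open>L\<close>, so every read belongs
      to \<open>L\<close> and has the same events before it as in \<open>L\<close>.\<close>
    have "r \<notin> set ?U" using U_write r event_kinds by blast
    then have rX: "r \<in> X" using r set_L by auto
    then obtain w0 where w0: "observes t r w0" using trace_read_observes[OF trace _ r(2)] X_subset
        by blast
    have b: "before ?u a r \<longleftrightarrow> before L a r" for a
      using \<open>r \<notin> set ?U\<close> before_in_set by (auto simp: before_append)
    have "before L a b" if "before ?u a b" "before ?u b r" for a b
    proof -
      have "b \<in> set L" using that(2) b before_in_set by blast
      then have "b \<notin> set ?U" using du by auto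
      then show ?thesis using that(1) before_in_set by (auto simp: before_append)
    qed
    then have "observes ?u r w0"
      using observes_linear[OF rX w0] b unfolding observes_def by blast
    then show ?thesis using w0 observes_unique[OF d] observes_unique[OF du] by blast
  qed
  have tr: "is_trace ?u"
    using trace_append_writes[OF trace_linear du] U_write by blast
  have tr1: "is_trace (?u @ [e1])"
  proof (rule trace_snoc_access[OF tr e(3) eu(1)])
    assume r: "is_read e1"
    show "\<exists>w\<in>set ?u. is_write w \<and> loc w = loc e1"
    \<comment> \<open>If \<open>e2\<close> is not initial, the initial write to the variable of
      \<open>e1\<close> precedes both events in \<open>t\<close>. It lies in a cone if it belongs to
      one of their processes, and otherwise in \<open>X\<close> or among the late writes.\<close>
    proof (cases "e2 \<in> set (take nv t)")
      case True
      then show ?thesis using init r set_L by (auto simp: read_is_initialised_def)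
    next
      case False
      obtain x where x: "act e1 = Read x" using r by (auto simp: is_read_def)
      then have l: "loc e1 = Var x" "x < nv" using wb by (auto simp: within_bounds_def loc_def)
      obtain w where w: "w \<in> set (take nv t)" "act w = Write x" using starts_with_writesD(2)[OF sw
          l(2)] by blast
      then have w': "is_write w" "loc w = loc e1" using l by (auto simp: is_write_def loc_def)
      have "e1 \<notin> set (take nv t)" using starts_with_writesD(1)[OF sw] r event_kinds by blast
      then have "before t w e1" "before t w e2" using before_take(1)[OF d w(1)] e False by auto
      then have "w \<in> X" if "proc w = proc e1 \<or> proc w = proc e2"
        using that cone_union_pred[of t w _ e1 e2] X by (auto simp: po_def)
      then have "w \<in> set ?u" using w(1) set_L by (auto simp: U)
      then show ?thesis using w' by blast
    qed
  qed
  have "is_trace ((?u @ [e1]) @ [e2])"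
  proof (rule trace_snoc_access[OF tr1 e(4)])
    show "e2 \<notin> set (?u @ [e1])" using eu ne by simp
    \<comment> \<open>A conflicting pair contains a write, so \<open>e1\<close> itself is the write
      in front of \<open>e2\<close>.\<close>
    assume "is_read e2"
    then have "is_write e1" "loc e1 = loc e2"
      using e(4,5) event_kinds[of e2] by (auto simp: conflicting_def is_lock_event_def)
    then show "\<exists>w\<in>set (?u @ [e1]). is_write w \<and> loc w = loc e2" by auto
  qed
  then have tr2: "is_trace (?u @ [e1, e2])" by simp
  have "correct_reordering t ?u"
    unfolding correct_reordering_def using tr pre obs by blast
  moreover have "exhibits_race (?u @ [e1, e2]) e1 e2"
    using e pne unfolding exhibits_race_def by (auto intro: exI[of _ ?u] exI[of _ "[]"])
  ultimately show ?thesis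
    unfolding witness_trace_def using tr2 pre_e by (intro exI[of _ ?u]) auto
qed

lemma race_decision_SomeD:
  assumes "race_input k nv nl t e1 e2" "race_decision t e1 e2 i (Some (X, Q))"
  shows "X = cone_union t e1 e2" "e1 \<notin> X" "e2 \<notin> X" "feasible t X" "closed_order t X Q"
    "\<nexists>a b. open_pair t X (proc (if i = 1 then e1 else e2)) Q a b" "i \<in> {1, 2}"
proof -
  let ?X = "cone_union t e1 e2"
  note r = assms(2)[unfolded race_decision_closure[OF cone_union_def]]
  have x: "e1 \<notin> ?X" "e2 \<notin> ?X" "feasible t ?X" using r by (auto split: if_splits)
  then obtain Q0 where q: "order_closure t ?X {} = Some Q0" and
    s: "saturate t ?X (proc (if i = 1 then e1 else e2)) Q0 (Some (X, Q))"
    using r by (auto split: option.splits if_splits)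
  have "closed_order t ?X Q0" using q order_closure_Some by blast
  note * = saturate_Some[OF s refl this]
  show "X = ?X" using * by blast
  then show "e1 \<notin> X" "e2 \<notin> X" "feasible t X" "closed_order t X Q"
    "\<nexists>a b. open_pair t X (proc (if i = 1 then e1 else e2)) Q a b" "i \<in> {1, 2}"
    using x * r by auto
qed

section \<open>Completeness for two processes\<close>

locale reordering =
  fixes t u :: "event list"
  assumes trace: "is_trace t" and reorder: "correct_reordering t u"
begin

lemma dist: "distinct t" and dist_u: "distinct u" and trace_u: "is_trace u"
  using trace reorder trace_distinct by (auto simp: correct_reordering_def)

lemma subset: "set u \<subseteq> set t"
proof
  fix e assume "e \<in> set u"
  then have "e \<in> set (proj u (proc e))" by (simp add: proj_def)
  moreover have "prefix (proj u (proc e)) (proj t (proc e))"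
    using reorder by (simp add: correct_reordering_def)
  ultimately have "e \<in> set (proj t (proc e))" using set_mono_prefix by blast
  then show "e \<in> set t" by (simp add: proj_def)
qed

text \<open>It suffices that \<open>b\<close> occurs in \<open>u\<close>: prefixes are down-closed,
  so a predecessor of \<open>b\<close> in \<open>t\<close> occurs in \<open>u\<close> as
  well.\<close>

lemma po_reorder:
  assumes "b \<in> set u"
  shows "po t a b \<longleftrightarrow> po u a b"
proof -
  have "prefix (proj u (proc b)) (proj t (proc b))"
    using reorder by (simp add: correct_reordering_def)
  moreover have "b \<in> set (proj u (proc b))" "distinct (proj t (proc b))"
    using assms dist by (auto simp: proj_def)
  ultimately have "before (proj t (proc b)) a b \<longleftrightarrow> before (proj u (proc b)) a b"
    using prefix_before by blast
  then show ?thesis by (auto simp: po_def before_proj)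
qed

lemma observes_reorder: "r \<in> set u \<Longrightarrow> observes u r w \<longleftrightarrow> observes t r w"
  using reorder by (cases "is_read r") (auto simp: correct_reordering_def observes_def)

text \<open>Correct reorderings do not mention the matching of locks. It is preserved because
  matched events share a process: the acquire \<open>b\<close> of \<rho> in \<open>t\<close> and its
  acquire \<open>a\<close> in \<open>u\<close> are comparable in program order, and either order
  puts one of them inside the critical section of the other.\<close>

lemma matches_reorder_down:
  assumes "matches u a \<rho>"
  shows "matches t a \<rho>"
proof -
  have m: "is_acquire a" "is_release \<rho>" "loc \<rho> = loc a" using assms by (auto simp: matches_def)
  have U: "a \<in> set u" "\<rho> \<in> set u" using matches_in_set assms by auto
  obtain b where b: "matches t b \<rho>" using trace_release_matched[OF trace _ m(2)] U subset by blast
  have pa: "po t a \<rho>" using trace_match_po[OF trace_u assms] po_reorder U by blast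
  have pb: "po t b \<rho>" using trace_match_po[OF trace b] .
  have k: "is_acquire b" "loc a = loc b" using b m by (auto simp: matches_def)
  have "a = b"
  proof (rule ccontr)
    assume "a \<noteq> b"
    moreover have "proc a = proc b" using pa pb by (simp add: po_def)
    ultimately consider "po t a b" | "po t b a"
      using before_total[of a t b] U subset matches_in_set[OF b] unfolding po_def by fastforce
    then show False
    proof cases
      case 1
      have "b \<in> set u" using pb po_reorder[OF U(2)] before_in_set by (auto simp: po_def)
      then have "before u a b" using 1 po_reorder by (auto simp: po_def)
      then have "before u \<rho> b" using trace_mutex[OF trace_u assms k(1)] k(2) by simp
      moreover have "before u b \<rho>" using pb po_reorder[OF U(2)] by (auto simp: po_def)
      ultimately show False using before_asym dist_u by blast
    next
      case 2
      then have "before t \<rho> a" using trace_mutex[OF trace b m(1) k(2)] by (simp add: po_def)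
      then show False using pa before_asym dist by (auto simp: po_def)
    qed
  qed
  then show ?thesis using b by simp
qed

lemma matches_reorder: "\<rho> \<in> set u \<Longrightarrow> matches u a \<rho> \<longleftrightarrow> matches t a \<rho>"
proof
  assume "\<rho> \<in> set u" and m: "matches t a \<rho>"
  then obtain b where "matches u b \<rho>"
    using trace_release_matched[OF trace_u] unfolding matches_def[of t] by blast
  then show "matches u a \<rho>" using matches_reorder_down trace_acquire_unique[OF trace m] by blast
qed (rule matches_reorder_down)

lemma acquires_reorder:
  assumes "is_acquire a" "is_acquire b" "loc a = loc b" "before u a b"
  shows "\<exists>\<rho>\<in>set u. matches t a \<rho> \<and> before u \<rho> b"
  using trace_u assms matches_reorder_down matches_in_set unfolding is_trace_def by metis

lemma feasible_reorder: "feasible t (set u)"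
  unfolding feasible_def
proof (intro conjI allI impI ballI)
  show "set u \<subseteq> set t" by (rule subset)
  show "e \<in> set u" if "po_eq t e e'" "e' \<in> set u" for e e'
    using that po_reorder before_in_set by (fastforce simp: po_eq_def po_def)
  show "w \<in> set u" if "r \<in> set u" "observes t r w" for r w
    using that observes_reorder before_in_set by (fastforce simp: observes_def)
  show "a \<in> set u" if "\<rho> \<in> set u" "matches t a \<rho>" for a \<rho>
    using that matches_reorder matches_in_set by blast
  show "loc a \<noteq> loc b" if "a \<in> set u" "b \<in> set u" "is_acquire a" "is_acquire b" "a \<noteq> b"
    "\<not> (\<exists>\<rho>\<in>set u. matches t a \<rho>)" "\<not> (\<exists>\<rho>\<in>set u. matches t b \<rho>)" for a b
    using that acquires_reorder before_total[of a u b] by metis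
qed

text \<open>The closed order that keeps the closure from being \<bottom> when \<open>u\<close> comes
  from a witness.\<close>

definition total_order :: "event rel" where
  "total_order = {(a, b). a \<in> set u \<and> b \<in> set u \<and> (a = b \<or> before u a b)}"

lemma strictly_total: "strictly total_order a b \<longleftrightarrow> before u a b"
  using before_in_set before_irrefl[OF dist_u] by (auto simp: strictly_def total_order_def)

text \<open>In a trace no write separates a read from the write it observes, and critical sections
  do not overlap. For a linear order these facts amount to the closure conditions, once observations
  and matches of \<open>t\<close> are translated to \<open>u\<close>.\<close>

lemma closed_total: "closed_order t (set u) total_order"
proof -
  have "partial_order_on (set u) total_order"
    unfolding partial_order_on_def preorder_on_def
  proof (intro conjI)
    show "trans total_order" using before_trans[OF dist_u] by (auto simp: trans_def total_order_def)
    show "antisym total_order" using before_asym[OF dist_u] by (auto simp: antisym_def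
        total_order_def)
  qed (auto simp: refl_on_def total_order_def)
  moreover have "respect_conditions t (set u) total_order"
    unfolding respect_conditions_def strictly_total
  proof (intro conjI ballI allI impI)
    show "(e, e') \<in> total_order" if "e \<in> set u" "e' \<in> set u" "po_eq t e e'" for e e'
      using that po_reorder by (auto simp: po_eq_def total_order_def po_def)
    show "before u w r" if "r \<in> set u" "observes t r w" for r w
      using that observes_reorder by (auto simp: observes_def)
    show "before u \<rho> a" if a: "a \<in> set u" "\<rho> \<in> set u" "is_acquire a" "is_release \<rho>" "loc \<rho> = loc a"
      "\<not> (\<exists>\<rho>'\<in>set u. matches t a \<rho>')" for a \<rho>
    proof (rule ccontr)
      assume n: "\<not> before u \<rho> a"
      have "a \<noteq> \<rho>" using a event_kinds by blast
      then have ar: "before u a \<rho>" using n before_total a by blast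
      obtain b where b: "matches u b \<rho>" using trace_release_matched[OF trace_u a(2,4)] by blast
      then have k: "is_acquire b" "loc a = loc b" "b \<in> set u" "before u b \<rho>"
        using a(5) matches_in_set by (auto simp: matches_def)
      \<comment> \<open>\<open>b\<close> is the acquire of \<rho>, whereas \<open>a\<close> has no
        release in \<open>u\<close>. If \<open>a\<close> came first, its section would have to end
        before \<open>b\<close>; if \<open>b\<close> came first, \<rho> would precede
        \<open>a\<close>.\<close>
      have "a \<noteq> b" using a b matches_reorder by blast
      then consider "before u a b" | "before u b a" using before_total a k by blast
      then show False
      proof cases
        case 1
        then show ?thesis using acquires_reorder[OF a(3) k(1,2)] a(6) by blast
      next
        case 2
        then show ?thesis using trace_mutex[OF trace_u b a(3) k(2)] n by blast
      qed
    qed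
  qed
  moreover have "observation_closed t (set u) total_order"
    unfolding observation_closed_def strictly_total
  proof (intro ballI allI impI conjI)
    fix r w w' assume r: "r \<in> set u" "observes t r w" "w' \<in> set u - {w}" "is_write w'"
        "conflicting w' r"
    have o: "observes u r w" using r observes_reorder by blast
    then have w: "w \<in> set u" "before u w r" using before_in_set by (auto simp: observes_def)
    have c: "\<not> (before u w w' \<and> before u w' r)" using o r by (auto simp: observes_def
        conflicting_def)
    have "w' \<noteq> r" using r(5) by (auto simp: conflicting_def)
    show "before u w' w" if "before u w' r" using that c r(3) w before_total by blast
    show "before u r w'" if "before u w w'" using that c r(1,3) \<open>w' \<noteq> r\<close> before_total by blast
  qed
  moreover have "lock_closed t (set u) total_order"
    unfolding lock_closed_def
  proof (intro ballI allI impI)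
    fix \<rho>1 \<rho>2 a1 a2 assume r: "\<rho>1 \<in> set u" "\<rho>2 \<in> set u" "\<rho>1 \<noteq> \<rho>2" "loc \<rho>1 = loc \<rho>2"
        "matches t a1 \<rho>1"
      "matches t a2 \<rho>2" "(a1, \<rho>2) \<in> total_order"
    have m: "matches u a1 \<rho>1" "matches u a2 \<rho>2" using r matches_reorder by auto
    then have k: "is_acquire a1" "is_acquire a2" "is_release \<rho>2" "a1 \<in> set u" "a2 \<in> set u"
        "loc a1 = loc a2"
      using r(4) matches_in_set by (auto simp: matches_def)
    have "a1 \<noteq> \<rho>2" using k event_kinds by blast
    then have b: "before u a1 \<rho>2" using r(7) by (auto simp: total_order_def)
    have "a1 \<noteq> a2" using m matches_unique[OF dist_u] r(3) by blast
    then consider "before u a1 a2" | "before u a2 a1" using before_total k by blast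
    then have "before u \<rho>1 a2"
    proof cases
      case 1
      then show ?thesis using trace_mutex[OF trace_u m(1) k(2)] k(6) by simp
    next
      case 2
      then show ?thesis using trace_mutex[OF trace_u m(2) k(1) k(6)] b before_asym[OF dist_u]
          by blast
    qed
    then show "(\<rho>1, a2) \<in> total_order" using before_in_set by (auto simp: total_order_def)
  qed
  ultimately show ?thesis by (simp add: closed_order_def respects_trace_def)
qed

end

text \<open>The lock rule of the cone concerns acquires of a third process, and there is none. The
  other rules stay within \<open>u\<close> because \<open>set u\<close> is feasible. Conversely,
  each event of \<open>u\<close> belongs to the process of \<open>e1\<close> or \<open>e2\<close>
  and precedes that event.\<close>

lemma two_process_cone:
  assumes inp: "race_input 2 nv nl t e1 e2" and ro: "reordering t u" and pne: "proc e1 \<noteq> proc e2"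
    and nu: "e1 \<notin> set u" "e2 \<notin> set u"
    and pre: "prefix (proj u (proc e1) @ [e1]) (proj t (proc e1))"
      "prefix (proj u (proc e2) @ [e2]) (proj t (proc e2))"
  shows "cone_union t e1 e2 = set u"
proof
  interpret reordering t u by (rule ro)
  have procs: "proc e = proc e1 \<or> proc e = proc e2" if "e \<in> set t" for e
  proof -
    have "proc e < 2" "proc e1 < 2" "proc e2 < 2"
      using inp that by (auto simp: race_input_def within_bounds_def)
    then show ?thesis using pne by linarith
  qed
  \<comment> \<open>As \<open>e\<close> is the next event of its process after \<open>u\<close>, its
    predecessors in \<open>t\<close> are the events of \<open>u\<close> in that process.\<close>
  have po_e: "po t a e \<longleftrightarrow> a \<in> set u \<and> proc a = proc e" if "e \<in> {e1, e2}" for a e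
  proof -
    have "prefix (proj u (proc e) @ [e]) (proj t (proc e))" "e \<notin> set u" using pre nu that by auto
    moreover have "distinct (proj t (proc e))" using dist by (simp add: proj_def)
    ultimately have "before (proj t (proc e)) a e \<longleftrightarrow> before (proj u (proc e) @ [e]) a e"
      by (intro prefix_before) auto
    also have "\<dots> \<longleftrightarrow> a \<in> set (proj u (proc e))"
      using \<open>e \<notin> set u\<close> by (auto simp: before_append before_Cons before_proj dest: before_in_set)
    finally show ?thesis unfolding before_proj po_def by (auto simp: proj_def)
  qed
  have "x \<in> set u" if "x \<in> rcone t e p" "e \<in> {e1, e2}" "p \<in> {proc e1, proc e2}" "proc e \<noteq> p"
      for x e p
    using that
  proof (induction rule: rcone.induct)
    case (pred e')
    then show ?case using po_e by blast
  next
    case (down e' e'')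
    then show ?case using feasible_reorder unfolding feasible_def by blast
  next
    case (obs r w)
    then show ?case using feasible_reorder unfolding feasible_def by blast
  next
    case (lock a \<rho>)
    then have "a \<in> set t" using subset by blast
    then show ?case using lock procs[of a] by auto
  qed
  then show "cone_union t e1 e2 \<subseteq> set u" using pne unfolding cone_union_def by auto
  show "set u \<subseteq> cone_union t e1 e2"
  proof
    fix a assume "a \<in> set u"
    then have "po t a e1 \<or> po t a e2" using procs subset po_e by blast
    then show "a \<in> cone_union t e1 e2" using cone_union_pred by blast
  qed
qed

lemma race_decision_complete:
  assumes inp: "race_input 2 nv nl t e1 e2" and race: "predictable_race t e1 e2" and i: "i \<in> {1, 2}"
  shows "\<exists>X Q. race_decision t e1 e2 i (Some (X, Q))" "\<not> race_decision t e1 e2 i None"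
proof -
  obtain u where u: "correct_reordering t u"
      "prefix (proj u (proc e1) @ [e1]) (proj t (proc e1))"
      "prefix (proj u (proc e2) @ [e2]) (proj t (proc e2))"
      "is_trace (u @ [e1, e2])" "exhibits_race (u @ [e1, e2]) e1 e2"
    using race unfolding predictable_race_def witness_trace_def by blast
  interpret reordering t u using inp u(1) by unfold_locales (auto simp: race_input_def)
  have nu: "e1 \<notin> set u" "e2 \<notin> set u" using trace_distinct[OF u(4)] by auto
  have pne: "proc e1 \<noteq> proc e2" using u(5) by (simp add: exhibits_race_def)
  let ?X = "cone_union t e1 e2" and ?q = "proc (if i = 1 then e1 else e2)"
  have X: "?X = set u" using two_process_cone[OF inp _ pne nu u(2,3)] reordering_axioms by blast
  obtain Q where Q: "order_closure t ?X {} = Some Q"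
    using order_closure_exists[OF closed_total] X by auto
  then have cl: "closed_order t ?X Q" by (simp add: order_closure_Some)
  have no: "\<not> open_pair t ?X ?q Q a b" for a b
  proof
    assume o: "open_pair t ?X ?q Q a b"
    then have ab: "a \<in> set t" "b \<in> set t" "a \<in> ?X" "b \<in> ?X" "before t a b" "(a, b) \<notin> Q"
      "proc a \<noteq> ?q" "proc b \<noteq> ?q"
      using X subset by (auto simp: open_pair_def)
    have "proc e < 2" if "e \<in> set t" for e
      using inp that by (auto simp: race_input_def within_bounds_def)
    then have "proc a < 2" "proc b < 2" "?q < 2" using ab(1,2) inp by (auto simp: race_input_def)
    \<comment> \<open>Both numbers are below 2 and differ from \<open>?q\<close>.\<close>
    then have "proc a = proc b" using ab(7,8) by linarith
    then show False using closed_orderD(2)[OF cl ab(3,4)] ab(5,6) by (simp add: po_def)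
  qed
  have rd: "race_decision t e1 e2 i res \<longleftrightarrow> saturate t ?X ?q Q res" for res
    using i Q nu X feasible_reorder by (subst race_decision_closure[OF cone_union_def]) auto
  show "\<exists>X Q. race_decision t e1 e2 i (Some (X, Q))" using rd no saturate.exit by blast
  show "\<not> race_decision t e1 e2 i None"
    unfolding rd using no by (auto elim: saturate.cases)
qed

section \<open>Total correctness of programs with a bound on the steps\<close>

text \<open>Termination is part of the claim, as the existence of a final state. Steps are bounded
  relative to the initial state and the counters are otherwise arbitrary, which makes bounds
  additive under sequencing.\<close>

definition reach :: "event list \<Rightarrow> com \<Rightarrow> nat \<Rightarrow> memory \<Rightarrow> (event set \<times> event rel) option \<Rightarrow>
    (memory \<Rightarrow> (event set \<times> event rel) option \<Rightarrow> bool) \<Rightarrow> bool" where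
  "reach t c T m h \<Phi> \<longleftrightarrow> (\<forall>s :: state. mem s = m \<longrightarrow> held s = h \<longrightarrow>
     (\<exists>s'. exec t c s s' \<and> steps s' \<le> steps s + T \<and> \<Phi> (mem s') (held s')))"

fun mods :: "com \<Rightarrow> string set" where
  "mods Skip = {}"
| "mods (Assign A i e) = {A}"
| "mods (Seq c c') = mods c \<union> mods c'"
| "mods (Cond b c c') = mods c \<union> mods c'"
| "mods (While b c) = mods c"
| "mods (Closure A n B C D) = {D}"
| "mods (InsertAndClose i j D) = {D}"
| "mods (Query i j D) = {D}"

fun closure_count :: "com \<Rightarrow> nat" where
  "closure_count (Seq c c') = closure_count c + closure_count c'"
| "closure_count (Cond b c c') = closure_count c + closure_count c'"
| "closure_count (While b c) = closure_count c"
| "closure_count (Closure A n B C D) = 1"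
| "closure_count _ = 0"

fun no_loop_closure :: "com \<Rightarrow> bool" where
  "no_loop_closure (Seq c c') \<longleftrightarrow> no_loop_closure c \<and> no_loop_closure c'"
| "no_loop_closure (Cond b c c') \<longleftrightarrow> no_loop_closure c \<and> no_loop_closure c'"
| "no_loop_closure (While b c) \<longleftrightarrow> no_loop_closure c \<and> closure_count c = 0"
| "no_loop_closure _ \<longleftrightarrow> True"

fun insertion_free :: "com \<Rightarrow> bool" where
  "insertion_free (Seq c c') \<longleftrightarrow> insertion_free c \<and> insertion_free c'"
| "insertion_free (Cond b c c') \<longleftrightarrow> insertion_free c \<and> insertion_free c'"
| "insertion_free (While b c) \<longleftrightarrow> insertion_free c"
| "insertion_free (InsertAndClose i j D) \<longleftrightarrow> False"
| "insertion_free _ \<longleftrightarrow> True"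

lemma state_simps [simp]:
  "mem (tick k s) = mem s" "held (tick k s) = held s" "steps (tick k s) = steps s + k"
  "closures (tick k s) = closures s" "insertions (tick k s) = insertions s"
      "queries (tick k s) = queries s"
  "mem (store A j x s) = (mem s)(A := (mem s A)(j := x))" "held (store A j x s) = held s"
  "steps (store A j x s) = steps s" "closures (store A j x s) = closures s"
  "insertions (store A j x s) = insertions s" "queries (store A j x s) = queries s"
  "mem (hold res A s) = (mem s)(A := (mem s A)(0 := if res = None then 0 else 1))"
  "held (hold res A s) = res" "steps (hold res A s) = steps s" "closures (hold res A s) = closures
      s"
  "insertions (hold res A s) = insertions s" "queries (hold res A s) = queries s"
  by (simp_all add: tick_def store_def hold_def)

lemma exec_frame: "exec t c s s' \<Longrightarrow> A \<notin> mods c \<Longrightarrow> mem s' A = mem s A"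
  by (induction rule: exec.induct) (auto split: if_splits)

text \<open>Queries and insertions cost a step each, so a bound on the steps bounds them as well.\<close>

lemma exec_queries: "exec t c s s' \<Longrightarrow> queries s' + steps s \<le> queries s + steps s'"
  by (induction rule: exec.induct) auto

lemma exec_insertions: "exec t c s s' \<Longrightarrow> insertions s' + steps s \<le> insertions s + steps s'"
  by (induction rule: exec.induct) auto

text \<open>Outside of loops each occurrence of \<open>Closure\<close> is executed at most once, so
  the syntactic count bounds the dynamic one.\<close>

lemma exec_closures:
  "exec t c s s' \<Longrightarrow> no_loop_closure c \<Longrightarrow> closures s' \<le> closures s + closure_count c"
  by (induction rule: exec.induct) (auto split: if_splits)

lemma exec_insertion_free: "exec t c s s' \<Longrightarrow> insertion_free c \<Longrightarrow> insertions s' = insertions s"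
  by (induction rule: exec.induct) (auto split: if_splits)

lemma reach_frame:
  "reach t c T m h \<Phi> \<Longrightarrow> reach t c T m h (\<lambda>m' h'. \<Phi> m' h' \<and> (\<forall>A. A \<notin> mods c \<longrightarrow> m' A = m A))"
  unfolding reach_def using exec_frame by metis

lemma reach_mono:
  "reach t c T m h \<Psi> \<Longrightarrow> T \<le> T' \<Longrightarrow> (\<And>m' h'. \<Psi> m' h' \<Longrightarrow> \<Phi> m' h') \<Longrightarrow> reach t c T' m h \<Phi>"
  unfolding reach_def
proof (intro allI impI)
  fix s :: state
  assume "\<forall>s. mem s = m \<longrightarrow> held s = h \<longrightarrow>
      (\<exists>s'. exec t c s s' \<and> steps s' \<le> steps s + T \<and> \<Psi> (mem s') (held s'))"
    and T: "T \<le> T'" and \<Phi>: "\<And>m' h'. \<Psi> m' h' \<Longrightarrow> \<Phi> m' h'" and "mem s = m" "held s = h"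
  then obtain s' where s': "exec t c s s'" "steps s' \<le> steps s + T" "\<Psi> (mem s') (held s')" by blast
  then show "\<exists>s'. exec t c s s' \<and> steps s' \<le> steps s + T' \<and> \<Phi> (mem s') (held s')"
    using T \<Phi> by (intro exI[of _ s']) auto
qed

text \<open>The second command may assume that arrays outside of \<open>mods c\<close> are
  unchanged. Postconditions thus mention only what a command computes, and the frame is recovered at
  each composition.\<close>

lemma reach_Seq:
  assumes "reach t c T m h \<Psi>"
    and "\<And>m' h'. \<Psi> m' h' \<Longrightarrow> (\<And>A. A \<notin> mods c \<Longrightarrow> m' A = m A) \<Longrightarrow> reach t c' T' m' h' \<Phi>"
    and "T + T' \<le> T''"
  shows "reach t (Seq c c') T'' m h \<Phi>"
  unfolding reach_def
proof (intro allI impI)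
  fix s :: state assume s: "mem s = m" "held s = h"
  obtain s1 where s1: "exec t c s s1" "steps s1 \<le> steps s + T" "\<Psi> (mem s1) (held s1)"
    "\<And>A. A \<notin> mods c \<Longrightarrow> mem s1 A = m A"
    using reach_frame[OF assms(1), unfolded reach_def, rule_format, OF s] s by blast
  obtain s2 where "exec t c' s1 s2" "steps s2 \<le> steps s1 + T'" "\<Phi> (mem s2) (held s2)"
    using assms(2)[OF s1(3,4), unfolded reach_def] by blast
  then show "\<exists>s'. exec t (Seq c c') s s' \<and> steps s' \<le> steps s + T'' \<and> \<Phi> (mem s') (held s')"
    using exec.Seq[OF s1(1)] s1(2) assms(3) by (intro exI[of _ s2]) auto
qed

lemma reach_Cond:
  assumes "holds m b \<Longrightarrow> reach t c T m h \<Phi>" "\<not> holds m b \<Longrightarrow> reach t c' T m h \<Phi>"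
  shows "reach t (Cond b c c') (Suc T) m h \<Phi>"
  unfolding reach_def
proof (intro allI impI)
  fix s :: state assume s: "mem s = m" "held s = h"
  have "reach t (if holds (mem s) b then c else c') T m h \<Phi>" using assms s by auto
  then obtain s1 where "exec t (if holds (mem s) b then c else c') (tick 1 s) s1"
      "steps s1 \<le> steps (tick 1 s) + T" "\<Phi> (mem s1) (held s1)"
    using s unfolding reach_def by (metis (no_types, lifting) state_simps(1,2))
  then show "\<exists>s'. exec t (Cond b c c') s s' \<and> steps s' \<le> steps s + Suc T \<and> \<Phi> (mem s') (held s')"
    using exec.Cond by (intro exI[of _ s1]) auto
qed

fun cost :: "com \<Rightarrow> nat" where
  "cost (Seq c c') = cost c + cost c'"
| "cost (Cond b c c') = Suc (max (cost c) (cost c'))"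
| "cost _ = 1"

text \<open>Symbolic execution of loop-free code, to be evaluated by the simplifier. Loops and
  \<open>Closure\<close> are mapped to \<open>False\<close>, as they are handled by rules of their
  own.\<close>

fun wp :: "event list \<Rightarrow> com \<Rightarrow> (memory \<Rightarrow> (event set \<times> event rel) option \<Rightarrow> bool) \<Rightarrow>
    memory \<Rightarrow> (event set \<times> event rel) option \<Rightarrow> bool" where
  "wp t Skip \<Phi> m h \<longleftrightarrow> \<Phi> m h"
| "wp t (Assign A i e) \<Phi> m h \<longleftrightarrow> \<Phi> (m(A := (m A)(val m i := val m e))) h"
| "wp t (Seq c c') \<Phi> m h \<longleftrightarrow> wp t c (wp t c' \<Phi>) m h"
| "wp t (Cond b c c') \<Phi> m h \<longleftrightarrow> (if holds m b then wp t c \<Phi> m h else wp t c' \<Phi> m h)"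
| "wp t (While b c) \<Phi> m h \<longleftrightarrow> False"
| "wp t (Closure A n B C D) \<Phi> m h \<longleftrightarrow> False"
| "wp t (InsertAndClose ei ej D) \<Phi> m h \<longleftrightarrow> (\<exists>X Q. h = Some (X, Q) \<and>
     val m ei < length t \<and> val m ej < length t \<and> t ! val m ei \<in> X \<and> t ! val m ej \<in> X \<and>
     (let res = map_option (Pair X) (insert_and_close t X Q (t ! val m ei) (t ! val m ej))
      in \<Phi> (m(D := (m D)(0 := if res = None then 0 else 1))) res))"
| "wp t (Query ei ej D) \<Phi> m h \<longleftrightarrow> (\<exists>X Q. h = Some (X, Q) \<and>
     val m ei < length t \<and> val m ej < length t \<and>
     \<Phi> (m(D := (m D)(0 := if (t ! val m ei, t ! val m ej) \<in> Q then 1 else 0))) h)"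

lemma reach_wp_cost: "wp t c \<Phi> m h \<Longrightarrow> reach t c (cost c) m h \<Phi>"
proof (induction c arbitrary: \<Phi> m h)
  case Skip
  then show ?case using exec.Skip unfolding reach_def by fastforce
next
  case (Assign A i e)
  show ?case
    unfolding reach_def
  proof (intro allI impI)
    fix s :: state assume "mem s = m" "held s = h"
    then show "\<exists>s'. exec t (Assign A i e) s s' \<and> steps s' \<le> steps s + cost (Assign A i e) \<and>
        \<Phi> (mem s') (held s')"
      using Assign exec.Assign[of t A i e s]
      by (intro exI[of _ "tick 1 (store A (val (mem s) i) (val (mem s) e) s)"]) auto
  qed
next
  case (Seq c c')
  then show ?case by (intro reach_Seq[where \<Psi> = "wp t c' \<Phi>"]) auto
next
  case (Cond b c c')
  have "reach t (Cond b c c') (Suc (max (cost c) (cost c'))) m h \<Phi>"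
  proof (rule reach_Cond)
    assume "holds m b"
    then have "reach t c (cost c) m h \<Phi>" using Cond by simp
    then show "reach t c (max (cost c) (cost c')) m h \<Phi>" by (rule reach_mono) auto
  next
    assume "\<not> holds m b"
    then have "reach t c' (cost c') m h \<Phi>" using Cond by simp
    then show "reach t c' (max (cost c) (cost c')) m h \<Phi>" by (rule reach_mono) auto
  qed
  then show ?case by simp
next
  case (InsertAndClose ei ej D)
  show ?case
    unfolding reach_def
  proof (intro allI impI)
    fix s :: state assume s: "mem s = m" "held s = h"
    obtain X Q where h: "h = Some (X, Q)" "val m ei < length t" "val m ej < length t"
        "t ! val m ei \<in> X" "t ! val m ej \<in> X"
      and "let res = map_option (Pair X) (insert_and_close t X Q (t ! val m ei) (t ! val m ej))
      in \<Phi> (m(D := (m D)(0 := if res = None then 0 else 1))) res" using InsertAndClose by auto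
    then show "\<exists>s'. exec t (InsertAndClose ei ej D) s s' \<and>
        steps s' \<le> steps s + cost (InsertAndClose ei ej D) \<and> \<Phi> (mem s') (held s')"
      using s exec.InsertAndClose[of s X Q _ ei _ ej t D, OF _ refl refl]
      by (intro exI[of _ "tick 1 (hold (map_option (Pair X) (insert_and_close t X Q (t ! val (mem
          s) ei)
        (t ! val (mem s) ej))) D (s\<lparr>insertions := insertions s + 1\<rparr>))"]) (auto simp: Let_def)
  qed
next
  case (Query ei ej D)
  show ?case
    unfolding reach_def
  proof (intro allI impI)
    fix s :: state assume s: "mem s = m" "held s = h"
    obtain X Q where h: "h = Some (X, Q)" "val m ei < length t" "val m ej < length t"
      and "\<Phi> (m(D := (m D)(0 := if (t ! val m ei, t ! val m ej) \<in> Q then 1 else 0))) h"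
          using Query by auto
    then show "\<exists>s'. exec t (Query ei ej D) s s' \<and> steps s' \<le> steps s + cost (Query ei ej D) \<and>
        \<Phi> (mem s') (held s')"
      using s exec.Query[of s X Q _ ei _ ej t D, OF _ refl refl]
      by (intro exI[of _ "tick 1 (store D 0 (if (t ! val (mem s) ei, t ! val (mem s) ej) \<in> Q then
          1 else 0)
        (s\<lparr>queries := queries s + 1\<rparr>))"]) auto
  qed
qed auto

lemma reach_wp: "wp t c \<Phi> m h \<Longrightarrow> cost c \<le> T \<Longrightarrow> reach t c T m h \<Phi>"
  using reach_mono reach_wp_cost by blast

section \<open>Counting loops\<close>

definition For :: "string \<Rightarrow> exp \<Rightarrow> com \<Rightarrow> com" where
  "For v e c = Seq (Assign v (Num 0) (Num 0)) (While (Less (Cell v (Num 0)) e)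
     (Seq c (Assign v (Num 0) (Plus (Cell v (Num 0)) (Num 1)))))"

lemma For_simps [simp]:
  "mods (For v e c) = insert v (mods c)" "closure_count (For v e c) = closure_count c"
  "no_loop_closure (For v e c) \<longleftrightarrow> no_loop_closure c \<and> closure_count c = 0"
  "insertion_free (For v e c) \<longleftrightarrow> insertion_free c"
  by (auto simp: For_def)

text \<open>The invariant is indexed by the number of completed rounds and is insensitive to the
  counter cell, which changes outside of the body. Each round pays one step for the test and one for
  the increment; the other 2 steps are the initial assignment and the failing last test.\<close>

lemma reach_For:
  assumes v: "v \<notin> mods c"
    and bound: "\<And>m'. (\<And>A. A \<notin> insert v (mods c) \<Longrightarrow> m' A = m A) \<Longrightarrow> val m' e = N"
    and stable: "\<And>j m' h' x. I j m' h' \<Longrightarrow> I j (m'(v := (m' v)(0 := x))) h'"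
    and init: "I 0 m h"
    and body: "\<And>j m' h'. j < N \<Longrightarrow> I j m' h' \<Longrightarrow> m' v 0 = j \<Longrightarrow>
      (\<And>A. A \<notin> insert v (mods c) \<Longrightarrow> m' A = m A) \<Longrightarrow> reach t c T m' h' (I (Suc j))"
    and post: "\<And>m' h'. I N m' h' \<Longrightarrow> (\<And>A. A \<notin> insert v (mods c) \<Longrightarrow> m' A = m A) \<Longrightarrow> \<Phi> m' h'"
    and time: "2 + N * (T + 2) \<le> T'"
  shows "reach t (For v e c) T' m h \<Phi>"
proof -
  let ?b = "Less (Cell v (Num 0)) e"
  let ?c = "Seq c (Assign v (Num 0) (Plus (Cell v (Num 0)) (Num 1)))"
  have loop: "\<exists>s'. exec t (While ?b ?c) s s' \<and> steps s' \<le> steps s + 1 + (N - j) * (T + 2) \<and>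
      \<Phi> (mem s') (held s')"
    if "j \<le> N" "I j (mem s) (held s)" "mem s v 0 = j" "\<And>A. A \<notin> insert v (mods c) \<Longrightarrow> mem s A = m A"
        for j and s :: state
    using that
  proof (induction "N - j" arbitrary: j s)
    case 0
    then have "j = N" by simp
    moreover have "\<not> holds (mem s) ?b" using bound[of "mem s"] 0(5) 0(4) \<open>j = N\<close> by simp
    ultimately show ?case
      using 0 post exec.WhileFalse[of s ?b t ?c] by (intro exI[of _ "tick 1 s"]) auto
  next
    case (Suc d)
    then have j: "j < N" by simp
    have b: "holds (mem s) ?b" using bound[of "mem s"] Suc(6) Suc(5) j by simp
    have "reach t c T (mem s) (held s) (I (Suc j))" using body[OF j Suc(4,5,6)] .
    then obtain s1 where s1: "exec t c (tick 1 s) s1" "steps s1 \<le> steps (tick 1 s) + T"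
        "I (Suc j) (mem s1) (held s1)"
      unfolding reach_def by (metis state_simps(1,2))
    let ?s2 = "tick 1 (store v 0 (Suc j) s1)"
    have v1: "mem s1 v 0 = j" using exec_frame[OF s1(1) v] Suc(5) by simp
    have e2: "exec t (Assign v (Num 0) (Plus (Cell v (Num 0)) (Num 1))) s1 ?s2"
      using exec.Assign[of t v "Num 0" "Plus (Cell v (Num 0)) (Num 1)" s1] v1 by simp
    have "\<exists>s'. exec t (While ?b ?c) ?s2 s' \<and> steps s' \<le> steps ?s2 + 1 + (N - Suc j) * (T + 2) \<and>
        \<Phi> (mem s') (held s')"
    proof (rule Suc(1))
      show "d = N - Suc j" "Suc j \<le> N" using Suc(2) j by auto
      show "I (Suc j) (mem ?s2) (held ?s2)" using stable[OF s1(3)] by simp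
      show "mem ?s2 v 0 = Suc j" by simp
      show "mem ?s2 A = m A" if "A \<notin> insert v (mods c)" for A
        using that Suc(6)[OF that] exec_frame[OF s1(1), of A] by simp
    qed
    then obtain s' where s': "exec t (While ?b ?c) ?s2 s'" "\<Phi> (mem s') (held s')"
      "steps s' \<le> steps ?s2 + 1 + (N - Suc j) * (T + 2)" by blast
    have "N - j = Suc (N - Suc j)" using j by simp
    then have "steps s' \<le> steps s + 1 + (N - j) * (T + 2)" using s'(3) s1(2) by simp
    then show ?case using exec.WhileTrue[OF b exec.Seq[OF s1(1) e2] s'(1)] s'(2) by blast
  qed
  show ?thesis
    unfolding reach_def For_def
  proof (intro allI impI)
    fix s :: state assume s: "mem s = m" "held s = h"
    let ?s1 = "tick 1 (store v 0 0 s)"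
    have e: "exec t (Assign v (Num 0) (Num 0)) s ?s1" using exec.Assign[of t v "Num 0" "Num 0" s]
        by simp
    have "\<exists>s'. exec t (While ?b ?c) ?s1 s' \<and> steps s' \<le> steps ?s1 + 1 + (N - 0) * (T + 2) \<and>
        \<Phi> (mem s') (held s')"
      by (rule loop) (use s stable[OF init] in auto)
    then show "\<exists>s'. exec t (Seq (Assign v (Num 0) (Num 0)) (While ?b ?c)) s s' \<and>
        steps s' \<le> steps s + T' \<and> \<Phi> (mem s') (held s')"
      using exec.Seq[OF e] time by fastforce
  qed
qed

section \<open>Construction of a witness\<close>

text \<open>Positions are shifted by one, as \<open>0\<close> stands for the absence of an event.\<close>

definition first_of :: "(nat \<Rightarrow> nat) \<Rightarrow> nat set \<Rightarrow> nat \<Rightarrow> nat" where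
  "first_of pr R p = (if \<exists>j\<in>R. pr j = p then Suc (LEAST j. j \<in> R \<and> pr j = p) else 0)"

lemma first_of_eq_0: "first_of pr R p = 0 \<longleftrightarrow> (\<forall>j\<in>R. pr j \<noteq> p)"
  by (auto simp: first_of_def)

lemma first_of_pos:
  assumes "0 < first_of pr R p"
  shows "first_of pr R p - 1 \<in> R" "pr (first_of pr R p - 1) = p"
    "j \<in> R \<Longrightarrow> pr j = p \<Longrightarrow> first_of pr R p - 1 \<le> j"
proof -
  obtain i where i: "i \<in> R \<and> pr i = p" using assms by (auto simp: first_of_def split: if_splits)
  then have *: "first_of pr R p - 1 = (LEAST j. j \<in> R \<and> pr j = p)" by (auto simp: first_of_def)
  show "first_of pr R p - 1 \<in> R" "pr (first_of pr R p - 1) = p" using LeastI[of "\<lambda>j. j \<in> R \<and>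
      pr j = p", OF i] unfolding * by auto
  show "j \<in> R \<Longrightarrow> pr j = p \<Longrightarrow> first_of pr R p - 1 \<le> j" unfolding * by (rule Least_le) auto
qed

lemma first_of_cong: "(\<And>j. pr j = p \<Longrightarrow> j \<in> R \<longleftrightarrow> j \<in> R') \<Longrightarrow> first_of pr R p = first_of pr R' p"
proof -
  assume "\<And>j. pr j = p \<Longrightarrow> j \<in> R \<longleftrightarrow> j \<in> R'"
  then have "(\<lambda>j. j \<in> R \<and> pr j = p) = (\<lambda>j. j \<in> R' \<and> pr j = p)" by auto
  then show ?thesis unfolding first_of_def Bex_def by metis
qed

lemma first_of_insert_min:
  assumes "\<And>j. j \<in> R \<Longrightarrow> i < j"
  shows "first_of pr (insert i R) p = (if pr i = p then Suc i else first_of pr R p)"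
proof (cases "pr i = p")
  case True
  have "(LEAST j. j \<in> insert i R \<and> pr j = p) = i"
    using assms True by (intro Least_equality) (auto intro: less_imp_le)
  then show ?thesis using True by (simp add: first_of_def)
next
  case False
  then have "first_of pr (insert i R) p = first_of pr R p" by (intro first_of_cong) auto
  then show ?thesis using False by simp
qed

abbreviation V :: "string \<Rightarrow> exp" where "V x \<equiv> Cell x (Num 0)"

abbreviation put :: "string \<Rightarrow> exp \<Rightarrow> com" where "put x e \<equiv> Assign x (Num 0) e"

abbreviation guarded :: "test \<Rightarrow> com \<Rightarrow> com" where "guarded b c \<equiv> Cond b c Skip"

abbreviation either :: "test \<Rightarrow> test \<Rightarrow> test" where "either b b' \<equiv> Neg (Conj (Neg b) (Neg b'))"

abbreviation seq (infixr ";;" 60) where "c ;; c' \<equiv> Seq c c'"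

definition pick_process :: com where
  "pick_process = Cond (Equal (V ''i'') (Num 1)) (put ''q'' (Cell ''proc'' (V ''e1'')))
     (put ''q'' (Cell ''proc'' (V ''e2'')))"

text \<open>The marks of the decision program are not in the input memory, so membership in
  \<open>X\<close> is recovered from the held order, which is reflexive exactly on \<open>X\<close>.
  Positions are scanned downwards, so that each new one goes to the front of the chain of its
  process.\<close>

definition build_chains :: com where
  "build_chains = For ''c'' (V ''n'') (
     put ''j'' (Minus (Minus (V ''n'') (Num 1)) (V ''c'')) ;;
     Query (V ''j'') (V ''j'') ''d'' ;;
     Assign ''in'' (V ''j'') (V ''d'') ;;
     guarded (Equal (V ''d'') (Num 1)) (
       Assign ''next'' (V ''j'') (Cell ''head'' (Cell ''proc'' (V ''j''))) ;;
       Assign ''head'' (Cell ''proc'' (V ''j'')) (Plus (V ''j'') (Num 1))))"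

text \<open>One sweep over the processes keeps a minimal candidate in \<open>x\<close>, with at most
  two queries per process: one against the head of \<open>q\<close> and one against
  \<open>x\<close>.\<close>

definition pick_event :: com where
  "pick_event = For ''p'' (V ''processes'') (
     guarded (Conj (Neg (Equal (V ''p'') (V ''q''))) (Less (Num 0) (Cell ''head'' (V ''p'')))) (
       put ''d'' (Num 0) ;;
       guarded (Less (Num 0) (Cell ''head'' (V ''q''))) (
         Query (Minus (Cell ''head'' (V ''q'')) (Num 1)) (Minus (Cell ''head'' (V ''p'')) (Num 1))
             ''d'') ;;
       guarded (Equal (V ''d'') (Num 0)) (
         Cond (Equal (V ''x'') (Num 0)) (put ''x'' (Cell ''head'' (V ''p''))) (
           Query (Minus (Cell ''head'' (V ''p'')) (Num 1)) (Minus (V ''x'') (Num 1)) ''d'' ;;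
           guarded (Equal (V ''d'') (Num 1)) (put ''x'' (Cell ''head'' (V ''p'')))))))"

definition emit :: "exp \<Rightarrow> com" where
  "emit e = Assign ''out'' (V ''len'') e ;; put ''len'' (Plus (V ''len'') (Num 1))"

text \<open>\<open>n\<close> rounds are enough for every \<open>X\<close>; once all chains are
  empty, \<open>x\<close> stays 0 and a round emits nothing. The head of \<open>q\<close> is taken
  only if no other process has a candidate, which realises the delay of \<open>q\<close>.\<close>

definition linearize :: com where
  "linearize = For ''c'' (V ''n'') (
     put ''x'' (Num 0) ;;
     pick_event ;;
     guarded (Equal (V ''x'') (Num 0)) (put ''x'' (Cell ''head'' (V ''q''))) ;;
     guarded (Less (Num 0) (V ''x'')) (
       put ''j'' (Minus (V ''x'') (Num 1)) ;;
       emit (V ''j'') ;;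
       Assign ''head'' (Cell ''proc'' (V ''j'')) (Cell ''next'' (V ''j''))))"

definition append_writes :: com where
  "append_writes = For ''c'' (V ''variables'') (
     guarded (Conj (Equal (Cell ''in'' (V ''c'')) (Num 0))
         (Conj (Neg (Equal (Cell ''proc'' (V ''c'')) (Cell ''proc'' (V ''e1''))))
           (Neg (Equal (Cell ''proc'' (V ''c'')) (Cell ''proc'' (V ''e2''))))))
       (emit (V ''c'')))"

definition witness_program :: com where
  "witness_program = pick_process ;; build_chains ;; linearize ;; append_writes ;;
     emit (V ''e1'') ;; emit (V ''e2'')"

section \<open>Greedy choice of the next event\<close>

locale ordered_trace =
  fixes t :: "event list" and X :: "event set" and Q :: "event rel" and q k :: nat
  assumes dist: "distinct t" and closed: "closed_order t X Q" and X_sub: "X \<subseteq> set t"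
    and procs: "\<And>e. e \<in> set t \<Longrightarrow> proc e < k"
begin

definition pr :: "nat \<Rightarrow> nat" where "pr j = proc (t ! j)"

definition S :: "nat set" where "S = {j. j < length t \<and> t ! j \<in> X}"

lemma query_refl: "j < length t \<Longrightarrow> (t ! j, t ! j) \<in> Q \<longleftrightarrow> j \<in> S"
  using partial_order_onD(1,2)[OF closed_orderD(1)[OF closed]] by (auto simp: S_def)

lemmas porder = partial_order_onD[OF closed_orderD(1)[OF closed]]

lemma same_proc_ordered: "i \<in> S \<Longrightarrow> j \<in> S \<Longrightarrow> i \<le> j \<Longrightarrow> pr i = pr j \<Longrightarrow> (t ! i, t ! j) \<in> Q"
  using closed_orderD(2)[OF closed, of "t ! i" "t ! j"] porder(2) before_nth[OF dist, of i j]
  by (cases "i = j") (auto simp: S_def po_def pr_def)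

lemma index_eq: "i \<in> S \<Longrightarrow> j \<in> S \<Longrightarrow> t ! i = t ! j \<Longrightarrow> i = j"
  using nth_eq_iff_index_eq[OF dist] by (auto simp: S_def)

lemma S_procs: "j \<in> S \<Longrightarrow> pr j < k"
  using procs by (auto simp: S_def pr_def)

abbreviation ev :: "nat \<Rightarrow> event" where "ev x \<equiv> t ! (x - 1)"

text \<open>A head of a process other than \<open>q\<close> is a candidate unless the head of \<open>q\<close> lies below it.  As
  the heads are the least remaining events of their processes, a candidate that is minimal among
  the candidates is minimal among all remaining events.\<close>

definition candidate :: "nat set \<Rightarrow> nat \<Rightarrow> bool" where
  "candidate R p \<longleftrightarrow> p \<noteq> q \<and> 0 < first_of pr R p \<and>
     \<not> (0 < first_of pr R q \<and> (ev (first_of pr R q), ev (first_of pr R p)) \<in> Q)"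

text \<open>Loop invariant of the sweep after the processes below \<open>p\<close>. Minimality
  compares heads rather than events, because the program stores positions.\<close>

definition selected :: "nat set \<Rightarrow> nat \<Rightarrow> nat \<Rightarrow> bool" where
  "selected R p x \<longleftrightarrow> (x = 0 \<and> (\<forall>p'<p. \<not> candidate R p')) \<or>
     ((\<exists>p0<p. candidate R p0 \<and> x = first_of pr R p0) \<and>
      (\<forall>p'<p. candidate R p' \<longrightarrow> (ev (first_of pr R p'), ev x) \<in> Q \<longrightarrow> first_of pr R p' = x))"

text \<open>Passing to a smaller head preserves minimality by transitivity and antisymmetry; if
  \<open>x\<close> is kept, the new head is not below it.\<close>

lemma selected_Suc:
  assumes R: "R \<subseteq> S" and s: "selected R p x"
  shows "\<not> candidate R p \<Longrightarrow> selected R (Suc p) x"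
    and "candidate R p \<Longrightarrow> x = 0 \<Longrightarrow> selected R (Suc p) (first_of pr R p)"
    and "candidate R p \<Longrightarrow> x > 0 \<Longrightarrow> (ev (first_of pr R p), ev x) \<notin> Q \<Longrightarrow> selected R (Suc p) x"
    and "candidate R p \<Longrightarrow> x > 0 \<Longrightarrow> (ev (first_of pr R p), ev x) \<in> Q \<Longrightarrow>
        selected R (Suc p) (first_of pr R p)"
proof -
  have eq: "first_of pr R a = first_of pr R b"
    if "candidate R a" "candidate R b" "ev (first_of pr R a) = ev (first_of pr R b)" for a b
  proof -
    have "0 < first_of pr R a" "0 < first_of pr R b" using that by (auto simp: candidate_def)
    then have "first_of pr R a - 1 = first_of pr R b - 1"
      using index_eq that(3) first_of_pos(1) R by blast
    then show ?thesis using \<open>0 < first_of pr R a\<close> \<open>0 < first_of pr R b\<close> by simp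
  qed
  show "\<not> candidate R p \<Longrightarrow> selected R (Suc p) x"
    using s unfolding selected_def less_Suc_eq by blast
  show "selected R (Suc p) (first_of pr R p)" if "candidate R p" "x = 0"
  proof -
    have "\<forall>p'<p. \<not> candidate R p'" using s that by (auto simp: selected_def candidate_def)
    then show ?thesis using that unfolding selected_def less_Suc_eq by blast
  qed
  show "selected R (Suc p) x" if "candidate R p" "x > 0" "(ev (first_of pr R p), ev x) \<notin> Q"
    using s that unfolding selected_def less_Suc_eq by blast
  show "selected R (Suc p) (first_of pr R p)"
    if c: "candidate R p" "x > 0" "(ev (first_of pr R p), ev x) \<in> Q"
  proof -
    obtain p0 where p0: "p0 < p" "candidate R p0" "x = first_of pr R p0"
      and min: "\<forall>p'<p. candidate R p' \<longrightarrow> (ev (first_of pr R p'), ev x) \<in> Q \<longrightarrow> first_of pr R p' = x"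
      using s c(2) unfolding selected_def by auto
    have "first_of pr R p' = first_of pr R p"
      if p': "p' < p" "candidate R p'" "(ev (first_of pr R p'), ev (first_of pr R p)) \<in> Q" for p'
    proof -
      have "first_of pr R p' = x" using min p' porder(3)[OF p'(3) c(3)] by blast
      then have "ev x = ev (first_of pr R p)" using p'(3) c(3) porder(4) by simp
      then show ?thesis using eq[OF p'(2) c(1)] \<open>first_of pr R p' = x\<close> by simp
    qed
    then show ?thesis using c unfolding selected_def less_Suc_eq by blast
  qed
qed

text \<open>Every remaining event lies above the head of its process, and outside of
  \<open>q\<close> a head that is no candidate lies above the head of \<open>q\<close>. Without
  candidates the head of \<open>q\<close> is therefore below everything that remains. Otherwise an
  event below \<open>x\<close> would yield a candidate below \<open>x\<close>, since the head of
  \<open>q\<close> is not below \<open>x\<close>.\<close>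

lemma selected_minimal:
  assumes R: "R \<subseteq> S" and s: "selected R k x" and y: "y = (if x = 0 then first_of pr R q else x)"
  shows "y = 0 \<Longrightarrow> R = {}"
    and "0 < y \<Longrightarrow> y - 1 \<in> R \<and> y = first_of pr R (pr (y - 1))"
    and "0 < y \<Longrightarrow> j \<in> R \<Longrightarrow> j \<noteq> y - 1 \<Longrightarrow> late_after q Q (ev y) (t ! j)"
proof -
  let ?H = "first_of pr R"
  have head: "0 < ?H (pr i)" "?H (pr i) - 1 \<in> R" "(ev (?H (pr i)), t ! i) \<in> Q"
    "pr (?H (pr i) - 1) = pr i" if "i \<in> R" for i
  proof -
    show p: "0 < ?H (pr i)" using that first_of_eq_0[of pr R "pr i"] by auto
    show "?H (pr i) - 1 \<in> R" "pr (?H (pr i) - 1) = pr i" using first_of_pos[OF p] by auto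
    then show "(ev (?H (pr i)), t ! i) \<in> Q"
      using same_proc_ordered first_of_pos(3)[OF p that] that R by blast
  qed
  have qcand: "0 < ?H q \<and> (ev (?H q), ev (?H (pr i))) \<in> Q" if "i \<in> R" "pr i \<noteq> q"
      "\<not> candidate R (pr i)" for i
    using that head unfolding candidate_def by blast
  show "R = {}" if "y = 0"
  proof (rule ccontr)
    assume "R \<noteq> {}"
    then obtain i where i: "i \<in> R" by blast
    have x: "x = 0" "?H q = 0" using that y by (auto split: if_splits)
    then have "\<not> candidate R (pr i)"
      using s S_procs i R unfolding selected_def candidate_def by fastforce
    moreover have "pr i \<noteq> q" using x(2) i by (auto simp: first_of_eq_0)
    ultimately show False using qcand i x by simp
  qed
  show 1: "y - 1 \<in> R \<and> y = ?H (pr (y - 1))" if "0 < y"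
  proof -
    obtain p where "y = ?H p" using s y unfolding selected_def by (auto split: if_splits)
    then show ?thesis using first_of_pos(1,2)[of pr R p] that by simp
  qed
  show "late_after q Q (ev y) (t ! j)" if y0: "0 < y" and j: "j \<in> R" "j \<noteq> y - 1"
  proof (cases "x = 0")
    case True
    then have yq: "y = ?H q" "0 < ?H q" using y y0 by auto
    have nc: "\<not> candidate R (pr j)"
      using s True S_procs j R unfolding selected_def candidate_def by fastforce
    have le: "(ev y, t ! j) \<in> Q"
    proof (cases "pr j = q")
      case True
      then show ?thesis using head(3)[OF j(1)] yq by simp
    next
      case False
      then show ?thesis using qcand[OF j(1) False nc] porder(3) head(3)[OF j(1)] yq by blast
    qed
    moreover have "(t ! j, ev y) \<notin> Q"
    proof
      assume "(t ! j, ev y) \<in> Q"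
      then have "t ! j = ev y" using le porder(4) by blast
      then show False using index_eq j 1[OF y0] R by blast
    qed
    ultimately show ?thesis by (simp add: late_after_def)
  next
    case False
    then obtain p0 where p0: "candidate R p0" "x = ?H p0"
      and min: "\<forall>p'<k. candidate R p' \<longrightarrow> (ev (?H p'), ev x) \<in> Q \<longrightarrow> ?H p' = x"
      using s unfolding selected_def by auto
    have "y = x" using y False by simp
    \<comment> \<open>The second half of \<open>late_after\<close> only restricts events of
      \<open>q\<close> in front, so it is void for the chosen event.\<close>
    have pq: "proc (ev y) \<noteq> q"
      using p0 first_of_pos(2)[of pr R p0] \<open>y = x\<close> by (auto simp: candidate_def pr_def)
    have "(t ! j, ev x) \<notin> Q"
    proof
      assume le: "(t ! j, ev x) \<in> Q"
      then have hx: "(ev (?H (pr j)), ev x) \<in> Q" using porder(3) head(3)[OF j(1)] by blast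
      have n: "\<not> (0 < ?H q \<and> (ev (?H q), ev x) \<in> Q)" using p0 by (simp add: candidate_def)
      have "pr j \<noteq> q" using n hx head(1)[OF j(1)] by auto
      then have "candidate R (pr j)"
        using n hx qcand[OF j(1)] porder(3) by blast
      then have hj: "?H (pr j) = x" using min hx S_procs j R by blast
      then have "(ev x, t ! j) \<in> Q" using head(3)[OF j(1)] by simp
      then have "t ! j = ev x" using le porder(4) by blast
      then show False using index_eq j 1[OF y0] R \<open>y = x\<close> by blast
    qed
    then show ?thesis using pq \<open>y = x\<close> by (simp add: late_after_def)
  qed
qed

section \<open>Correctness of the witness program\<close>

lemma build_chains_reach:
  assumes n: "m ''n'' 0 = length t" and P: "\<And>j. j < length t \<Longrightarrow> m ''proc'' j = pr j"
    and z: "\<And>p. m ''head'' p = 0"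
  shows "reach t build_chains (2 + length t * 8) m (Some (X, Q)) (\<lambda>m' h'. h' = Some (X, Q) \<and>
    (\<forall>p. m' ''head'' p = first_of pr S p) \<and>
    (\<forall>j\<in>S. m' ''next'' j = first_of pr (S \<inter> {j<..}) (pr j)) \<and>
    (\<forall>j<length t. m' ''in'' j = 0 \<longleftrightarrow> j \<notin> S))"
  unfolding build_chains_def
proof (rule reach_For[where N = "length t" and T = 6 and I = "\<lambda>c m' h'. h' = Some (X, Q) \<and>
    (\<forall>p. m' ''head'' p = first_of pr (S \<inter> {length t - c..}) p) \<and>
    (\<forall>j\<in>S. length t - c \<le> j \<longrightarrow> m' ''next'' j = first_of pr (S \<inter> {j<..}) (pr j)) \<and>
    (\<forall>j<length t. length t - c \<le> j \<longrightarrow> (m' ''in'' j = 0 \<longleftrightarrow> j \<notin> S))"], goal_cases)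
  case 1 then show ?case by simp
next
  case (2 m') then show ?case using n by simp
next
  case (3 j m' h' x) then show ?case by simp
next
  case 4
  have "S \<inter> {length t..} = {}" by (auto simp: S_def)
  then show ?case using z by (auto simp: first_of_def S_def)
next
  case (5 c m' h')
  let ?n = "length t"
  \<comment> \<open>Round \<open>c\<close> treats position \<open>n - 1 - c\<close>; the invariant
    covers the positions from \<open>n - c\<close> upwards.\<close>
  define J where "J = ?n - Suc c"
  have J: "J < ?n" "?n - c = Suc J" "?n - Suc 0 - c = J" "?n - Suc c = J" using 5(1)
      unfolding J_def by arith+
  have fr: "m' ''n'' 0 = ?n" "m' ''proc'' J = pr J"
    using 5(4)[of "''n''"] 5(4)[of "''proc''"] n P J(1) by simp_all
  note I = 5(2)[unfolded J(2)]
  show ?case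
  proof (cases "J \<in> S")
    case True
    have S1: "S \<inter> {J..} = insert J (S \<inter> {J<..})" using True by auto
    have h: "m' ''head'' p = first_of pr (S \<inter> {J<..}) p" for p
      using I by (simp add: atLeast_Suc_greaterThan)
    have f: "first_of pr (S \<inter> {J..}) p = (if pr J = p then Suc J else first_of pr (S \<inter> {J<..}) p)"
        for p
      unfolding S1 by (rule first_of_insert_min) auto
    have le: "Suc J \<le> i" if "J \<le> i" "i \<noteq> J" for i using that by simp
    show ?thesis
      by (rule reach_wp) (use I 5(3) fr J query_refl[OF J(1)] True le in \<open>auto simp: h f\<close>)
  next
    case False
    have "S \<inter> {J..} = S \<inter> {Suc J..}" using False by (auto simp: Suc_le_eq le_less)
    moreover have "Suc J \<le> i" if "J \<le> i" "i \<noteq> J" for i using that by simp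
    ultimately show ?thesis
      by (intro reach_wp) (use I 5(3) fr J query_refl[OF J(1)] False in auto)
  qed
next
  case (6 m' h')
  have "S \<inter> {0..} = S" by auto
  then show ?case using 6(1) by simp
next
  case 7 then show ?case by simp
qed

lemma pick_event_reach:
  assumes k: "m ''processes'' 0 = k" and q: "m ''q'' 0 = q" and R: "R \<subseteq> S"
    and H: "\<And>p. m ''head'' p = first_of pr R p" and x: "m ''x'' 0 = 0"
  shows "reach t pick_event (2 + k * 12) m (Some (X, Q)) (\<lambda>m' h'. h' = Some (X, Q) \<and>
      selected R k (m' ''x'' 0))"
  unfolding pick_event_def
proof (rule reach_For[where N = k and T = 10 and I = "\<lambda>p m' h'. h' = Some (X, Q) \<and>
    selected R p (m' ''x'' 0)"], goal_cases)
  case 1 then show ?case by simp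
next
  case (2 m') then show ?case using k by simp
next
  case (3 j m' h' x) then show ?case by simp
next
  case 4 then show ?case using x by (simp add: selected_def)
next
  case (5 p m' h')
  have fr: "m' ''q'' 0 = q" "\<And>p. m' ''head'' p = first_of pr R p"
    using 5(4)[of "''q''"] 5(4)[of "''head''"] q H by simp_all
  have I: "h' = Some (X, Q)" "selected R p (m' ''x'' 0)" using 5(2) by auto
  have lt: "first_of pr R p' - Suc 0 < length t" if "0 < first_of pr R p'" for p'
    using first_of_pos(1)[OF that] R by (auto simp: S_def)
  have ltx: "m' ''x'' 0 - Suc 0 < length t" if "0 < m' ''x'' 0"
    using I(2) that lt unfolding selected_def by auto
  note Suc = selected_Suc[OF R I(2)]
  have qx: "m' ''q'' 0 = q" "m' ''p'' 0 = p" using fr 5(3) by auto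
  consider (skip) "p = q \<or> \<not> 0 < first_of pr R p"
    | (above) "p \<noteq> q" "0 < first_of pr R p" "0 < first_of pr R q"
        "(ev (first_of pr R q), ev (first_of pr R p)) \<in> Q"
    | (cand) "candidate R p" using candidate_def by metis
  then show ?case
  proof cases
    case skip
    then have "\<not> candidate R p" by (auto simp: candidate_def)
    from Suc(1)[OF this] show ?thesis
      by (intro reach_wp) (use skip I(1) qx fr(2) in auto)
  next
    case above
    then have "\<not> candidate R p" by (auto simp: candidate_def)
    from Suc(1)[OF this] show ?thesis
      by (intro reach_wp) (use above I(1) qx fr(2) lt[OF above(2)] lt[OF above(3)] in simp_all)
  next
    case cand
    then have c: "p \<noteq> q" "0 < first_of pr R p" by (auto simp: candidate_def)
    have n: "0 < first_of pr R q \<Longrightarrow> (ev (first_of pr R q), ev (first_of pr R p)) \<notin> Q"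
      using cand by (auto simp: candidate_def)
    show ?thesis
    proof (cases "m' ''x'' 0 = 0")
      case True
      from Suc(2)[OF cand True] show ?thesis
        by (intro reach_wp) (use c n True I(1) qx fr(2) lt[OF c(2)] lt in simp_all)
    next
      case False
      then have x: "0 < m' ''x'' 0" by simp
      show ?thesis
      proof (cases "(ev (first_of pr R p), ev (m' ''x'' 0)) \<in> Q")
        case True
        from Suc(4)[OF cand x True] show ?thesis
          by (intro reach_wp) (use c n x True I(1) qx fr(2) lt[OF c(2)] lt ltx[OF x] in simp_all)
      next
        case False
        from Suc(3)[OF cand x False] show ?thesis
          by (intro reach_wp) (use c n x False I(1) qx fr(2) lt[OF c(2)] lt ltx[OF x] in simp_all)
      qed
    qed
  qed
next
  case (6 m' h') then show ?case by simp
next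
  case 7 then show ?case by simp
qed

end

definition emitted :: "memory \<Rightarrow> nat list" where
  "emitted m = map (m ''out'') [0..<m ''len'' 0]"

lemma emitted_snoc:
  "m' ''out'' = (m ''out'')(m ''len'' 0 := j) \<Longrightarrow> m' ''len'' 0 = Suc (m ''len'' 0) \<Longrightarrow>
    emitted m' = emitted m @ [j]"
  by (simp add: emitted_def)

context ordered_trace
begin

abbreviation late_index :: "nat \<Rightarrow> nat \<Rightarrow> bool" where
  "late_index i j \<equiv> late_after q Q (t ! i) (t ! j)"

text \<open>\<open>R\<close> holds the positions still to be emitted. Its closure under later
  positions of the same process lets the fixed \<open>next\<close> links serve as heads of
  \<open>R\<close>. The last conjunct counts rounds: as long as something remains, every round has
  emitted one event.\<close>

definition linear_inv :: "nat \<Rightarrow> memory \<Rightarrow> nat set \<Rightarrow> bool" where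
  "linear_inv c m R \<longleftrightarrow> R \<subseteq> S \<and> (\<forall>j\<in>R. \<forall>i\<in>S. j < i \<and> pr i = pr j \<longrightarrow> i \<in> R) \<and>
     (\<forall>p. m ''head'' p = first_of pr R p) \<and> distinct (emitted m) \<and> set (emitted m) = S - R \<and>
     sorted_wrt late_index (emitted m) \<and> (\<forall>i\<in>S - R. \<forall>j\<in>R. late_index i j) \<and>
     (R = {} \<or> m ''len'' 0 = c)"

text \<open>The link stored at \<open>j\<close> was computed for \<open>S\<close>, not for
  \<open>R\<close>. Behind \<open>j\<close> the two sets agree within the process of
  \<open>j\<close>, because \<open>j\<close> is the least position of \<open>R\<close> there and
  \<open>R\<close> contains everything later.\<close>

lemma linear_inv_step:
  assumes inv: "linear_inv c m R" and j: "j \<in> R" "Suc j = first_of pr R (pr j)"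
    and min: "\<And>i. i \<in> R \<Longrightarrow> i \<noteq> j \<Longrightarrow> late_index j i"
    and m': "m' ''out'' = (m ''out'')(m ''len'' 0 := j)" "m' ''len'' 0 = Suc (m ''len'' 0)"
      "m' ''head'' = (m ''head'')(pr j := first_of pr (S \<inter> {j<..}) (pr j))"
  shows "linear_inv (Suc c) m' (R - {j})"
proof -
  note inv = inv[unfolded linear_inv_def]
  have em: "emitted m' = emitted m @ [j]" using emitted_snoc m' by blast
  have jS: "j \<in> S" using inv j by blast
  have head: "m' ''head'' p = first_of pr (R - {j}) p" for p
  proof (cases "p = pr j")
    case True
    have "i \<in> S \<inter> {j<..} \<longleftrightarrow> i \<in> R - {j}" if "pr i = p" for i
    proof
      assume "i \<in> S \<inter> {j<..}"
      then show "i \<in> R - {j}" using inv j(1) that True by auto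
    next
      assume i: "i \<in> R - {j}"
      then have "j \<le> i" using first_of_pos(3)[of pr R p i] j(2) that True by simp
      then show "i \<in> S \<inter> {j<..}" using i inv by auto
    qed
    then have "first_of pr (S \<inter> {j<..}) p = first_of pr (R - {j}) p" by (rule first_of_cong)
    then show ?thesis using m'(3) True by simp
  next
    case False
    then have "first_of pr R p = first_of pr (R - {j}) p" by (intro first_of_cong) auto
    then show ?thesis using m'(3) inv False by simp
  qed
  have up: "\<forall>i\<in>R - {j}. \<forall>i'\<in>S. i < i' \<and> pr i' = pr i \<longrightarrow> i' \<in> R - {j}"
  proof (intro ballI impI)
    fix i i' assume i: "i \<in> R - {j}" "i' \<in> S" "i < i' \<and> pr i' = pr i"
    then have "i' \<in> R" using inv by blast
    moreover have "i' \<noteq> j"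
      using first_of_pos(3)[of pr R "pr j" i] j(2) i by auto
    ultimately show "i' \<in> R - {j}" by simp
  qed
  have "R - {j} \<subseteq> S" "distinct (emitted m @ [j])" "set (emitted m @ [j]) = S - (R - {j})"
    using inv j(1) jS by auto
  moreover have "sorted_wrt late_index (emitted m @ [j])"
    using inv j(1) by (simp add: sorted_wrt_append)
  moreover have "late_index i i'" if "i \<in> S - (R - {j})" "i' \<in> R - {j}" for i i'
    using inv that min by (cases "i = j") blast+
  moreover have "m' ''len'' 0 = Suc c" using inv j(1) m'(2) by auto
  ultimately show ?thesis unfolding linear_inv_def em using up head by blast
qed

lemma linearize_reach:
  assumes n: "m ''n'' 0 = length t" "m ''processes'' 0 = k" "m ''q'' 0 = q"
    and P: "\<And>j. j < length t \<Longrightarrow> m ''proc'' j = pr j"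
    and H: "\<And>p. m ''head'' p = first_of pr S p"
    and N: "\<And>j. j \<in> S \<Longrightarrow> m ''next'' j = first_of pr (S \<inter> {j<..}) (pr j)"
    and len: "m ''len'' 0 = 0"
  shows "reach t linearize (2 + length t * (14 + k * 12)) m (Some (X, Q)) (\<lambda>m' h'. h' = Some (X,
      Q) \<and>
    distinct (emitted m') \<and> set (emitted m') = S \<and> sorted_wrt late_index (emitted m'))"
  unfolding linearize_def
proof (rule reach_For[where N = "length t" and T = "12 + k * 12" and
      I = "\<lambda>c m' h'. h' = Some (X, Q) \<and> (\<exists>R. linear_inv c m' R)"], goal_cases)
  case 1 then show ?case by (simp add: pick_event_def emit_def)
next
  case (2 m') then show ?case using n(1) by (simp add: pick_event_def emit_def)
next
  case (3 j m' h' x) then show ?case by (auto simp: linear_inv_def emitted_def)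
next
  case 4
  have "linear_inv 0 m S" using H len by (auto simp: linear_inv_def emitted_def)
  then show ?case by blast
next
  case (5 c m' h')
  obtain R where R: "linear_inv c m' R" and h': "h' = Some (X, Q)" using 5(2) by blast
  have RS: "R \<subseteq> S" and HR: "m' ''head'' p = first_of pr R p" for p using R
      by (auto simp: linear_inv_def)
  have fr: "m' ''processes'' 0 = k" "m' ''q'' 0 = q" "m' ''proc'' = m ''proc''"
      "m' ''next'' = m ''next''"
    using 5(4)[of "''processes''"] 5(4)[of "''q''"] 5(4)[of "''proc''"] 5(4)[of "''next''"] n
    by (simp_all add: pick_event_def emit_def)
  show ?case
  proof (rule reach_Seq[where T = 1 and T' = "11 + k * 12" and \<Psi> = "\<lambda>m1 h1. h1 = h' \<and>
      m1 ''x'' 0 = 0"], goal_cases)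
    case 1 show ?case by (rule reach_wp) simp_all
  next
    case (2 m1 h1)
    have fr1: "m1 A = m' A" if "A \<noteq> ''x''" for A using 2(2)[of A] that by simp
    show ?case
    proof (rule reach_Seq[where T = "2 + k * 12" and T' = 9 and
          \<Psi> = "\<lambda>m2 h2. h2 = Some (X, Q) \<and> selected R k (m2 ''x'' 0)"], goal_cases)
      case 1
      have "h1 = Some (X, Q)" using 2(1) h' by simp
      then show ?case
        using pick_event_reach[of m1 R] fr1 fr HR RS 2(1) by simp
    next
      case (2 m2 h2)
      have "m2 A = m1 A" if "A \<notin> {''p'', ''d'', ''x''}" for A
        using 2(2)[of A] that by (simp add: pick_event_def)
      then have fr2: "m2 A = m' A" if "A \<notin> {''p'', ''d'', ''x''}" for A using that fr1[of A] by simp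
      define y where "y = (if m2 ''x'' 0 = 0 then first_of pr R q else m2 ''x'' 0)"
      note sel = selected_minimal[OF RS conjunct2[OF 2(1)] y_def]
      have fr3: "m2 ''q'' 0 = q" "\<And>p. m2 ''head'' p = first_of pr R p" "m2 ''out'' = m' ''out''"
        "m2 ''len'' = m' ''len''" "m2 ''next'' = m ''next''" "m2 ''proc'' = m ''proc''"
        using fr2 fr HR by auto
      have fr4: "m2 ''head'' = m' ''head''" using fr2 by simp
      show ?case
      proof (cases "y = 0")
        case True
        then have "R = {}" using sel(1) by simp
        then have I: "linear_inv (Suc c) m3 {}" if "\<And>A. A \<noteq> ''x'' \<Longrightarrow> m3 A = m2 A" for m3
          using R that fr3 fr4 by (simp add: linear_inv_def emitted_def)
        have yz: "m2 ''x'' 0 = 0" "first_of pr R q = 0" using True by (auto simp: y_def split: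
            if_splits)
        show ?thesis
          by (rule reach_wp) (use yz fr3 2(1) I in \<open>auto intro!: exI[of _ "{}"] simp: emit_def\<close>)
      next
        case False
        define j where "j = y - 1"
        have j: "j \<in> R" "Suc j = first_of pr R (pr j)" "y = Suc j"
          using sel(2) False by (auto simp: j_def)
        have min: "late_index j i" if "i \<in> R" "i \<noteq> j" for i
          using sel(3)[OF _ that(1)] that(2) False by (simp add: j_def)
        have jn: "j < length t" "j \<in> S" using j(1) RS by (auto simp: S_def)
        have I: "linear_inv (Suc c) m3 (R - {j})"
          if "m3 ''out'' = (m' ''out'')(m' ''len'' 0 := j)" "m3 ''len'' 0 = Suc (m' ''len'' 0)"
            "m3 ''head'' = (m' ''head'')(pr j := first_of pr (S \<inter> {j<..}) (pr j))" for m3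
          using linear_inv_step[OF R j(1,2) min that] by blast
        note I = exI[of "linear_inv (Suc c) _", OF I]
        show ?thesis
        proof (cases "m2 ''x'' 0 = 0")
          case True
          then have "first_of pr R q = Suc j" using j(3) y_def by simp
          then show ?thesis
            by (intro reach_wp) (use True fr3 fr4 2(1) P[OF jn(1)] N[OF jn(2)] in
              \<open>simp_all add: emit_def I\<close>)
        next
          case False
          then have "m2 ''x'' 0 = Suc j" using j(3) y_def by simp
          then show ?thesis
            by (intro reach_wp) (use fr3 fr4 2(1) P[OF jn(1)] N[OF jn(2)] in
              \<open>simp_all add: emit_def I\<close>)
        qed
      qed
    qed simp
  qed simp
next
  case (6 m' h')
  then obtain R where R: "linear_inv (length t) m' R" and h': "h' = Some (X, Q)" by blast
  \<comment> \<open>If something remained after \<open>n\<close> rounds, \<open>n\<close> distinct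
    positions would have been emitted, although they form a proper subset of the \<open>n\<close>
    positions of \<open>t\<close>.\<close>
  have "R = {}"
  proof (rule ccontr)
    assume "R \<noteq> {}"
    then have "m' ''len'' 0 = length t" using R by (simp add: linear_inv_def)
    then have "card (S - R) = length t"
      using R distinct_card[of "emitted m'"] by (simp add: linear_inv_def emitted_def)
    moreover have "S - R \<subset> {..<length t}" using \<open>R \<noteq> {}\<close> R by (auto simp: S_def linear_inv_def)
    ultimately show False using psubset_card_mono[of "{..<length t}" "S - R"] by simp
  qed
  then show ?case using R h' by (simp add: linear_inv_def)
next
  case 7 then show ?case by (simp add: algebra_simps)
qed

lemma append_writes_reach:
  assumes nv: "m ''variables'' 0 = nv" "nv \<le> length t"
    and P: "\<And>j. j < length t \<Longrightarrow> m ''proc'' j = pr j"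
    and I: "\<And>j. j < length t \<Longrightarrow> m ''in'' j = 0 \<longleftrightarrow> j \<notin> S"
    and e: "m ''e1'' 0 = j1" "m ''e2'' 0 = j2" "j1 < length t" "j2 < length t"
  shows "reach t append_writes (2 + nv * 5) m h (\<lambda>m' h'.
    emitted m' = emitted m @ filter (\<lambda>j. j \<notin> S \<and> pr j \<noteq> pr j1 \<and> pr j \<noteq> pr j2) [0..<nv])"
  unfolding append_writes_def
proof (rule reach_For[where N = nv and T = 3 and I = "\<lambda>c m' h'.
    emitted m' = emitted m @ filter (\<lambda>j. j \<notin> S \<and> pr j \<noteq> pr j1 \<and> pr j \<noteq> pr j2) [0..<c]"], goal_cases)
  case 1 then show ?case by (simp add: emit_def)
next
  case (2 m') then show ?case using nv by (simp add: emit_def)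
next
  case (3 j m' h' x) then show ?case by (simp add: emitted_def)
next
  case 4 then show ?case by simp
next
  case (5 c m' h')
  have "m' A = m A" if "A \<notin> {''out'', ''len'', ''c''}" for A using 5(4)[of A] that
      by (simp add: emit_def)
  then have fr: "m' ''in'' = m ''in''" "m' ''proc'' = m ''proc''" "m' ''e1'' 0 = j1"
      "m' ''e2'' 0 = j2"
    using e by auto
  have c: "c < length t" using 5(1) nv(2) by simp
  show ?case
  proof (cases "c \<notin> S \<and> pr c \<noteq> pr j1 \<and> pr c \<noteq> pr j2")
    case True
    then have t: "m ''in'' c = 0" "m ''proc'' c \<noteq> m ''proc'' j1" "m ''proc'' c \<noteq> m ''proc'' j2"
      using I[OF c] P c e(3,4) by auto
    show ?thesis
      by (rule reach_wp) (use t True 5(2,3) fr in \<open>simp_all add: emit_def emitted_def\<close>)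
  next
    case False
    then have "\<not> (m ''in'' c = 0 \<and> m ''proc'' c \<noteq> m ''proc'' j1 \<and> m ''proc'' c \<noteq> m ''proc'' j2)"
      using I[OF c] P c e(3,4) by auto
    then show ?thesis
      by (intro reach_wp) (use False 5(2,3) fr in \<open>auto simp: emit_def\<close>)
  qed
next
  case (6 m' h') then show ?case by simp
next
  case 7 then show ?case by simp
qed

end

lemma input_memory_simps:
  fixes k nv nl t j1 j2 i
  defines "m \<equiv> input_memory k nv nl t j1 j2 i"
  shows "m ''n'' 0 = length t" "m ''processes'' 0 = k" "m ''variables'' 0 = nv"
    "m ''e1'' 0 = j1" "m ''e2'' 0 = j2" "m ''i'' 0 = i"
    "j < length t \<Longrightarrow> m ''proc'' j = proc (t ! j)"
    "j < length t \<Longrightarrow> m ''type'' j = action_code (act (t ! j))"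
    "j < length t \<Longrightarrow> m ''loc'' j = loc_code (loc (t ! j))"
    "A \<notin> {''n'', ''processes'', ''variables'', ''locks'', ''e1'', ''e2'', ''i'', ''proc'',
        ''type'', ''loc''} \<Longrightarrow> m A x = 0"
  by (simp_all add: m_def input_memory_def scalar_def table_def)

lemma output_events_emitted: "output_events t s = map (nth t) (emitted (mem s))"
  by (simp add: output_events_def emitted_def)

lemma late_writes_index:
  assumes "nv \<le> length t"
  shows "map (nth t) (filter (\<lambda>j. P (t ! j)) [0..<nv]) = filter P (take nv t)"
proof -
  have "take nv t = map (nth t) [0..<nv]"
    using assms by (intro nth_equalityI) auto
  then show ?thesis by (simp add: filter_map o_def)
qed

lemma ordered_trace_intro:
  assumes "race_input k nv nl t e1 e2" "feasible t X" "closed_order t X Q"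
  shows "ordered_trace t X Q k"
  using assms trace_distinct feasibleD(1)
  by unfold_locales (auto simp: race_input_def within_bounds_def)

text \<open>The emitted part up to the late writes is sorted by \<open>late_after\<close>, so the
  result on linearizations applies to it. The coefficient of \<open>n\<close> adds 8 for the chains,
  \<open>14 + k * 12\<close> for the linearization and 5 for the initial writes, of which there are
  at most \<open>n\<close>; the bound is rounded up from there.\<close>

lemma witness_program_reach:
  assumes inp: "race_input k nv nl t (t ! j1) (t ! j2)" and j: "j1 < length t" "j2 < length t"
    and rd: "race_decision t (t ! j1) (t ! j2) i (Some (X, Q))"
    and init: "read_is_initialised nv t X (t ! j1) (t ! j2)"
  shows "reach t witness_program (40 * (k + 1) * (length t + 1)) (input_memory k nv nl t j1 j2 i)
      (Some (X, Q))
    (\<lambda>m' h'. witness_trace t (t ! j1) (t ! j2) (map (nth t) (emitted m')))"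
proof -
  note D = race_decision_SomeD[OF inp rd]
  define q where "q = proc (if i = 1 then t ! j1 else t ! j2)"
  interpret ordered_trace t X Q q k using ordered_trace_intro[OF inp D(4,5)] .
  let ?n = "length t"
  let ?m = "input_memory k nv nl t j1 j2 i"
  note m = input_memory_simps
  have tr: "is_trace t" and nv: "nv \<le> ?n" using inp starts_with_writesD(3)
      by (auto simp: race_input_def)
  have inS: "j \<in> S \<longleftrightarrow> j < ?n \<and> t ! j \<in> X" for j by (simp add: S_def)
  show ?thesis
    unfolding witness_program_def
  proof (rule reach_Seq[where T = 2 and T' = "10 + ?n * (27 + k * 12)" and
        \<Psi> = "\<lambda>m' h'. h' = Some (X, Q) \<and> m' ''q'' 0 = q"], goal_cases)
    case 1
    show ?case
      by (rule reach_wp) (use j in \<open>auto simp: pick_process_def m q_def\<close>)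
  next
    case (2 m1 h1)
    have m1: "m1 A = ?m A" if "A \<noteq> ''q''" for A using 2(2)[of A] that
        by (simp add: pick_process_def)
    have R1: "reach t build_chains (2 + ?n * 8) m1 (Some (X, Q)) (\<lambda>m' h'. h' = Some (X, Q) \<and>
      (\<forall>p. m' ''head'' p = first_of pr S p) \<and>
      (\<forall>j\<in>S. m' ''next'' j = first_of pr (S \<inter> {j<..}) (pr j)) \<and>
      (\<forall>j<?n. m' ''in'' j = 0 \<longleftrightarrow> j \<notin> S))"
      by (rule build_chains_reach) (simp_all add: m1 m pr_def)
    have h1: "h1 = Some (X, Q)" using 2(1) by simp
    show ?case
      unfolding h1
    proof (rule reach_Seq[where T' = "8 + ?n * (19 + k * 12)", OF R1], goal_cases)
      case (1 m2 h2)
      have m2: "m2 A = ?m A" if "A \<notin> {''q'', ''c'', ''j'', ''d'', ''in'', ''next'', ''head''}" for A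
        using 1(2)[of A] that m1[of A] by (simp add: build_chains_def)
      have "m2 ''q'' 0 = q" using 1(2)[of "''q''"] 2(1) by (simp add: build_chains_def)
      then have R2: "reach t linearize (2 + ?n * (14 + k * 12)) m2 (Some (X, Q)) (\<lambda>m' h'. h' =
          Some (X, Q) \<and>
        distinct (emitted m') \<and> set (emitted m') = S \<and> sorted_wrt late_index (emitted m'))"
        using 1(1) by (intro linearize_reach) (simp_all add: m2 m pr_def)
      have h2: "h2 = Some (X, Q)" using 1(1) by simp
      have in2: "m2 ''in'' j = 0 \<longleftrightarrow> j \<notin> S" if "j < ?n" for j using 1(1) that by blast
      show ?case
        unfolding h2
      proof (rule reach_Seq[where T' = "6 + ?n * 5", OF R2], goal_cases)
        case (1 m3 h3)
        have m3: "m3 A = m2 A" if "A \<notin> {''c'', ''x'', ''p'', ''d'', ''j'', ''out'', ''len'',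
            ''head''}" for A
          using 1(2)[of A] that by (simp add: linearize_def pick_event_def emit_def)
        define ol where "ol = emitted m3"
        have ol: "distinct ol" "set ol = S" "sorted_wrt late_index ol"
          using 1(1) by (auto simp: ol_def)
        let ?late = "filter (\<lambda>j. j \<notin> S \<and> pr j \<noteq> pr j1 \<and> pr j \<noteq> pr j2) [0..<nv]"
        have R3: "reach t append_writes (2 + nv * 5) m3 h3 (\<lambda>m' h'. emitted m' = ol @ ?late)"
          unfolding ol_def by (rule append_writes_reach) (use j nv in \<open>simp_all add: in2 m3 m2 m
              pr_def\<close>)
        show ?case
        proof (rule reach_Seq[where T' = 4, OF R3], goal_cases)
          case (1 m4 h4)
          note em4 = 1(1)
          have m4: "m4 ''e1'' 0 = j1" "m4 ''e2'' 0 = j2"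
            using 1(2)[of "''e1''"] 1(2)[of "''e2''"] m3 m2 m by (simp_all add: append_writes_def
                emit_def)
          have fin: "witness_trace t (t ! j1) (t ! j2) (map (nth t) (ol @ ?late @ [j1, j2]))"
          proof -
            have "linearization t X Q q (map (nth t) ol)"
            proof
              show "distinct (map (nth t) ol)"
                using ol index_eq by (auto simp: distinct_map inj_on_def)
              have "\<exists>j. j < ?n \<and> t ! j = e" if "e \<in> X" for e
                using that X_sub by (auto simp flip: in_set_conv_nth)
              then show "set (map (nth t) ol) = X" using ol(2) by (auto simp: S_def)
              show "sorted_wrt (late_after q Q) (map (nth t) ol)" using ol(3)
                  by (simp add: sorted_wrt_map)
              show "\<nexists>a b. open_pair t X q Q a b" using D(6) by (simp add: q_def)
            qed (use tr D(4,5) in auto)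
            from linearization_witness[OF inp D(1) D(2,3) init this]
            have w: "witness_trace t (t ! j1) (t ! j2)
              (map (nth t) ol @ late_writes nv t X (t ! j1) (t ! j2) @ [t ! j1, t ! j2])" .
            have "?late = filter (\<lambda>j. t ! j \<notin> X \<and> proc (t ! j) \<noteq> proc (t ! j1) \<and>
                proc (t ! j) \<noteq> proc (t ! j2)) [0..<nv]"
              using nv by (intro filter_cong) (auto simp: S_def pr_def)
            then have "map (nth t) ?late = late_writes nv t X (t ! j1) (t ! j2)"
              using late_writes_index[OF nv, of "\<lambda>e. e \<notin> X \<and> proc e \<noteq> proc (t ! j1) \<and>
                  proc e \<noteq> proc (t ! j2)"]
              by (simp add: late_writes_def)
            then show ?thesis using w by simp
          qed
          show ?case
          proof (rule reach_wp, goal_cases)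
            case 1
            let ?m5 = "m4(''out'' := (m4 ''out'')(m4 ''len'' 0 := j1), ''len'' := (m4 ''len'')(0
                := Suc (m4 ''len'' 0)))"
            have "emitted ?m5 = emitted m4 @ [j1]" by (rule emitted_snoc) simp_all
            then have "emitted (?m5(''out'' := (?m5 ''out'')(?m5 ''len'' 0 := j2),
              ''len'' := (?m5 ''len'')(0 := Suc (?m5 ''len'' 0)))) = ol @ ?late @ [j1, j2]"
              using em4 by (subst emitted_snoc[of _ ?m5 j2]) simp_all
            then show ?case using fin m4 by (simp add: emit_def)
          qed (simp add: emit_def)
        qed (use nv in simp)
      qed (simp add: algebra_simps)
    qed (simp add: algebra_simps)
  qed (simp add: algebra_simps)
qed

section \<open>The decision procedure\<close>

text \<open>The arrays of links map an event without a link to itself (\<open>d\<close> below), so that following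
  a link never leaves a closed set.\<close>

definition is_last :: "(nat \<Rightarrow> bool) \<Rightarrow> nat \<Rightarrow> nat \<Rightarrow> nat \<Rightarrow> bool" where
  "is_last P d b x \<longleftrightarrow> (if \<exists>i<b. P i then x < b \<and> P x \<and> (\<forall>i<b. P i \<longrightarrow> i \<le> x) else x = d)"

definition is_first :: "(nat \<Rightarrow> bool) \<Rightarrow> nat \<Rightarrow> nat \<Rightarrow> nat \<Rightarrow> bool" where
  "is_first P d b x \<longleftrightarrow> (if \<exists>i<b. P i then x < b \<and> P x \<and> (\<forall>i<b. P i \<longrightarrow> x \<le> i) else x = d)"

lemma is_last_0: "is_last P d 0 d"
  by (simp add: is_last_def)

lemma is_first_0: "is_first P d 0 d"
  by (simp add: is_first_def)

lemma is_last_Suc: "is_last P d b x \<Longrightarrow> is_last P d (Suc b) (if P b then b else x)"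
  unfolding is_last_def less_Suc_eq by (auto split: if_splits)

text \<open>The default \<open>d\<close> doubles as the sign that nothing has been found yet, which
  is unambiguous because \<open>d\<close> does not satisfy \<open>P\<close>.\<close>

lemma is_first_Suc:
  assumes "is_first P d b x" "\<not> P d"
  shows "is_first P d (Suc b) (if P b \<and> x = d then b else x)"
proof (cases "\<exists>i<b. P i")
  case True
  then have "x < b" "P x" "\<forall>i<b. P i \<longrightarrow> x \<le> i" using assms(1) by (auto simp: is_first_def)
  then show ?thesis using assms(2) unfolding is_first_def less_Suc_eq by auto
next
  case False
  then show ?thesis using assms unfolding is_first_def less_Suc_eq by auto
qed

section \<open>Codes of actions and locations\<close>

lemma action_code_iff:
  "action_code (act e) = 0 \<longleftrightarrow> is_write e" "action_code (act e) = Suc 0 \<longleftrightarrow> is_read e"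
  "action_code (act e) = 2 \<longleftrightarrow> is_acquire e" "action_code (act e) = 3 \<longleftrightarrow> is_release e"
  "action_code (act e) < 2 \<longleftrightarrow> is_access e"
  by (cases "act e"; simp add: is_write_def is_read_def is_acquire_def is_release_def
      is_access_def)+

lemma lock_event_iff: "is_lock_event e \<longleftrightarrow> \<not> is_access e"
  by (cases "act e") (auto simp: is_lock_event_def is_write_def is_read_def is_acquire_def
      is_release_def is_access_def)

text \<open>The code forgets whether a location is a variable or a lock, so it may only be compared
  between two accesses or two lock events.\<close>

lemma loc_code_iff:
  "is_access e \<longleftrightarrow> is_access e' \<Longrightarrow> loc_code (loc e) = loc_code (loc e') \<longleftrightarrow> loc e = loc e'"
  by (cases "act e"; cases "act e'")
    (auto simp: loc_def is_write_def is_read_def is_acquire_def is_release_def is_access_def)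

abbreviation both :: "test \<Rightarrow> test \<Rightarrow> test" (infixr "&&" 35) where "b && b' \<equiv> Conj b b'"

abbreviation same :: "string \<Rightarrow> exp \<Rightarrow> exp \<Rightarrow> test" where
  "same A e e' \<equiv> Equal (Cell A e) (Cell A e')"

abbreviation has_type :: "exp \<Rightarrow> nat \<Rightarrow> test" where "has_type e c \<equiv> Equal (Cell ''type'' e) (Num c)"

abbreviation marked :: "exp \<Rightarrow> test" where "marked e \<equiv> Neg (Equal (Cell ''in'' e) (Num 0))"

abbreviation all_pairs :: "com \<Rightarrow> com" where
  "all_pairs c \<equiv> For ''a'' (V ''n'') (For ''b'' (V ''n'') c)"

text \<open>In an ascending scan the last assignment wins, which yields the latest predecessor and
  the latest write. An entry of \<open>match\<close> is written only while it has its default, which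
  yields the earliest release.\<close>

definition link_step :: com where
  "link_step =
     guarded (Less (V ''b'') (V ''a'') && same ''proc'' (V ''a'') (V ''b''))
       (Assign ''prev'' (V ''a'') (V ''b'')) ;;
     guarded (Less (V ''b'') (V ''a'') && has_type (V ''a'') 1 && has_type (V ''b'') 0 &&
         same ''loc'' (V ''a'') (V ''b''))
       (Assign ''obs'' (V ''a'') (V ''b'')) ;;
     guarded (Less (V ''a'') (V ''b'') && has_type (V ''a'') 2 && has_type (V ''b'') 3 &&
         same ''loc'' (V ''a'') (V ''b'') && Equal (Cell ''match'' (V ''a'')) (V ''a''))
       (Assign ''match'' (V ''a'') (V ''b''))"

definition build_links :: com where
  "build_links = For ''a'' (V ''n'') (
     (Assign ''prev'' (V ''a'') (V ''a'') ;; Assign ''obs'' (V ''a'') (V ''a'') ;;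
      Assign ''match'' (V ''a'') (V ''a'')) ;;
     For ''b'' (V ''n'') link_step)"

definition mark_seeds :: com where
  "mark_seeds = For ''a'' (V ''n'') (
     guarded (either (Less (V ''a'') (V ''e1'') && same ''proc'' (V ''a'') (V ''e1''))
        (Less (V ''a'') (V ''e2'') && same ''proc'' (V ''a'') (V ''e2'')))
       (Assign ''in'' (V ''a'') (Num 1)))"

text \<open>One marking serves both cones: the lock rule of either cone exempts the processes of
  both \<open>e1\<close> and \<open>e2\<close>, so the cones obey the same rules and differ only in
  their seeds.\<close>

definition spread_step :: com where
  "spread_step = guarded (marked (V ''a'')) (
     Assign ''in'' (Cell ''prev'' (V ''a'')) (Num 1) ;;
     Assign ''in'' (Cell ''obs'' (V ''a'')) (Num 1) ;;
     guarded (Neg (same ''proc'' (V ''a'') (V ''e1'')) && Neg (same ''proc'' (V ''a'') (V ''e2'')))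
       (Assign ''in'' (Cell ''match'' (V ''a'')) (Num 1)))"

definition spread :: com where
  "spread = For ''r'' (V ''n'') (For ''a'' (V ''n'') spread_step)"

section \<open>Link tables and the computation of the cones\<close>

locale input_trace =
  fixes t :: "event list" and j1 j2 :: nat
  assumes trace: "is_trace t" and j: "j1 < length t" "j2 < length t"
begin

abbreviation n :: nat where "n \<equiv> length t"

definition input_facts :: "memory \<Rightarrow> bool" where
  "input_facts m \<longleftrightarrow> m ''n'' 0 = n \<and> m ''e1'' 0 = j1 \<and> m ''e2'' 0 = j2 \<and>
     (\<forall>j<n. m ''proc'' j = proc (t ! j) \<and> m ''type'' j = action_code (act (t ! j)) \<and>
       m ''loc'' j = loc_code (loc (t ! j)))"

lemma input_factsD:
  assumes "input_facts m"
  shows "m ''n'' 0 = n" "m ''e1'' 0 = j1" "m ''e2'' 0 = j2" "j < n \<Longrightarrow> m ''proc'' j = proc (t ! j)"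
    "j < n \<Longrightarrow> m ''type'' j = action_code (act (t ! j))" "j < n \<Longrightarrow>
        m ''loc'' j = loc_code (loc (t ! j))"
  using assms by (auto simp: input_facts_def)

lemma input_facts_cong:
  assumes "input_facts m" "m' ''n'' = m ''n''" "m' ''e1'' = m ''e1''" "m' ''e2'' = m ''e2''"
    "m' ''proc'' = m ''proc''" "m' ''type'' = m ''type''" "m' ''loc'' = m ''loc''"
  shows "input_facts m'"
  using assms by (simp add: input_facts_def)

definition prev_of :: "nat \<Rightarrow> nat \<Rightarrow> bool" where
  "prev_of a i \<longleftrightarrow> i < a \<and> proc (t ! a) = proc (t ! i)"

definition obs_of :: "nat \<Rightarrow> nat \<Rightarrow> bool" where
  "obs_of a i \<longleftrightarrow> i < a \<and> is_read (t ! a) \<and> is_write (t ! i) \<and> loc (t ! a) = loc (t ! i)"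

definition match_of :: "nat \<Rightarrow> nat \<Rightarrow> bool" where
  "match_of a i \<longleftrightarrow> a < i \<and> is_acquire (t ! a) \<and> is_release (t ! i) \<and> loc (t ! a) = loc (t ! i)"

definition links_upto :: "nat \<Rightarrow> nat \<Rightarrow> memory \<Rightarrow> bool" where
  "links_upto a b m \<longleftrightarrow> is_last (prev_of a) a b (m ''prev'' a) \<and>
      is_last (obs_of a) a b (m ''obs'' a) \<and>
     is_first (match_of a) a b (m ''match'' a)"

definition links :: "memory \<Rightarrow> bool" where
  "links m \<longleftrightarrow> (\<forall>a<n. links_upto a n m)"

lemma link_tests:
  assumes "input_facts m" "a < n" "b < n"
  shows "b < a \<and> m ''proc'' a = m ''proc'' b \<longleftrightarrow> prev_of a b"
    "b < a \<and> m ''type'' a = Suc 0 \<and> m ''type'' b = 0 \<and> m ''loc'' a = m ''loc'' b \<longleftrightarrow> obs_of a b"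
    "a < b \<and> m ''type'' a = 2 \<and> m ''type'' b = 3 \<and> m ''loc'' a = m ''loc'' b \<longleftrightarrow> match_of a b"
    "a < b \<and> m ''type'' a = 2 \<and> m ''type'' b = 3 \<and> m ''loc'' a = m ''loc'' b \<and> R \<longleftrightarrow>
      match_of a b \<and> R"
  using input_factsD[OF assms(1)] assms(2,3) loc_code_iff[of "t ! a" "t ! b"] lock_event_iff
  by (auto simp: prev_of_def obs_of_def match_of_def action_code_iff is_access_def
      is_lock_event_def)

lemma build_links_reach:
  assumes inp: "input_facts m"
  shows "reach t build_links (2 + n * (7 + n * 8)) m h (\<lambda>m' h'. links m')"
  unfolding build_links_def
proof (rule reach_For[where N = n and T = "5 + n * 8"
    and I = "\<lambda>a m' h'. \<forall>a'<a. links_upto a' n m'"], goal_cases)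
  case (2 m') then show ?case using input_factsD[OF inp] by (simp add: link_step_def)
next
  case (5 a m' h')
  have inp': "input_facts m'" by (rule input_facts_cong[OF inp]) (simp_all add: 5(4) link_step_def)
  show ?case
  proof (rule reach_Seq[where T = 3 and T' = "2 + n * 8" and
        \<Psi> = "\<lambda>m' h'. (\<forall>a'<a. links_upto a' n m') \<and> links_upto a 0 m'"], goal_cases)
    case 1
    show ?case
      by (rule reach_wp) (use 5(2,3) in \<open>auto simp: links_upto_def is_last_0 is_first_0\<close>)
  next
    case (2 m1 h1)
    have inp1: "input_facts m1" by (rule input_facts_cong[OF inp']) (simp_all add: 2(2))
    have a1: "m1 ''a'' 0 = a" using 2(2)[of "''a''"] 5(3) by simp
    show ?case
    proof (rule reach_For[where N = n and T = 6 and
          I = "\<lambda>b m' h'. (\<forall>a'<a. links_upto a' n m') \<and> links_upto a b m'"], goal_cases)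
      case (2 m') then show ?case using input_factsD[OF inp1] by (simp add: link_step_def)
    next
      case 4 then show ?case using 2(1) .
    next
      case (5 b m2 h2)
      have inp2: "input_facts m2" by (rule input_facts_cong[OF inp1]) (simp_all add: 5(4)
          link_step_def)
      have a2: "m2 ''a'' 0 = a" using 5(4)[of "''a''"] a1 by (simp add: link_step_def)
      have ab: "a < n" "b < n" using \<open>a < n\<close> 5(1) by auto
      note L = 5(2)[THEN conjunct2, unfolded links_upto_def]
      have "\<not> match_of a a" by (simp add: match_of_def)
      note s = is_last_Suc[OF L[THEN conjunct1]] is_last_Suc[OF L[THEN conjunct2, THEN conjunct1]]
        is_first_Suc[OF L[THEN conjunct2, THEN conjunct2] this]
      show ?case
        unfolding link_step_def
      proof (rule reach_wp, goal_cases)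
        case 1
        note T = link_tests[OF inp2 ab]
        show ?case
          using s 5(2,3)
          by (cases "prev_of a b"; cases "obs_of a b"; cases "match_of a b"; cases
              "m2 ''match'' a = a")
            (simp_all add: a2 T links_upto_def)
      qed simp
    next
      case (6 m' h') then show ?case by (auto simp: less_Suc_eq)
    qed (auto simp: links_upto_def link_step_def)
  qed simp
next
  case (6 m' h') then show ?case by (simp add: links_def)
qed (auto simp: links_upto_def link_step_def)

end

context input_trace
begin

lemma dist: "distinct t"
  using trace trace_distinct by blast

lemma po_index: "a < n \<Longrightarrow> b < n \<Longrightarrow> po t (t ! a) (t ! b) \<longleftrightarrow> prev_of b a"
  using before_nth[OF dist] by (auto simp: po_def prev_of_def)

lemma index_of:
  assumes "e \<in> set t"
  obtains a where "a < n" "e = t ! a"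
  using assms by (auto simp: in_set_conv_nth)

lemma observes_index:
  assumes "links m" "a < n"
  shows "observes t (t ! a) w \<longleftrightarrow> m ''obs'' a \<noteq> a \<and> w = t ! m ''obs'' a"
proof -
  have L: "is_last (obs_of a) a n (m ''obs'' a)" using assms by (simp add: links_def links_upto_def)
  have b: "before t (t ! i) (t ! i') \<longleftrightarrow> i < i'" if "i < n" "i' < n" for i i'
    using before_nth[OF dist] that by blast
  show ?thesis
  proof (cases "\<exists>i<n. obs_of a i")
    case True
    let ?x = "m ''obs'' a"
    have x: "?x < n" "obs_of a ?x" "\<forall>i<n. obs_of a i \<longrightarrow> i \<le> ?x"
      using L True unfolding is_last_def by (metis (no_types, lifting))+
    have False if w: "is_write w'" "loc w' = loc (t ! a)" "before t (t ! ?x) w'"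
        "before t w' (t ! a)" for w'
    proof -
      obtain i where i: "i < n" "w' = t ! i" using w(3) before_in_set index_of by metis
      then have "?x < i" "i < a" using w b x(1) assms(2) by auto
      moreover have "obs_of a i" using i w x(2) \<open>i < a\<close> by (auto simp: obs_of_def)
      ultimately show False using x(3) i(1) by auto
    qed
    then have "observes t (t ! a) (t ! ?x)"
      using x(1,2) b assms(2) unfolding observes_def obs_of_def by auto
    moreover have "?x \<noteq> a" using x(2) by (simp add: obs_of_def)
    ultimately show ?thesis using observes_unique[OF dist] by blast
  next
    case False
    then have "m ''obs'' a = a" using L by (auto simp: is_last_def)
    moreover have "\<not> observes t (t ! a) w"
    proof
      assume o: "observes t (t ! a) w"
      then have "w \<in> set t" using before_in_set by (auto simp: observes_def)
      then obtain i where "i < n" "w = t ! i" by (rule index_of)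
      then show False using o False b[of i a] assms(2) by (auto simp: observes_def obs_of_def)
    qed
    ultimately show ?thesis by simp
  qed
qed

lemma matches_index:
  assumes "links m" "a < n"
  shows "matches t (t ! a) \<rho> \<longleftrightarrow> m ''match'' a \<noteq> a \<and> \<rho> = t ! m ''match'' a"
proof -
  have L: "is_first (match_of a) a n (m ''match'' a)" using assms by (simp add: links_def
      links_upto_def)
  have b: "before t (t ! i) (t ! i') \<longleftrightarrow> i < i'" if "i < n" "i' < n" for i i'
    using before_nth[OF dist] that by blast
  show ?thesis
  proof (cases "\<exists>i<n. match_of a i")
    case True
    let ?x = "m ''match'' a"
    have x: "?x < n" "match_of a ?x" "\<forall>i<n. match_of a i \<longrightarrow> ?x \<le> i"
      using L True unfolding is_first_def by (metis (no_types, lifting))+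
    have False if w: "is_release \<rho>'" "loc \<rho>' = loc (t ! a)" "before t (t ! a) \<rho>'"
        "before t \<rho>' (t ! ?x)" for \<rho>'
    proof -
      obtain i where i: "i < n" "\<rho>' = t ! i" using w(3) before_in_set index_of by metis
      then have "i < ?x" "a < i" using w b x(1) assms(2) by auto
      moreover have "match_of a i" using i w x(2) \<open>a < i\<close> by (auto simp: match_of_def)
      ultimately show False using x(3) i(1) by auto
    qed
    then have "matches t (t ! a) (t ! ?x)"
      using x(1,2) b assms(2) unfolding matches_def match_of_def by auto
    moreover have "?x \<noteq> a" using x(2) by (auto simp: match_of_def)
    ultimately show ?thesis using matches_unique[OF dist] by blast
  next
    case False
    then have "m ''match'' a = a" using L by (auto simp: is_first_def)
    moreover have "\<not> matches t (t ! a) \<rho>"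
    proof
      assume o: "matches t (t ! a) \<rho>"
      then have "\<rho> \<in> set t" using matches_in_set by blast
      then obtain i where "i < n" "\<rho> = t ! i" by (rule index_of)
      then show False using o False b[of a i] assms(2) by (auto simp: matches_def match_of_def)
    qed
    ultimately show ?thesis by simp
  qed
qed

definition marks :: "memory \<Rightarrow> nat set" where
  "marks m = {a. a < n \<and> m ''in'' a \<noteq> 0}"

definition seeds :: "nat set" where
  "seeds = {a. a < n \<and> (prev_of j1 a \<or> prev_of j2 a)}"

lemma mark_seeds_reach:
  assumes inp: "input_facts m" and z: "\<And>a. m ''in'' a = 0"
  shows "reach t mark_seeds (2 + n * 4) m h (\<lambda>m' h'. marks m' = seeds)"
  unfolding mark_seeds_def
proof (rule reach_For[where N = n and T = 2 and I = "\<lambda>c m' h'. marks m' = {a \<in> seeds. a < c}"],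
    goal_cases)
  case (2 m') then show ?case using input_factsD[OF inp] by simp
next
  case 4 then show ?case using z by (simp add: marks_def)
next
  case (5 a m' h')
  have inp': "input_facts m'" by (rule input_facts_cong[OF inp]) (simp_all add: 5(4))
  note I = input_factsD[OF inp']
  have "marks (m'(''in'' := (m' ''in'')(a := 1))) = insert a (marks m')"
    using 5(1) by (auto simp: marks_def)
  moreover have "{a' \<in> seeds. a' < Suc a} = (if a \<in> seeds then insert a {a' \<in> seeds. a' < a} else
      {a' \<in> seeds. a' < a})"
    by (auto simp: less_Suc_eq)
  moreover have "(a < j1 \<and> m' ''proc'' a = m' ''proc'' j1) \<or> (a < j2 \<and>
      m' ''proc'' a = m' ''proc'' j2) \<longleftrightarrow> a \<in> seeds"
    using I(4) j 5(1) by (auto simp: seeds_def prev_of_def)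
  ultimately show ?case
    by (intro reach_wp) (use I 5(2,3) in auto)
next
  case (6 m' h') then show ?case by (auto simp: seeds_def)
qed (auto simp: marks_def)

definition succs :: "memory \<Rightarrow> nat \<Rightarrow> nat set" where
  "succs m a = {m ''prev'' a, m ''obs'' a} \<union>
     (if proc (t ! a) \<noteq> proc (t ! j1) \<and> proc (t ! a) \<noteq> proc (t ! j2) then {m ''match'' a} else {})"

definition succ_closed :: "memory \<Rightarrow> nat set \<Rightarrow> bool" where
  "succ_closed m T \<longleftrightarrow> (\<forall>a\<in>T. succs m a \<subseteq> T)"

lemma is_last_range: "is_last P a n x \<Longrightarrow> a < n \<Longrightarrow> x < n"
  by (auto simp: is_last_def split: if_splits)

lemma is_first_range: "is_first P a n x \<Longrightarrow> a < n \<Longrightarrow> x < n"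
  by (auto simp: is_first_def split: if_splits)

lemma link_range:
  assumes "links m" "a < n"
  shows "m ''prev'' a < n" "m ''obs'' a < n" "m ''match'' a < n"
  using assms is_last_range is_first_range unfolding links_def links_upto_def by blast+

lemma marks_upd: "x < n \<Longrightarrow> marks (m(''in'' := (m ''in'')(x := Suc 0))) = insert x (marks m)"
  by (auto simp: marks_def)

lemma spread_step_reach:
  assumes inp: "input_facts m" and L: "links m" and a: "a < n" "m ''a'' 0 = a"
  shows "reach t spread_step 5 m h (\<lambda>m' h'. marks m' = (if a \<in> marks m then marks m \<union> succs m a
      else marks m))"
proof -
  note I = input_factsD[OF inp] and R = link_range[OF L a(1)]
  have ma: "m ''in'' a \<noteq> 0 \<longleftrightarrow> a \<in> marks m" using a(1) by (simp add: marks_def)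
  let ?m1 = "m(''in'' := (m ''in'')(m ''prev'' a := Suc 0))"
  let ?m2 = "?m1(''in'' := (?m1 ''in'')(m ''obs'' a := Suc 0))"
  let ?m3 = "?m2(''in'' := (?m2 ''in'')(m ''match'' a := Suc 0))"
  have "marks ?m2 = marks m \<union> {m ''prev'' a, m ''obs'' a}"
    unfolding marks_upd[OF R(2)] marks_upd[OF R(1)] by auto
  moreover have "marks ?m3 = insert (m ''match'' a) (marks ?m2)" using marks_upd[OF R(3)] .
  ultimately show ?thesis
    unfolding spread_step_def
    by (intro reach_wp) (use a I(1-3) I(4)[OF a(1)] I(4)[OF j(1)] I(4)[OF j(2)] ma in \<open>auto simp:
        succs_def\<close>)
qed

text \<open>A round that does not reach a closed set marks at least one new event, so \<open>n\<close> rounds suffice.\<close>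

lemma spread_reach:
  assumes inp: "input_facts m" and L: "links m"
  shows "reach t spread (2 + n * (4 + n * 7)) m h (\<lambda>m' h'. marks m \<subseteq> marks m' \<and>
      succ_closed m (marks m') \<and>
    (\<forall>T. succ_closed m T \<longrightarrow> marks m \<subseteq> T \<longrightarrow> marks m' \<subseteq> T))"
  unfolding spread_def
proof (rule reach_For[where N = n and T = "2 + n * 7" and I = "\<lambda>r m' h'. marks m \<subseteq> marks m' \<and>
    (succ_closed m (marks m') \<or> r \<le> card (marks m')) \<and>
    (\<forall>T. succ_closed m T \<longrightarrow> marks m \<subseteq> T \<longrightarrow> marks m' \<subseteq> T)"], goal_cases)
  case (2 m') then show ?case using input_factsD[OF inp] by (simp add: spread_step_def)
next
  case (5 r m1 h1)
  define M where "M = marks m1"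
  have fr1: "m1 A = m A" if "A \<notin> {''r'', ''a'', ''in''}" for A using 5(4)[of A] that
      by (simp add: spread_step_def)
  have inp1: "input_facts m1" by (rule input_facts_cong[OF inp]) (simp_all add: fr1)
  show ?case
  proof (rule reach_For[where N = n and T = 5 and I = "\<lambda>a m' h'. M \<subseteq> marks m' \<and>
      (\<forall>a'\<in>M. a' < a \<longrightarrow> succs m a' \<subseteq> marks m') \<and> (\<forall>T. succ_closed m T \<longrightarrow> M \<subseteq> T \<longrightarrow> marks m' \<subseteq>
          T)"], goal_cases)
    case (2 m') then show ?case using input_factsD[OF inp1] by (simp add: spread_step_def)
  next
    case (5 a m2 h2)
    have fr2: "m2 A = m A" if "A \<notin> {''r'', ''a'', ''in''}" for A
      using 5(4)[of A] fr1[of A] that by (simp add: spread_step_def)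
    have inp2: "input_facts m2" by (rule input_facts_cong[OF inp]) (simp_all add: fr2)
    have "links m2" using L by (simp add: links_def links_upto_def fr2)
    from spread_step_reach[OF inp2 this 5(1,3)]
    show ?case
    proof (rule reach_mono, goal_cases)
      case (2 m3 h3)
      have s: "succs m2 a = succs m a" by (simp add: succs_def fr2)
      have sub: "marks m2 \<subseteq> marks m3" using 2 by auto
      have "succs m a' \<subseteq> marks m3" if "a' \<in> M" "a' < Suc a" for a'
      proof (cases "a' = a")
        case True
        then have "a \<in> marks m2" using that(1) 5(2) by blast
        then show ?thesis using 2 s True by simp
      next
        case False
        then have "succs m a' \<subseteq> marks m2" using that 5(2) by simp
        then show ?thesis using sub by blast
      qed
      moreover have "marks m3 \<subseteq> T" if "succ_closed m T" "M \<subseteq> T" for T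
      proof -
        have "marks m2 \<subseteq> T" using 5(2) that by blast
        moreover have "succs m a \<subseteq> T" if "a \<in> marks m2"
          using \<open>succ_closed m T\<close> \<open>marks m2 \<subseteq> T\<close> that unfolding succ_closed_def by blast
        ultimately show ?thesis using 2 s by simp
      qed
      moreover have "M \<subseteq> marks m3" using conjunct1[OF 5(2)] sub by (rule subset_trans)
      ultimately show ?case by simp
    qed simp
  next
    case (6 m2 h2)
    have "M \<subseteq> {..<n}" by (auto simp: M_def marks_def)
    then have S: "M \<subseteq> marks m2" "\<And>a. a \<in> M \<Longrightarrow> succs m a \<subseteq> marks m2"
      "\<And>T. succ_closed m T \<Longrightarrow> M \<subseteq> T \<Longrightarrow> marks m2 \<subseteq> T"
      using 6(1) by auto
    have "succ_closed m (marks m2) \<or> Suc r \<le> card (marks m2)"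
    proof (cases "succ_closed m M")
      case True
      then have "marks m2 = M" using S by blast
      then show ?thesis using True by simp
    next
      case False
      then have "M \<subset> marks m2" using S(1,2) unfolding succ_closed_def by blast
      moreover have "finite (marks m2)" by (simp add: marks_def)
      ultimately have "card M < card (marks m2)" by (rule psubset_card_mono[rotated])
      moreover have "r \<le> card M" using 5(2) False by (simp add: M_def)
      ultimately show ?thesis by simp
    qed
    moreover have "marks m \<subseteq> M" "\<And>T. succ_closed m T \<Longrightarrow> marks m \<subseteq> T \<Longrightarrow> M \<subseteq> T"
      using 5(2) by (simp_all add: M_def)
    ultimately show ?case using S(1,3) by simp
  qed (auto simp: marks_def M_def spread_step_def)
next
  case (6 m' h')
  have "succ_closed m (marks m')"
  proof (rule ccontr)
    assume nc: "\<not> succ_closed m (marks m')"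
    \<comment> \<open>Without a closed set after \<open>n\<close> rounds every position would be
      marked, and the set of all positions is closed because links stay in range.\<close>
    then have "n \<le> card (marks m')" using 6(1) by blast
    moreover have "marks m' \<subseteq> {..<n}" by (auto simp: marks_def)
    ultimately have "marks m' = {..<n}" using card_mono[of "{..<n}" "marks m'"]
        by (intro card_subset_eq) auto
    then have "succ_closed m (marks m')" using link_range[OF L] by (auto simp: succ_closed_def
        succs_def)
    then show False using nc by simp
  qed
  then show ?case using 6(1) by blast
next
  case 7 then show ?case by (simp add: algebra_simps)
qed (simp_all add: marks_def spread_step_def)

definition positions :: "event set \<Rightarrow> nat set" where
  "positions X = {a. a < n \<and> t ! a \<in> X}"

text \<open>Only the immediate predecessor is linked; following links repeatedly reaches all earlier
  events of the process.\<close>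

lemma succ_closed_prev:
  assumes "links m" "succ_closed m M" "M \<subseteq> {..<n}"
  shows "a \<in> M \<Longrightarrow> prev_of a i \<Longrightarrow> i \<in> M"
proof (induction a rule: less_induct)
  case (less a)
  let ?x = "m ''prev'' a"
  have "a < n" "i < n" using less(2,3) assms(3) by (auto simp: prev_of_def)
  then have "is_last (prev_of a) a n ?x" using assms(1) by (simp add: links_def links_upto_def)
  then have x: "prev_of a ?x" "i \<le> ?x" using \<open>i < n\<close> less(3) unfolding is_last_def by (auto split:
      if_splits)
  have "?x \<in> M" using less(2) assms(2) by (auto simp: succ_closed_def succs_def)
  then show ?case using x less(1)[of ?x] less(3) by (cases "i = ?x") (auto simp: prev_of_def)
qed

text \<open>\<open>M\<close> and the union of the cones are least sets for the same rules, up to the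
  detour through immediate predecessors. One inclusion uses that \<open>M\<close> is least, the
  other is rule induction over a cone.\<close>

lemma cone_positions:
  assumes L: "links m" and M: "M \<subseteq> {..<n}" "succ_closed m M" "seeds \<subseteq> M"
    and least: "\<And>T. succ_closed m T \<Longrightarrow> seeds \<subseteq> T \<Longrightarrow> M \<subseteq> T"
  shows "M = positions (cone_union t (t ! j1) (t ! j2))"
proof
  let ?X = "cone_union t (t ! j1) (t ! j2)"
  show "M \<subseteq> positions ?X"
  proof (rule least)
    show "seeds \<subseteq> positions ?X"
      using cone_union_pred[of t _ _ "t ! j1" "t ! j2"] po_index j by (auto simp: seeds_def
          positions_def)
    show "succ_closed m (positions ?X)"
      unfolding succ_closed_def
    proof
      fix a assume "a \<in> positions ?X"
      then have a: "a < n" "t ! a \<in> ?X" by (auto simp: positions_def)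
      note R = link_range[OF L a(1)]
      have "m ''prev'' a \<in> positions ?X"
      proof (cases "m ''prev'' a = a")
        case False
        then have "prev_of a (m ''prev'' a)"
          using L a(1) unfolding links_def links_upto_def is_last_def by metis
        then have "po_eq t (t ! m ''prev'' a) (t ! a)" using po_index R(1) a(1)
            by (simp add: po_eq_def)
        then show ?thesis using rcone.down a(2) R(1) unfolding cone_union_def positions_def by blast
      qed (use a in \<open>simp add: positions_def\<close>)
      moreover have "m ''obs'' a \<in> positions ?X"
      proof (cases "m ''obs'' a = a")
        case False
        then have "observes t (t ! a) (t ! m ''obs'' a)" using observes_index[OF L a(1)] by simp
        then show ?thesis using rcone.obs a(2) R(2) unfolding cone_union_def positions_def by blast
      qed (use a in \<open>simp add: positions_def\<close>)
      moreover have "m ''match'' a \<in> positions ?X"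
        if p: "proc (t ! a) \<noteq> proc (t ! j1)" "proc (t ! a) \<noteq> proc (t ! j2)"
      proof (cases "m ''match'' a = a")
        case False
        then have "matches t (t ! a) (t ! m ''match'' a)" using matches_index[OF L a(1)] by simp
        then show ?thesis using rcone.lock p a(2) R(3) unfolding cone_union_def positions_def
            by blast
      qed (use a in \<open>simp add: positions_def\<close>)
      ultimately show "succs m a \<subseteq> positions ?X" by (auto simp: succs_def)
    qed
  qed
  have cone: "\<exists>a\<in>M. x = t ! a"
    if "x \<in> rcone t e p" "e = t ! j1 \<and> p = proc (t ! j2) \<or> e = t ! j2 \<and> p = proc (t ! j1)" for x e p
    using that
  proof (induction rule: rcone.induct)
    case (pred e')
    then obtain a where a: "a < n" "e' = t ! a" using index_of before_in_set by (metis po_def)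
    then have "a \<in> seeds" using pred po_index j by (auto simp: seeds_def)
    then show ?case using M(3) a by blast
  next
    case (down e' e'')
    then obtain a where a: "a \<in> M" "e' = t ! a" by blast
    show ?case
    proof (cases "e'' = e'")
      case False
      then have po: "po t e'' e'" using down(2) by (simp add: po_eq_def)
      then obtain i where i: "i < n" "e'' = t ! i" using index_of before_in_set by (metis po_def)
      then have "prev_of a i" using po po_index a M(1) by auto
      then show ?thesis using succ_closed_prev[OF L M(2,1) a(1)] i by blast
    qed (use a in auto)
  next
    case (obs r w)
    then obtain a where a: "a \<in> M" "r = t ! a" by blast
    then have "w = t ! m ''obs'' a" using obs observes_index[OF L, of a] M(1) by auto
    then show ?case using a M(2) by (auto simp: succ_closed_def succs_def)
  next
    case (lock b \<rho>)
    then obtain a where a: "a \<in> M" "b = t ! a" by blast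
    then have "\<rho> = t ! m ''match'' a" using lock matches_index[OF L, of a] M(1) by auto
    moreover have "m ''match'' a \<in> succs m a" using lock a by (auto simp: succs_def)
    ultimately show ?case using a M(2) by (auto simp: succ_closed_def)
  qed
  show "positions ?X \<subseteq> M"
  proof
    fix i assume "i \<in> positions ?X"
    then have i: "i < n" "t ! i \<in> ?X" by (auto simp: positions_def)
    then obtain a where "a \<in> M" "t ! i = t ! a" using cone unfolding cone_union_def by blast
    then show "i \<in> M" using i(1) M(1) nth_eq_iff_index_eq[OF dist] by auto
  qed
qed

end

text \<open>The invariant is indexed by the set of visited pairs, which hides the order of the
  visits. The body learns that its pair is new, so that invariants can count pairs.\<close>

lemma reach_all_pairs:
  assumes fresh: "''a'' \<notin> mods c" "''b'' \<notin> mods c" "''n'' \<notin> mods c" and N: "m ''n'' 0 = N"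
    and stable: "\<And>P m' h' x. I P m' h' \<Longrightarrow> I P (m'(''a'' := (m' ''a'')(0 := x))) h'"
      "\<And>P m' h' x. I P m' h' \<Longrightarrow> I P (m'(''b'' := (m' ''b'')(0 := x))) h'"
    and init: "I {} m h"
    and body: "\<And>P a b m' h'. P \<subseteq> {..<N} \<times> {..<N} \<Longrightarrow> (a, b) \<notin> P \<Longrightarrow> a < N \<Longrightarrow> b < N \<Longrightarrow> I P m' h' \<Longrightarrow>
      m' ''a'' 0 = a \<Longrightarrow> m' ''b'' 0 = b \<Longrightarrow>
      (\<And>A. A \<notin> insert ''a'' (insert ''b'' (mods c)) \<Longrightarrow> m' A = m A) \<Longrightarrow> reach t c T m' h' (I (insert
          (a, b) P))"
    and post: "\<And>m' h'. I ({..<N} \<times> {..<N}) m' h' \<Longrightarrow>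
      (\<And>A. A \<notin> insert ''a'' (insert ''b'' (mods c)) \<Longrightarrow> m' A = m A) \<Longrightarrow> \<Phi> m' h'"
    and time: "2 + N * (4 + N * (T + 2)) \<le> T'"
  shows "reach t (all_pairs c) T' m h \<Phi>"
proof (rule reach_For[where N = N and T = "2 + N * (T + 2)" and I = "\<lambda>a. I ({..<a} \<times> {..<N})"],
    goal_cases)
  case (5 a m1 h1)
  show ?case
  proof (rule reach_For[where N = N and T = T and I = "\<lambda>b. I ({..<a} \<times> {..<N} \<union> {a} \<times> {..<b})"],
      goal_cases)
    case 1 then show ?case using fresh(2) .
  next
    case (3 b m2 h2 x) then show ?case by (rule stable(2))
  next
    case (2 m2)
    have "m1 ''n'' = m ''n''" using 5(4)[of "''n''"] fresh(3) by simp
    then show ?case using 2[of "''n''"] fresh(3) N by simp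
  next
    case 4 then show ?case using 5(2) by simp
  next
    case (5 b m2 h2)
    have eq: "{..<a} \<times> {..<N} \<union> {a} \<times> {..<Suc b} = insert (a, b) ({..<a} \<times> {..<N} \<union> {a} \<times> {..<b})"
        by auto
    have fr: "m2 A = m A" if "A \<notin> insert ''a'' (insert ''b'' (mods c))" for A
      using \<open>\<And>A. A \<notin> insert ''b'' (mods c) \<Longrightarrow> m2 A = m1 A\<close>[of A]
        \<open>\<And>A. A \<notin> insert ''a'' (mods (For ''b'' (V ''n'') c)) \<Longrightarrow> m1 A = m A\<close>[of A] that by simp
    have a2: "m2 ''a'' 0 = a" using 5(4)[of "''a''"] \<open>m1 ''a'' 0 = a\<close> fresh(1) by simp
    show ?case
      unfolding eq by (rule body[OF _ _ \<open>a < N\<close> 5(1,2) a2 5(3) fr]) (use \<open>a < N\<close> 5(1) in auto)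
  next
    case (6 m2 h2)
    have "{..<a} \<times> {..<N} \<union> {a} \<times> {..<N} = {..<Suc a} \<times> {..<N}" by auto
    then show ?case using 6(1) by simp
  qed simp
next
  case 1 then show ?case using fresh(1) by simp
next
  case (3 a m' h' x) then show ?case by (rule stable(1))
next
  case 4 then show ?case using init by simp
next
  case (2 m') then show ?case using N fresh by simp
next
  case 7 then show ?case using time by (simp add: algebra_simps)
next
  case (6 m' h')
  show ?case by (rule post[OF 6(1)]) (use 6(2) in simp)
qed

section \<open>Feasibility test and generating edges\<close>

abbreviation unmatched :: "exp \<Rightarrow> test" where
  "unmatched e \<equiv> either (Equal (Cell ''match'' e) e) (Equal (Cell ''in'' (Cell ''match'' e)) (Num
      0))"

definition check_pair :: com where
  "check_pair = guarded (Less (V ''a'') (V ''b'') && marked (V ''a'') && marked (V ''b'') &&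
       has_type (V ''a'') 2 && has_type (V ''b'') 2 && same ''loc'' (V ''a'') (V ''b'') &&
       unmatched (V ''a'') && unmatched (V ''b''))
     (put ''ok'' (Num 0))"

definition check :: com where
  "check = (put ''ok'' (Num 1) ;; guarded (marked (V ''e1'')) (put ''ok'' (Num 0)) ;;
     guarded (marked (V ''e2'')) (put ''ok'' (Num 0))) ;; all_pairs check_pair"

definition list_edge :: com where
  "list_edge = guarded (marked (V ''a'') && marked (V ''b'') &&
       either (Less (V ''a'') (V ''b'') && same ''proc'' (V ''b'') (V ''a''))
         (either (Neg (Equal (V ''a'') (V ''b'')) && Equal (Cell ''obs'' (V ''b'')) (V ''a''))
           (has_type (V ''a'') 3 && has_type (V ''b'') 2 && same ''loc'' (V ''a'') (V ''b'') &&
             unmatched (V ''b''))))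
     (Assign ''src'' (V ''edges'') (V ''a'') ;; Assign ''dst'' (V ''edges'') (V ''b'') ;;
      put ''edges'' (Plus (V ''edges'') (Num 1)))"

context input_trace
begin

definition unmatched_in :: "memory \<Rightarrow> nat \<Rightarrow> bool" where
  "unmatched_in m a \<longleftrightarrow> m ''match'' a = a \<or> m ''match'' a \<notin> marks m"

definition blocked :: "memory \<Rightarrow> nat \<times> nat \<Rightarrow> bool" where
  "blocked m = (\<lambda>(a, b). a < b \<and> a \<in> marks m \<and> b \<in> marks m \<and> is_acquire (t ! a) \<and>
      is_acquire (t ! b) \<and>
     loc (t ! a) = loc (t ! b) \<and> unmatched_in m a \<and> unmatched_in m b)"

lemma unmatched_test:
  "links m \<Longrightarrow> a < n \<Longrightarrow> m ''match'' a = a \<or> m ''in'' (m ''match'' a) = 0 \<longleftrightarrow> unmatched_in m a"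
  using link_range(3)[of m a] by (auto simp: unmatched_in_def marks_def)

lemma check_reach:
  assumes inp: "input_facts m" and L: "links m"
  shows "reach t check (8 + n * (4 + n * 4)) m h (\<lambda>m' h'. h' = h \<and>
    m' ''ok'' 0 = (if j1 \<notin> marks m \<and> j2 \<notin> marks m \<and> (\<forall>p\<in>{..<n} \<times> {..<n}. \<not> blocked m p) then 1
        else 0))"
  unfolding check_def
proof (rule reach_Seq[where T = 5 and T' = "2 + n * (4 + n * 4)" and
      \<Psi> = "\<lambda>m' h'. h' = h \<and> m' ''ok'' 0 = (if j1 \<notin> marks m \<and> j2 \<notin> marks m then 1 else 0)"],
          goal_cases)
  case 1
  have "m ''in'' j1 \<noteq> 0 \<longleftrightarrow> j1 \<in> marks m" "m ''in'' j2 \<noteq> 0 \<longleftrightarrow> j2 \<in> marks m" using j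
      by (auto simp: marks_def)
  then show ?case by (intro reach_wp) (use input_factsD[OF inp] in auto)
next
  case (2 m1 h1)
  have fr1: "m1 A = m A" if "A \<noteq> ''ok''" for A using 2(2)[of A] that by simp
  show ?case
  proof (rule reach_all_pairs[where N = n and T = 2 and I = "\<lambda>P m' h'. h' = h \<and>
        m' ''ok'' 0 = (if j1 \<notin> marks m \<and> j2 \<notin> marks m \<and> (\<forall>p\<in>P. \<not> blocked m p) then 1 else
            0)"], goal_cases)
    case 4 then show ?case using input_factsD[OF inp] fr1 by simp
  next
    case 7 then show ?case using 2(1) by simp
  next
    case (8 P a b m2 h2)
    have fr2: "m2 A = m A" if "A \<notin> {''a'', ''b'', ''ok''}" for A
      using 8(8)[of A] that fr1[of A] by (simp add: check_pair_def)
    have inp2: "input_facts m2" by (rule input_facts_cong[OF inp]) (simp_all add: fr2)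
    note I = input_factsD[OF inp2]
    have L2: "links m2" using L by (simp add: links_def links_upto_def fr2)
    have M2: "marks m2 = marks m" by (simp add: marks_def fr2)
    have B: "a < b \<and> m2 ''in'' a \<noteq> 0 \<and> m2 ''in'' b \<noteq> 0 \<and> m2 ''type'' a = 2 \<and> m2 ''type'' b = 2 \<and>
      m2 ''loc'' a = m2 ''loc'' b \<and> (m2 ''match'' a = a \<or> m2 ''in'' (m2 ''match'' a) = 0) \<and>
      (m2 ''match'' b = b \<or> m2 ''in'' (m2 ''match'' b) = 0) \<longleftrightarrow> blocked m (a, b)"
      unfolding unmatched_test[OF L2 8(3)] unmatched_test[OF L2 8(4)]
      using I(5,6)[OF 8(3)] I(5,6)[OF 8(4)] 8(3,4) M2 loc_code_iff[of "t ! a" "t ! b"] event_kinds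
      by (auto simp: blocked_def action_code_iff marks_def unmatched_in_def fr2)
    show ?case
      unfolding check_pair_def
      by (rule reach_wp) (use B 8(5,6,7) in auto)
  next
    case (9 m' h') then show ?case by simp
  qed (simp_all add: check_pair_def)
qed simp

definition edge :: "memory \<Rightarrow> nat \<times> nat \<Rightarrow> bool" where
  "edge m = (\<lambda>(a, b). a \<in> marks m \<and> b \<in> marks m \<and> (prev_of b a \<or> (a \<noteq> b \<and> m ''obs'' b = a) \<or>
     (is_release (t ! a) \<and> is_acquire (t ! b) \<and> loc (t ! a) = loc (t ! b) \<and> unmatched_in m b)))"

definition listed :: "memory \<Rightarrow> (nat \<times> nat) set" where
  "listed m = (\<lambda>i. (m ''src'' i, m ''dst'' i)) ` {..<m ''edges'' 0}"

text \<open>At most one edge is listed per visited pair, which bounds the cost of reading the edges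
  in \<open>Closure\<close> by \<open>n * n\<close>.\<close>

lemma list_edges_reach:
  assumes inp: "input_facts m" and L: "links m" and z: "m ''edges'' 0 = 0"
  shows "reach t (all_pairs list_edge) (2 + n * (4 + n * 6)) m h (\<lambda>m' h'. h' = h \<and>
      m' ''edges'' 0 \<le> n * n \<and>
    listed m' = {p \<in> {..<n} \<times> {..<n}. edge m p})"
proof (rule reach_all_pairs[where N = n and T = 4 and I = "\<lambda>P m' h'. h' = h \<and>
      m' ''edges'' 0 \<le> card P \<and> listed m' = {p \<in> P. edge m p}"], goal_cases)
  case 4 then show ?case using input_factsD[OF inp] by simp
next
  case 7 then show ?case using z by (simp add: listed_def)
next
  case (8 P a b m2 h2)
  have fr2: "m2 A = m A" if "A \<notin> {''a'', ''b'', ''src'', ''dst'', ''edges''}" for A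
    using 8(8)[of A] that by (simp add: list_edge_def)
  have inp2: "input_facts m2" by (rule input_facts_cong[OF inp]) (simp_all add: fr2)
  note I = input_factsD[OF inp2]
  have L2: "links m2" using L by (simp add: links_def links_upto_def fr2)
  have M2: "marks m2 = marks m" by (simp add: marks_def fr2)
  have card: "card (insert (a, b) P) = Suc (card P)"
    using 8(1,2) finite_subset[OF 8(1)] by simp
  have B: "m2 ''in'' a \<noteq> 0 \<and> m2 ''in'' b \<noteq> 0 \<and> (a < b \<and> m2 ''proc'' b = m2 ''proc'' a \<or>
      a \<noteq> b \<and> m2 ''obs'' b = a \<or> m2 ''type'' a = 3 \<and> m2 ''type'' b = 2 \<and>
      m2 ''loc'' a = m2 ''loc'' b \<and> (m2 ''match'' b = b \<or> m2 ''in'' (m2 ''match'' b) = 0)) \<longleftrightarrow>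
          edge m (a, b)"
    unfolding unmatched_test[OF L2 8(4)]
    using I(5,6)[OF 8(3)] I(5,6)[OF 8(4)] 8(3,4) M2 loc_code_iff[of "t ! a" "t ! b"] event_kinds
      link_tests(1)[OF inp2 8(4,3)]
    by (auto simp: edge_def action_code_iff marks_def unmatched_in_def fr2)
  have listed: "listed m3 = insert (a, b) (listed m2)"
    if "m3 ''src'' = (m2 ''src'')(m2 ''edges'' 0 := a)" "m3 ''dst'' = (m2 ''dst'')(m2 ''edges'' 0
        := b)"
      "m3 ''edges'' 0 = Suc (m2 ''edges'' 0)" for m3
  proof -
    have "(\<lambda>i. (m3 ''src'' i, m3 ''dst'' i)) ` {..<m2 ''edges'' 0} = listed m2"
      unfolding listed_def by (intro image_cong) (auto simp: that)
    then show ?thesis by (simp add: listed_def that lessThan_Suc)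
  qed
  show ?case
  proof (cases "edge m (a, b)")
    case True
    have "{p \<in> insert (a, b) P. edge m p} = insert (a, b) {p \<in> P. edge m p}" using True by auto
    moreover have "listed (m2(''src'' := (m2 ''src'')(m2 ''edges'' 0 := a), ''dst'' := (m2
        ''dst'')(m2 ''edges'' 0 := b),
      ''edges'' := (m2 ''edges'')(0 := Suc (m2 ''edges'' 0)))) = insert (a, b) (listed m2)"
      by (rule listed) simp_all
    ultimately show ?thesis
      unfolding list_edge_def
      by (intro reach_wp) (use B[THEN iffD2, OF True] 8(5,6,7) card in simp_all)
  next
    case False
    have "{p \<in> insert (a, b) P. edge m p} = {p \<in> P. edge m p}" using False by auto
    then show ?thesis
      unfolding list_edge_def
      by (intro reach_wp) (use B[THEN iffD1] False 8(5,6,7) card in auto)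
  qed
next
  case (9 m' h') then show ?case by simp
qed (simp_all add: list_edge_def listed_def)

end

lemma reach_Closure:
  assumes "X = marked_events t m A" "len = val m e" "\<forall>j<len. m B j < length t \<and> m C j < length t"
    "R = listed_edges t m len B C" "R \<subseteq> X \<times> X" "P = R\<^sup>+ \<union> Id_on X" "feasible t X"
        "respect_conditions t X P"
    and res: "res = map_option (Pair X) (order_closure t X P)"
    and \<Phi>: "\<Phi> (m(D := (m D)(0 := if res = None then 0 else 1))) res" and T: "1 + len \<le> T"
  shows "reach t (Closure A e B C D) T m h \<Phi>"
  unfolding reach_def
proof (intro allI impI)
  fix s :: state assume s: "mem s = m" "held s = h"
  have "exec t (Closure A e B C D) s (tick (1 + len) (hold (map_option (Pair X) (order_closure t X
      P)) D
        (s\<lparr>closures := closures s + 1\<rparr>)))"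
    using assms s by (intro exec.Closure) auto
  then show "\<exists>s'. exec t (Closure A e B C D) s s' \<and> steps s' \<le> steps s + T \<and> \<Phi> (mem s') (held s')"
    using \<Phi> T s res
    by (intro exI[of _ "tick (1 + len) (hold (map_option (Pair X) (order_closure t X P)) D
        (s\<lparr>closures := closures s + 1\<rparr>))"]) auto
qed

text \<open>Exactly the edges that respecting the trace asks for. Antisymmetry may fail for the
  order they generate, but \<open>Closure\<close> does not demand it.\<close>

definition required :: "event list \<Rightarrow> event set \<Rightarrow> event rel" where
  "required t X = {(e, e'). e \<in> X \<and> e' \<in> X \<and> (po t e e' \<or> observes t e' e \<or>
     (is_release e \<and> is_acquire e' \<and> loc e = loc e' \<and> \<not> (\<exists>\<rho>\<in>X. matches t e' \<rho>)))}"

lemma required_subset: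
  assumes "closed_order t X Q"
  shows "(required t X)\<^sup>+ \<union> Id_on X \<subseteq> Q"
proof -
  have "required t X \<subseteq> Q" using closed_orderD[OF assms] unfolding required_def by auto
  moreover have "trans Q" using closed_orderD(1)[OF assms] by (simp add: partial_order_on_def
      preorder_on_def)
  ultimately have "(required t X)\<^sup>+ \<subseteq> Q" by (metis subsetI trancl_id trancl_mono)
  then show ?thesis using partial_order_onD(2)[OF closed_orderD(1)[OF assms]] by auto
qed

text \<open>The edges handed to \<open>Closure\<close> may form a cycle, in which case both closures are \<open>\<bottom>\<close>.\<close>

lemma order_closure_required: "order_closure t X ((required t X)\<^sup>+ \<union> Id_on X) = order_closure t X
    {}"
proof -
  have "(\<lambda>Q. closed_order t X Q \<and> (required t X)\<^sup>+ \<union> Id_on X \<subseteq> Q) = (\<lambda>Q. closed_order t X Q \<and>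
      {} \<subseteq> Q)"
    using required_subset by blast
  then show ?thesis by (simp only: order_closure_def)
qed

text \<open>The strict conditions hold even if the generators have a cycle, since
  \<open>strictly\<close> only asks for different endpoints, and the kinds of the events guarantee
  those.\<close>

lemma required_respects:
  assumes "feasible t X"
  shows "respect_conditions t X ((required t X)\<^sup>+ \<union> Id_on X)"
  unfolding respect_conditions_def
proof (intro conjI ballI allI impI)
  show "(e, e') \<in> (required t X)\<^sup>+ \<union> Id_on X" if "e \<in> X" "e' \<in> X" "po_eq t e e'" for e e'
    using that by (auto simp: po_eq_def required_def)
  show "strictly ((required t X)\<^sup>+ \<union> Id_on X) w r" if "r \<in> X" "observes t r w" for r w
  proof -
    have "w \<in> X" "w \<noteq> r" using feasibleD(3)[OF assms that] that(2) event_kinds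
        by (auto simp: observes_def)
    then show ?thesis using that by (auto simp: strictly_def required_def)
  qed
  show "strictly ((required t X)\<^sup>+ \<union> Id_on X) \<rho> a"
    if "a \<in> X" "\<rho> \<in> X" "is_acquire a" "is_release \<rho>" "loc \<rho> = loc a" "\<not> (\<exists>\<rho>'\<in>X. matches t a \<rho>')"
        for a \<rho>
  proof -
    have "\<rho> \<noteq> a" using that event_kinds by blast
    then show ?thesis using that by (auto simp: strictly_def required_def)
  qed
qed

lemma rcone_subset: "x \<in> rcone t e q \<Longrightarrow> x \<in> set t"
  by (induction rule: rcone.induct)
    (auto simp: po_def po_eq_def observes_def matches_def dest: before_in_set)

text \<open>The guard evaluates everything about an open pair except for \<open>Q\<close>, and two
  queries settle the rest. A failed closure sets \<open>ok\<close> to 0, which makes all later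
  visits idle.\<close>

definition order_pair :: com where
  "order_pair = guarded (Equal (V ''ok'') (Num 1) && Less (V ''a'') (V ''b'') && marked (V ''a'') &&
       marked (V ''b'') && Neg (Equal (Cell ''proc'' (V ''a'')) (V ''q'')) &&
       Neg (Equal (Cell ''proc'' (V ''b'')) (V ''q'')) && same ''loc'' (V ''a'') (V ''b'') &&
       either (Less (Cell ''type'' (V ''a'')) (Num 2) && Less (Cell ''type'' (V ''b'')) (Num 2) &&
           Neg (has_type (V ''a'') 1 && has_type (V ''b'') 1))
         (Neg (Less (Cell ''type'' (V ''a'')) (Num 2)) && Neg (Less (Cell ''type'' (V ''b'')) (Num
             2))))
     (Query (V ''a'') (V ''b'') ''d'' ;;
      guarded (Equal (V ''d'') (Num 0)) (
        Query (V ''b'') (V ''a'') ''d'' ;;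
        guarded (Equal (V ''d'') (Num 0)) (InsertAndClose (V ''a'') (V ''b'') ''ok'')))"

definition decision_program :: com where
  "decision_program = pick_process ;; build_links ;; mark_seeds ;; spread ;; check ;;
     guarded (Equal (V ''ok'') (Num 1)) (
       all_pairs list_edge ;;
       Closure ''in'' (V ''edges'') ''src'' ''dst'' ''ok'' ;;
       guarded (Equal (V ''ok'') (Num 1)) (all_pairs order_pair)) ;;
     put ''result'' (V ''ok'')"

section \<open>Correctness of the decision program\<close>

context input_trace
begin

definition prepared :: "event set \<Rightarrow> memory \<Rightarrow> bool" where
  "prepared X m \<longleftrightarrow> X = cone_union t (t ! j1) (t ! j2) \<and> input_facts m \<and> links m \<and>
      marks m = positions X"

lemma cone_subset: "cone_union t e1 e2 \<subseteq> set t"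
  using rcone_subset unfolding cone_union_def by blast

lemma marks_iff: "prepared X m \<Longrightarrow> a < n \<Longrightarrow> a \<in> marks m \<longleftrightarrow> t ! a \<in> X"
  by (simp add: prepared_def positions_def)

lemma unmatched_in_iff:
  assumes "prepared X m" "a < n"
  shows "unmatched_in m a \<longleftrightarrow> \<not> (\<exists>\<rho>\<in>X. matches t (t ! a) \<rho>)"
  using assms matches_index[of m a] link_range(3)[of m a] marks_iff[OF assms(1), of "m ''match'' a"]
  by (auto simp: unmatched_in_def prepared_def)

text \<open>Cones are closed under predecessors and observed writes by their rules, and a release
  brings in its acquire because the two share a process. Only the condition on open critical
  sections needs a test, and by symmetry \<open>a < b\<close> suffices.\<close>

lemma feasible_iff:
  assumes p: "prepared X m"
  shows "feasible t X \<longleftrightarrow> (\<forall>p\<in>{..<n} \<times> {..<n}. \<not> blocked m p)"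
proof
  assume f: "feasible t X"
  show "\<forall>p\<in>{..<n} \<times> {..<n}. \<not> blocked m p"
  proof
    fix p assume "p \<in> {..<n} \<times> {..<n}"
    then obtain a b where ab: "p = (a, b)" "a < n" "b < n" by auto
    show "\<not> blocked m p"
    proof
      assume "blocked m p"
      then have B: "a < b" "t ! a \<in> X" "t ! b \<in> X" "is_acquire (t ! a)" "is_acquire (t ! b)"
        "loc (t ! a) = loc (t ! b)" "unmatched_in m a" "unmatched_in m b"
        using marks_iff[OF p] ab by (auto simp: blocked_def)
      moreover have "t ! a \<noteq> t ! b" using B(1) ab nth_eq_iff_index_eq[OF dist] by auto
      ultimately show False
        using feasibleD(5)[OF f B(2,3,4,5)] unmatched_in_iff[OF p] ab by blast
    qed
  qed
next
  assume nb: "\<forall>p\<in>{..<n} \<times> {..<n}. \<not> blocked m p"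
  have X: "X = cone_union t (t ! j1) (t ! j2)" using p by (simp add: prepared_def)
  have sub: "X \<subseteq> set t" using cone_subset X by blast
  have po_closed: "e \<in> X" if "po_eq t e e'" "e' \<in> X" for e e'
    using that rcone.down unfolding X cone_union_def by blast
  have *: "\<not> (is_acquire a1 \<and> is_acquire a2 \<and> loc a1 = loc a2 \<and>
      \<not> (\<exists>\<rho>\<in>X. matches t a1 \<rho>) \<and> \<not> (\<exists>\<rho>\<in>X. matches t a2 \<rho>))"
    if a: "a1 \<in> X" "a2 \<in> X" "before t a1 a2" for a1 a2
  proof
    obtain a b where ab: "a < n" "a1 = t ! a" "b < n" "a2 = t ! b"
      using a index_of sub by (metis subsetD)
    assume "is_acquire a1 \<and> is_acquire a2 \<and> loc a1 = loc a2 \<and>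
      \<not> (\<exists>\<rho>\<in>X. matches t a1 \<rho>) \<and> \<not> (\<exists>\<rho>\<in>X. matches t a2 \<rho>)"
    then have "blocked m (a, b)"
      using ab a before_nth[OF dist ab(1,3)] unmatched_in_iff[OF p] marks_iff[OF p]
          by (auto simp: blocked_def)
    then show False using nb ab by auto
  qed
  show "feasible t X"
    unfolding feasible_def
  proof (intro conjI allI impI ballI)
    show "e \<in> X" if "po_eq t e e'" "e' \<in> X" for e e' using po_closed that .
    show "w \<in> X" if "r \<in> X" "observes t r w" for r w
      using that rcone.obs unfolding X cone_union_def by blast
    show "a \<in> X" if "\<rho> \<in> X" "matches t a \<rho>" for a \<rho>
      using po_closed[of a \<rho>] that trace_match_po[OF trace that(2)] by (auto simp: po_eq_def)
    show "loc a1 \<noteq> loc a2" if "a1 \<in> X" "a2 \<in> X" "is_acquire a1" "is_acquire a2" "a1 \<noteq> a2"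
      "\<not> (\<exists>\<rho>\<in>X. matches t a1 \<rho>)" "\<not> (\<exists>\<rho>\<in>X. matches t a2 \<rho>)" for a1 a2
    proof -
      have "before t a1 a2 \<or> before t a2 a1"
        using before_total[OF subsetD[OF sub that(1)] subsetD[OF sub that(2)] that(5)] .
      then show ?thesis using *[OF that(1,2)] *[OF that(2,1)] that(3,4,6,7) by auto
    qed
  qed (rule sub)
qed

lemma edges_required:
  assumes p: "prepared X m"
  shows "(\<lambda>(a, b). (t ! a, t ! b)) ` {p \<in> {..<n} \<times> {..<n}. edge m p} = required t X"
proof -
  have L: "links m" using p by (simp add: prepared_def)
  have X: "X \<subseteq> set t" using p cone_subset by (auto simp: prepared_def)
  have edge: "edge m (a, b) \<longleftrightarrow> (t ! a, t ! b) \<in> required t X" if "a < n" "b < n" for a b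
  proof -
    have "a \<noteq> b \<and> m ''obs'' b = a \<longleftrightarrow> observes t (t ! b) (t ! a)"
      using observes_index[OF L that(2)] nth_eq_iff_index_eq[OF dist that(1)] link_range(2)[OF L
          that(2)] by auto
    then show ?thesis
      using that po_index[OF that] marks_iff[OF p] unmatched_in_iff[OF p] by (auto simp: edge_def
          required_def)
  qed
  show ?thesis
  proof
    show "required t X \<subseteq> (\<lambda>(a, b). (t ! a, t ! b)) ` {p \<in> {..<n} \<times> {..<n}. edge m p}"
    proof
      fix x assume x: "x \<in> required t X"
      then have "fst x \<in> set t" "snd x \<in> set t" using X by (auto simp: required_def)
      then obtain a b where "a < n" "b < n" "x = (t ! a, t ! b)" by (metis index_of prod.collapse)
      then show "x \<in> (\<lambda>(a, b). (t ! a, t ! b)) ` {p \<in> {..<n} \<times> {..<n}. edge m p}"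
        using edge x by (intro image_eqI[of _ _ "(a, b)"]) auto
    qed
  qed (use edge in auto)
qed

lemma closure_reach:
  assumes p: "prepared X m" and f: "feasible t X" and len: "m ''edges'' 0 \<le> n * n"
    and l: "listed m = {p \<in> {..<n} \<times> {..<n}. edge m p}"
  shows "reach t (Closure ''in'' (V ''edges'') ''src'' ''dst'' ''ok'') (1 + n * n) m h (\<lambda>m' h'.
    h' = map_option (Pair X) (order_closure t X {}) \<and> m' ''ok'' 0 = (if h' = None then 0 else 1))"
proof (rule reach_Closure[where X = X and len = "m ''edges'' 0" and R = "required t X" and
      P = "(required t X)\<^sup>+ \<union> Id_on X" and res = "map_option (Pair X) (order_closure t X {})"])
  have "marked_events t m ''in'' = {t ! a | a. a \<in> marks m}"
    by (simp add: marked_events_def marks_def)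
  also have "\<dots> = {t ! a | a. a < n \<and> t ! a \<in> X}" using p by (simp add: prepared_def positions_def)
  also have "\<dots> = X"
  proof -
    have "X \<subseteq> set t" using p cone_subset by (simp add: prepared_def)
    then have "\<exists>a. e = t ! a \<and> a < n" if "e \<in> X" for e using that index_of by (metis subsetD)
    then show ?thesis by auto
  qed
  finally show "X = marked_events t m ''in''" by simp
  have "(m ''src'' i, m ''dst'' i) \<in> {..<n} \<times> {..<n}" if "i < m ''edges'' 0" for i
  proof -
    have "(m ''src'' i, m ''dst'' i) \<in> listed m" using that by (auto simp: listed_def)
    then show ?thesis using l by simp
  qed
  then show "\<forall>i<m ''edges'' 0. m ''src'' i < n \<and> m ''dst'' i < n" by auto
  have "listed_edges t m (m ''edges'' 0) ''src'' ''dst'' = (\<lambda>(a, b). (t ! a, t ! b)) ` listed m"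
    by (auto simp: listed_edges_def listed_def)
  then show "required t X = listed_edges t m (m ''edges'' 0) ''src'' ''dst''"
    using l edges_required[OF p] by simp
  show "required t X \<subseteq> X \<times> X" by (auto simp: required_def)
  show "respect_conditions t X ((required t X)\<^sup>+ \<union> Id_on X)" using required_respects[OF f] .
  show "map_option (Pair X) (order_closure t X {}) =
    map_option (Pair X) (order_closure t X ((required t X)\<^sup>+ \<union> Id_on X))"
    by (simp only: order_closure_required)
qed (use f len in simp_all)

text \<open>The clause on \<open>res\<close> says that a run continued from \<open>Q\<close>
  completes to a run from \<open>Q0\<close>. The program builds a run from its front, whereas the
  rules of \<open>saturate\<close> build it from its end.\<close>

definition saturating :: "event set \<Rightarrow> nat \<Rightarrow> event rel \<Rightarrow> (nat \<times> nat) set \<Rightarrow> memory \<Rightarrow>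
    (event set \<times> event rel) option \<Rightarrow> bool" where
  "saturating X q Q0 P m h \<longleftrightarrow>
     (m ''ok'' 0 = 1 \<and> (\<exists>Q. h = Some (X, Q) \<and> closed_order t X Q \<and>
       (\<forall>res. saturate t X q Q res \<longrightarrow> saturate t X q Q0 res) \<and>
       (\<forall>(a, b)\<in>P. \<not> open_pair t X q Q (t ! a) (t ! b)))) \<or>
     (m ''ok'' 0 = 0 \<and> h = None \<and> saturate t X q Q0 None)"

text \<open>Orders only grow, so a visited pair stays settled, and the inserted pair is now ordered.
  No pair has to be visited twice.\<close>

lemma saturating_insert:
  assumes Q: "closed_order t X Q" "\<forall>res. saturate t X q Q res \<longrightarrow> saturate t X q Q0 res"
      "\<forall>(a, b)\<in>P. \<not> open_pair t X q Q (t ! a) (t ! b)"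
    and o: "open_pair t X q Q (t ! a) (t ! b)"
    and res: "res = map_option (Pair X) (insert_and_close t X Q (t ! a) (t ! b))"
      "m ''ok'' 0 = (if res = None then 0 else 1)"
  shows "saturating X q Q0 (insert (a, b) P) m res"
proof (cases "insert_and_close t X Q (t ! a) (t ! b)")
  case None
  then show ?thesis using res Q(2) saturate.cycle[OF o None] by (simp add: saturating_def)
next
  case (Some Q')
  then have Q': "closed_order t X Q'" "insert (t ! a, t ! b) Q \<subseteq> Q'"
    unfolding insert_and_close_def order_closure_Some by auto
  have "\<not> open_pair t X q Q' (t ! a') (t ! b')" if "(a', b') \<in> insert (a, b) P" for a' b'
    using that Q(3) Q'(2) unfolding open_pair_def by blast
  then show ?thesis
    using res Some Q(2) saturate.step[OF o Some] Q'(1) by (auto simp: saturating_def)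
qed

lemma order_pairs_reach:
  assumes p: "prepared X m" and q: "m ''q'' 0 = q" and ok: "m ''ok'' 0 = 1"
      and Q0: "closed_order t X Q0"
  shows "reach t (all_pairs order_pair) (2 + n * (4 + n * 8)) m (Some (X, Q0)) (\<lambda>m' h'.
    saturate t X q Q0 h' \<and> m' ''ok'' 0 = (if h' = None then 0 else 1))"
proof (rule reach_all_pairs[where N = n and T = 6 and I = "saturating X q Q0"], goal_cases)
  case 4 then show ?case using p input_factsD(1) by (auto simp: prepared_def)
next
  case 7
  then show ?case using ok Q0 by (auto simp: saturating_def)
next
  case (8 P a b m2 h2)
  have fr2: "m2 A = m A" if "A \<notin> {''a'', ''b'', ''d'', ''ok''}" for A
    using 8(8)[of A] that by (simp add: order_pair_def)
  have inp: "input_facts m" using p by (simp add: prepared_def)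
  have inp2: "input_facts m2" by (rule input_facts_cong[OF inp]) (simp_all add: fr2)
  note I = input_factsD[OF inp2]
  note ab = 8(3,4)
  have ne: "t ! a \<noteq> t ! b" if "a < b" using that nth_eq_iff_index_eq[OF dist ab] by simp
  have mk: "m2 ''in'' c \<noteq> 0 \<longleftrightarrow> t ! c \<in> X" if "c < n" for c
    using marks_iff[OF p that] that fr2 by (simp add: marks_def)
  let ?static = "a < b \<and> t ! a \<in> X \<and> t ! b \<in> X \<and> proc (t ! a) \<noteq> q \<and> proc (t ! b) \<noteq> q \<and>
      conflicting (t ! a) (t ! b)"
  let ?test = "a < b \<and> m2 ''in'' a \<noteq> 0 \<and> m2 ''in'' b \<noteq> 0 \<and> m2 ''proc'' a \<noteq> m2 ''q'' 0 \<and>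
    m2 ''proc'' b \<noteq> m2 ''q'' 0 \<and> m2 ''loc'' a = m2 ''loc'' b \<and>
    (m2 ''type'' a < 2 \<and> m2 ''type'' b < 2 \<and> \<not> (m2 ''type'' a = Suc 0 \<and> m2 ''type'' b = Suc 0) \<or>
      \<not> m2 ''type'' a < 2 \<and> \<not> m2 ''type'' b < 2)"
  \<comment> \<open>The codes decide conflicts: two codes below 2 are accesses, which conflict
    unless both are 1, the code of reads; two codes from 2 on are lock events.\<close>
  have st: "?test \<longleftrightarrow> ?static"
    using I(4-6)[OF ab(1)] I(4-6)[OF ab(2)] ne mk[OF ab(1)] mk[OF ab(2)] q fr2[of "''q''"]
      loc_code_iff[of "t ! a" "t ! b"]
    by (auto simp: action_code_iff conflicting_def lock_event_iff is_access_def dest: event_kinds)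
  have op: "open_pair t X q Q (t ! a) (t ! b) \<longleftrightarrow> ?static \<and> (t ! a, t ! b) \<notin> Q \<and> (t ! b, t ! a) \<notin> Q"
      for Q
    using before_nth[OF dist ab] by (auto simp: open_pair_def)
  show ?case
  proof (cases "m2 ''ok'' 0 = 1 \<and> ?static")
    case False
    have "saturating X q Q0 (insert (a, b) P) m2 h2"
      using 8(5) False op unfolding saturating_def by auto
    moreover have "\<not> (m2 ''ok'' 0 = 1 \<and> ?test)" using st False by blast
    ultimately show ?thesis
      unfolding order_pair_def by (intro reach_wp) (use 8(6,7) in auto)
  next
    case True
    then obtain Q where Q: "h2 = Some (X, Q)" "closed_order t X Q"
      "\<forall>res. saturate t X q Q res \<longrightarrow> saturate t X q Q0 res"
      "\<forall>(a, b)\<in>P. \<not> open_pair t X q Q (t ! a) (t ! b)"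
      using 8(5) unfolding saturating_def by auto
    note test = st[THEN iffD2, OF conjunct2[OF True]]
    have keep: "saturating X q Q0 (insert (a, b) P) m' (Some (X, Q))"
      if "(t ! a, t ! b) \<in> Q \<or> (t ! b, t ! a) \<in> Q" "m' ''ok'' 0 = 1" for m'
      using that Q op unfolding saturating_def by auto
    have close: "saturating X q Q0 (insert (a, b) P) m' (map_option (Pair X) (insert_and_close t X
        Q (t ! a) (t ! b)))"
      if "(t ! a, t ! b) \<notin> Q" "(t ! b, t ! a) \<notin> Q"
        "m' ''ok'' 0 = (if map_option (Pair X) (insert_and_close t X Q (t ! a) (t ! b)) = None
            then 0 else 1)" for m'
    proof (rule saturating_insert[OF Q(2,3,4)])
      show "open_pair t X q Q (t ! a) (t ! b)" using op that(1,2) True by blast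
    qed (use that(3) in auto)
    consider "(t ! a, t ! b) \<in> Q" | "(t ! a, t ! b) \<notin> Q" "(t ! b, t ! a) \<in> Q" |
      "(t ! a, t ! b) \<notin> Q" "(t ! b, t ! a) \<notin> Q" by blast
    then show ?thesis
    proof cases
      case 1
      then show ?thesis
        unfolding order_pair_def
        by (intro reach_wp) (use test 8(6,7) True ab Q(1) keep in simp_all)
    next
      case 2
      then show ?thesis
        unfolding order_pair_def
        by (intro reach_wp) (use test 8(6,7) True ab Q(1) keep in simp_all)
    next
      case 3
      then show ?thesis
        unfolding order_pair_def
        by (intro reach_wp) (use test 8(6,7) True ab Q(1) close in \<open>auto simp: Let_def\<close>)
    qed
  qed
next
  case (9 m' h')
  then show ?case
  proof (cases "h' = None")
    case False
    then obtain Q where Q: "h' = Some (X, Q)" "\<forall>res. saturate t X q Q res \<longrightarrow> saturate t X q Q0 res"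
      "\<forall>(a, b)\<in>{..<n} \<times> {..<n}. \<not> open_pair t X q Q (t ! a) (t ! b)" "m' ''ok'' 0 = 1"
      using 9(1) unfolding saturating_def by auto
    have "X \<subseteq> set t" using p cone_subset by (auto simp: prepared_def)
    have "\<nexists>a b. open_pair t X q Q a b"
    proof (intro notI, elim exE)
      fix e e' assume o: "open_pair t X q Q e e'"
      then have "e \<in> set t" "e' \<in> set t" using \<open>X \<subseteq> set t\<close> by (auto simp: open_pair_def)
      then obtain a b where "a < n" "e = t ! a" "b < n" "e' = t ! b" by (metis index_of)
      then show False using Q(3) o by auto
    qed
    \<comment> \<open>With all pairs visited, \<open>Q\<close> ends its own run by the exit rule,
      and that run completes to one from \<open>Q0\<close>.\<close>
    then show ?thesis using Q saturate.exit by auto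
  qed (auto simp: saturating_def)
qed (simp_all add: order_pair_def saturating_def)

end

context input_trace
begin

lemma prepared_cong:
  assumes "prepared X m" "m' ''n'' = m ''n''" "m' ''e1'' = m ''e1''" "m' ''e2'' = m ''e2''"
    "m' ''proc'' = m ''proc''" "m' ''type'' = m ''type''" "m' ''loc'' = m ''loc''"
        "m' ''prev'' = m ''prev''"
    "m' ''obs'' = m ''obs''" "m' ''match'' = m ''match''" "m' ''in'' = m ''in''"
  shows "prepared X m'"
proof -
  have p: "X = cone_union t (t ! j1) (t ! j2)" "input_facts m" "links m" "marks m = positions X"
    using assms(1) unfolding prepared_def by blast+
  have "input_facts m'" by (rule input_facts_cong[OF p(2) assms(2-7)])
  moreover have "links m'" using p(3) assms(8-10) unfolding links_def links_upto_def by simp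
  moreover have "marks m' = marks m" unfolding marks_def by (simp only: assms(11))
  ultimately show ?thesis unfolding prepared_def using p(1,4) by simp
qed

text \<open>The rest of the program is a parameter because \<open>;;\<close> associates to the
  right, so that the first three commands do not form a subterm of their own.\<close>

lemma prepare_reach:
  assumes inp: "input_facts m" and z: "\<And>a. m ''in'' a = 0"
    and rest: "\<And>m' h'. prepared (cone_union t (t ! j1) (t ! j2)) m' \<Longrightarrow>
      (\<And>A. A \<notin> {''a'', ''b'', ''r'', ''prev'', ''obs'', ''match'', ''in''} \<Longrightarrow> m' A = m A) \<Longrightarrow>
          reach t c T m' h' \<Phi>"
    and T: "T' = 6 + n * (15 + n * 15) + T"
  shows "reach t (build_links ;; mark_seeds ;; spread ;; c) T' m h \<Phi>"
proof (rule reach_Seq[OF build_links_reach[OF inp], where T' = "4 + n * (8 + n * 7) + T"],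
    goal_cases)
  case (1 m1 h1)
  have fr1: "m1 A = m A" if "A \<notin> {''a'', ''b'', ''prev'', ''obs'', ''match''}" for A
    using 1(2)[of A] that by (simp add: build_links_def link_step_def)
  have inp1: "input_facts m1" by (rule input_facts_cong[OF inp]) (simp_all add: fr1)
  have z1: "m1 ''in'' a = 0" for a using z fr1[of "''in''"] by simp
  show ?case
  proof (rule reach_Seq[OF mark_seeds_reach[OF inp1 z1], where T' = "2 + n * (4 + n * 7) + T"],
      goal_cases)
    case (1 m2 h2)
    have fr2: "m2 A = m1 A" if "A \<notin> {''a'', ''in''}" for A
      using 1(2)[of A] that by (simp add: mark_seeds_def)
    have inp2: "input_facts m2" by (rule input_facts_cong[OF inp1]) (simp_all add: fr2)
    have L2: "links m2" using \<open>links m1\<close> by (simp add: links_def links_upto_def fr2)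
    show ?case
    proof (rule reach_Seq[OF spread_reach[OF inp2 L2], where T' = T], goal_cases)
      case (1 m3 h3)
      have fr3: "m3 A = m2 A" if "A \<notin> {''a'', ''r'', ''in''}" for A
        using 1(2)[of A] that by (simp add: spread_def spread_step_def)
      have "marks m3 = positions (cone_union t (t ! j1) (t ! j2))"
      proof (rule cone_positions[OF L2])
        show "marks m3 \<subseteq> {..<n}" by (auto simp: marks_def)
        show "marks m3 \<subseteq> T" if "succ_closed m2 T" "seeds \<subseteq> T" for T
          using 1(1) \<open>marks m2 = seeds\<close> that by simp
      qed (use 1(1) \<open>marks m2 = seeds\<close> in simp_all)
      moreover have "input_facts m3" by (rule input_facts_cong[OF inp2]) (simp_all add: fr3)
      moreover have "links m3" using L2 by (simp add: links_def links_upto_def fr3)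
      ultimately have "prepared (cone_union t (t ! j1) (t ! j2)) m3" by (simp add: prepared_def)
      then show ?case
        by (rule rest) (simp add: fr1 fr2 fr3)
    qed simp
  qed (simp add: algebra_simps)
qed (simp add: T algebra_simps)

lemma decision_program_reach:
  assumes rd: "race_input k nv nl t (t ! j1) (t ! j2)" and i: "i \<in> {1, 2}"
  shows "reach t decision_program (60 * (n + 1) * (n + 1)) (input_memory k nv nl t j1 j2 i) h (\<lambda>m'
      h'.
    \<exists>res. race_decision t (t ! j1) (t ! j2) i res \<and> m' ''result'' 0 = (if res = None then 0 else
        1) \<and>
      (res \<noteq> None \<longrightarrow> h' = res))"
proof -
  let ?m = "input_memory k nv nl t j1 j2 i" and ?X = "cone_union t (t ! j1) (t ! j2)"
  define q where "q = proc (if i = 1 then t ! j1 else t ! j2)"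
  note m = input_memory_simps
  \<comment> \<open>The program calls \<open>Closure\<close> once, which fits the form of the
    algorithm that closes the empty relation instead of the weakest respecting order.\<close>
  have rdc: "race_decision t (t ! j1) (t ! j2) i res \<longleftrightarrow>
      (if {t ! j1, t ! j2} \<inter> ?X \<noteq> {} \<or> \<not> feasible t ?X then res = None
       else case order_closure t ?X {} of None \<Rightarrow> res = None | Some Q \<Rightarrow> saturate t ?X q Q
           res)" for res
    unfolding race_decision_closure[OF cone_union_def] q_def using i by simp
  let ?decided = "\<lambda>m' h'. \<exists>res. race_decision t (t ! j1) (t ! j2) i res \<and>
    m' ''ok'' 0 = (if res = None then 0 else 1) \<and> (res \<noteq> None \<longrightarrow> h' = res)"
  show ?thesis
    unfolding decision_program_def
  proof (rule reach_Seq[where T = 2 and T' = "50 + n * (50 + n * 50)"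
      and \<Psi> = "\<lambda>m' h'. m' ''q'' 0 = q"], goal_cases)
    case 1
    show ?case by (rule reach_wp) (use j in \<open>auto simp: pick_process_def m q_def\<close>)
  next
    case (2 m1 h1)
    have fr1: "m1 A = ?m A" if "A \<noteq> ''q''" for A using 2(2)[of A] that
        by (simp add: pick_process_def)
    have inp1: "input_facts m1" by (simp add: input_facts_def fr1 m)
    have z1: "m1 ''in'' a = 0" for a by (simp add: fr1 m)
    show ?case
    proof (rule prepare_reach[OF inp1 z1, where T = "44 + n * (35 + n * 35)"], goal_cases)
      case (1 m2 h2)
      note p = 1(1) and fr2 = 1(2)
      have inp2: "input_facts m2" "links m2" using p unfolding prepared_def by blast+
      have ok: "j1 \<notin> marks m2 \<and> j2 \<notin> marks m2 \<and> (\<forall>p\<in>{..<n} \<times> {..<n}. \<not> blocked m2 p) \<longleftrightarrow>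
          {t ! j1, t ! j2} \<inter> ?X = {} \<and> feasible t ?X"
        using feasible_iff[OF p] marks_iff[OF p j(1)] marks_iff[OF p j(2)] by simp
      show ?case
      proof (rule reach_Seq[OF check_reach[OF inp2], where T' = "36 + n * (31 + n * 31)"],
          goal_cases)
        case (1 m3 h3)
        have fr3: "m3 A = m2 A" if "A \<notin> {''a'', ''b'', ''ok''}" for A
          using 1(2)[of A] that by (simp add: check_def check_pair_def)
        have p3: "prepared ?X m3" by (rule prepared_cong[OF p]) (simp_all add: fr3)
        have ok3: "m3 ''ok'' 0 = (if {t ! j1, t ! j2} \<inter> ?X = {} \<and> feasible t ?X then 1 else 0)"
          using 1(1) unfolding ok by (rule conjunct2)
        show ?case
        proof (rule reach_Seq[where T = "Suc (30 + n * (30 + n * 30))" and T' = 1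
            and \<Psi> = ?decided], goal_cases)
          case 1
          show ?case
          proof (rule reach_Cond)
            assume "\<not> holds m3 (Equal (V ''ok'') (Num 1))"
            then have z: "\<not> ({t ! j1, t ! j2} \<inter> ?X = {} \<and> feasible t ?X)"
              using ok3 by (metis holds.simps(2) val.simps(1,2))
            then have "race_decision t (t ! j1) (t ! j2) i None" unfolding rdc by argo
            moreover have "m3 ''ok'' 0 = 0" using ok3 z by presburger
            ultimately have "?decided m3 h3" by (intro exI[of _ None]) simp
            then show "reach t Skip (30 + n * (30 + n * 30)) m3 h3 ?decided"
              by (intro reach_wp) simp_all
          next
            assume "holds m3 (Equal (V ''ok'') (Num 1))"
            then have f: "{t ! j1, t ! j2} \<inter> ?X = {}" "feasible t ?X"
              using ok3 by (metis holds.simps(2) val.simps(1,2) zero_neq_one)+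
            have e3: "m3 ''edges'' 0 = 0" by (simp add: fr3 fr2 fr1 m)
            have inp3: "input_facts m3" "links m3" using p3 unfolding prepared_def by blast+
            show "reach t (all_pairs list_edge ;; Closure ''in'' (V ''edges'') ''src'' ''dst''
                ''ok'' ;;
              guarded (Equal (V ''ok'') (Num 1)) (all_pairs order_pair)) (30 + n * (30 + n * 30))
                  m3 h3 ?decided"
            proof (rule reach_Seq[OF list_edges_reach[OF inp3 e3],
                where T' = "28 + n * (20 + n * 20)"], goal_cases)
              case (1 m4 h4)
              have fr4: "m4 A = m3 A" if "A \<notin> {''a'', ''b'', ''src'', ''dst'', ''edges''}" for A
                using 1(2)[of A] that by (simp add: list_edge_def)
              have p4: "prepared ?X m4" by (rule prepared_cong[OF p3]) (simp_all add: fr4)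
              have "edge m4 = edge m3"
                by (simp add: edge_def unmatched_in_def marks_def fr4)
              then have l: "listed m4 = {p \<in> {..<n} \<times> {..<n}. edge m4 p}"
                  and len: "m4 ''edges'' 0 \<le> n * n"
                using 1(1) by simp_all
              show ?case
              proof (rule reach_Seq[OF closure_reach[OF p4 f(2) len l],
                  where T' = "Suc (2 + n * (4 + n * 8))"], goal_cases)
                case (1 m5 h5)
                have fr5: "m5 A = m4 A" if "A \<noteq> ''ok''" for A using 1(2)[of A] that by simp
                have p5: "prepared ?X m5" by (rule prepared_cong[OF p4]) (simp_all add: fr5)
                have q5: "m5 ''q'' 0 = q" using 2(1) by (simp add: fr5 fr4 fr3 fr2)
                show ?case
                proof (rule reach_Cond)
                  assume "\<not> holds m5 (Equal (V ''ok'') (Num 1))"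
                  then have "m5 ''ok'' 0 \<noteq> 1" by simp
                  then have "m5 ''ok'' 0 = 0" "order_closure t ?X {} = None"
                    using 1(1) by (cases "order_closure t ?X {}"; simp)+
                  moreover from this(2) have "race_decision t (t ! j1) (t ! j2) i None"
                      by (simp add: rdc)
                  ultimately have "?decided m5 h5" by (intro exI[of _ None]) simp
                  then show "reach t Skip (2 + n * (4 + n * 8)) m5 h5 ?decided"
                    by (intro reach_wp) simp_all
                next
                  assume "holds m5 (Equal (V ''ok'') (Num 1))"
                  then have ok5: "m5 ''ok'' 0 = 1" by simp
                  then obtain Q where Q: "order_closure t ?X {} = Some Q" "h5 = Some (?X, Q)"
                    using 1(1) by (cases "order_closure t ?X {}") simp_all
                  have "closed_order t ?X Q" using Q(1) by (simp add: order_closure_Some)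
                  from order_pairs_reach[OF p5 q5 ok5 this]
                  show "reach t (all_pairs order_pair) (2 + n * (4 + n * 8)) m5 h5 ?decided"
                    unfolding Q(2)
                  proof (rule reach_mono, goal_cases)
                    case (2 m' h')
                    then have "race_decision t (t ! j1) (t ! j2) i h'" using f Q(1) rdc by simp
                    then show ?case using 2 by blast
                  qed simp
                qed
              qed (simp add: algebra_simps)
            qed (simp add: algebra_simps)
          qed
        next
          case (2 m4 h4)
          then show ?case by (intro reach_wp) simp_all
        qed (simp add: algebra_simps)
      qed (simp add: algebra_simps)
    qed (simp add: algebra_simps)
  qed (simp add: algebra_simps)
qed

end

section \<open>Running times\<close>

lemma decision_program_counts: "no_loop_closure decision_program" "closure_count decision_program
    = 1"
  by (simp_all add: decision_program_def pick_process_def build_links_def link_step_def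
      mark_seeds_def
      spread_def spread_step_def check_def check_pair_def list_edge_def order_pair_def)

lemma witness_program_counts:
  "no_loop_closure witness_program" "closure_count witness_program = 0"
      "insertion_free witness_program"
  by (simp_all add: witness_program_def pick_process_def build_chains_def linearize_def
      pick_event_def
      emit_def append_writes_def)

lemma start_state_simps [simp]:
  "mem (start_state m h) = m" "held (start_state m h) = h" "steps (start_state m h) = 0"
  "closures (start_state m h) = 0" "insertions (start_state m h) = 0" "queries (start_state m h) =
      0"
  by (simp_all add: start_state_def)

lemma reach_start:
  assumes "reach t c T m h \<Phi>" "no_loop_closure c"
  obtains s where "exec t c (start_state m h) s" "\<Phi> (mem s) (held s)" "steps s \<le> T"
    "closures s \<le> closure_count c" "insertions s \<le> T" "queries s \<le> T"
proof -
  obtain s where s: "exec t c (start_state m h) s" "steps s \<le> steps (start_state m h) + T"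
      "\<Phi> (mem s) (held s)"
    using assms(1) unfolding reach_def by (metis start_state_simps(1,2))
  show ?thesis
    using that[OF s(1,3)] s(2) exec_closures[OF s(1) assms(2)] exec_insertions[OF s(1)]
        exec_queries[OF s(1)] by simp
qed

text \<open>\<open>ti n\<close> need not be monotone in the number of operations, hence the maximum
  over all numbers up to \<open>T\<close>. The single closure contributes \<open>tc n\<close>
  once.\<close>

definition decision_time :: "(nat \<Rightarrow> nat) \<Rightarrow> (nat \<Rightarrow> nat \<Rightarrow> nat) \<Rightarrow> (nat \<Rightarrow> nat) \<Rightarrow> nat \<Rightarrow> nat" where
  "decision_time tc ti tq n = (let T = 60 * (n + 1) * (n + 1) in
     T + tc n + Max (ti n ` {..T}) + T * tq n)"

text \<open>The program executes no insertion and no closure, and \<open>ti n 0 = 0\<close>, so only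
  steps and queries are paid for.\<close>

definition witness_time :: "nat \<Rightarrow> (nat \<Rightarrow> nat) \<Rightarrow> nat \<Rightarrow> nat" where
  "witness_time k tq n = (let T = 40 * (k + 1) * (n + 1) in T + T * tq n)"

lemma decision_program_correct:
  assumes j: "j1 < length t" "j2 < length t" and i: "i \<in> {1, 2}"
    and inp: "race_input k nv nl t (t ! j1) (t ! j2)"
  shows "\<exists>s res. exec t decision_program (start_state (input_memory k nv nl t j1 j2 i) None) s \<and>
    race_decision t (t ! j1) (t ! j2) i res \<and> mem s ''result'' 0 = (if res = None then 0 else 1) \<and>
    (res \<noteq> None \<longrightarrow> held s = res) \<and> running_time tc ti tq (length t) s \<le> decision_time tc ti tq
        (length t)"
proof -
  interpret input_trace t j1 j2 using j inp by unfold_locales (simp_all add: race_input_def)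
  let ?T = "60 * (n + 1) * (n + 1)"
  obtain s where s: "exec t decision_program (start_state (input_memory k nv nl t j1 j2 i) None) s"
    "\<exists>res. race_decision t (t ! j1) (t ! j2) i res \<and> mem s ''result'' 0 = (if res = None then 0
        else 1) \<and>
      (res \<noteq> None \<longrightarrow> held s = res)" "steps s \<le> ?T" "closures s \<le> 1" "insertions s \<le> ?T" "queries s
          \<le> ?T"
    using reach_start[OF decision_program_reach[OF inp i] decision_program_counts(1)]
    unfolding decision_program_counts(2) by metis
  have "ti n (insertions s) \<le> Max (ti n ` {..?T})" using s(5) by (intro Max_ge) auto
  moreover have "closures s * tc n \<le> 1 * tc n" using s(4) by (rule mult_le_mono1)
  moreover have "queries s * tq n \<le> ?T * tq n" using s(6) by (rule mult_le_mono1)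
  ultimately have "running_time tc ti tq n s \<le> decision_time tc ti tq n"
    using s(3) unfolding running_time_def decision_time_def Let_def by linarith
  then show ?thesis using s(1,2) by blast
qed

lemma witness_program_correct:
  assumes j: "j1 < length t" "j2 < length t" and inp: "race_input k nv nl t (t ! j1) (t ! j2)"
    and rd: "race_decision t (t ! j1) (t ! j2) i (Some (X, Q))"
    and init: "read_is_initialised nv t X (t ! j1) (t ! j2)" and ti: "ti (length t) 0 = 0"
  shows "\<exists>s. exec t witness_program (start_state (input_memory k nv nl t j1 j2 i) (Some (X, Q))) s \<and>
    witness_trace t (t ! j1) (t ! j2) (output_events t s) \<and>
    running_time tc ti tq (length t) s \<le> witness_time k tq (length t)"
proof -
  let ?T = "40 * (k + 1) * (length t + 1)"
  obtain s where s: "exec t witness_program (start_state (input_memory k nv nl t j1 j2 i) (Some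
      (X, Q))) s"
    "witness_trace t (t ! j1) (t ! j2) (map (nth t) (emitted (mem s)))" "steps s \<le> ?T"
        "closures s = 0" "queries s \<le> ?T"
    using reach_start[OF witness_program_reach[OF inp j rd init] witness_program_counts(1)]
    unfolding witness_program_counts(2) by auto
  have "insertions s = 0" using exec_insertion_free[OF s(1) witness_program_counts(3)] by simp
  then have "running_time tc ti tq (length t) s = steps s + queries s * tq (length t)"
    using s(4) ti by (simp add: running_time_def)
  moreover have "queries s * tq (length t) \<le> ?T * tq (length t)" using s(5) by (rule mult_le_mono1)
  ultimately have "running_time tc ti tq (length t) s \<le> witness_time k tq (length t)"
    using s(3) unfolding witness_time_def Let_def by linarith
  then show ?thesis using s(1,2) by (auto simp: output_events_emitted)
qed

lemma decision_time_bigo: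
  assumes "subroutine_times tc ti tq"
  shows "(\<lambda>n. real (decision_time tc ti tq n)) \<in> O(\<lambda>n. real n ^ 2 * ln (real n))"
proof -
  let ?g = "\<lambda>n. real n ^ 2 * ln (real n)" and ?T = "\<lambda>n::nat. 60 * (n + 1) * (n + 1)"
  have tc: "(\<lambda>n. real (tc n)) \<in> O(?g)" and tq: "(\<lambda>n. real (tq n)) \<in> O(\<lambda>n. ln (real n))"
    using assms by (auto simp: subroutine_times_def)
  obtain c where c: "\<And>n s. n \<ge> 2 \<Longrightarrow> real (ti n s) \<le> c * (real n ^ 2 * ln (real n) + real s * ln
      (real n))"
    using assms unfolding subroutine_times_def by blast
  have T2: "(\<lambda>n. real (?T n)) \<in> O(\<lambda>n. real n ^ 2)"
    by real_asymp
  have Tg: "(\<lambda>n. real (?T n)) \<in> O(?g)"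
    by real_asymp
  have Tq: "(\<lambda>n. real (?T n) * real (tq n)) \<in> O(?g)"
    using landau_o.big.mult[OF T2 tq] .
  have "(\<lambda>n. real (Max (ti n ` {..?T n}))) \<in> O(\<lambda>n. ?g n + real (?T n) * ln (real n))"
  \<comment> \<open>The constant of the amortised bound comes without a sign, hence the absolute
    value.\<close>
  proof (rule bigoI[where c = "\<bar>c\<bar>"])
    show "\<forall>\<^sub>F n in at_top. norm (real (Max (ti n ` {..?T n}))) \<le> \<bar>c\<bar> * norm (?g n + real (?T n) *
        ln (real n))"
      using eventually_ge_at_top[of 2]
    proof eventually_elim
      case (elim n)
      \<comment> \<open>The maximum is attained at some number of operations up to
        \<open>?T n\<close>. As \<open>?T n\<close> is quadratic, the term per operation is of the
        same order as the fixed term.\<close>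
      have "Max (ti n ` {..?T n}) \<in> ti n ` {..?T n}" by (intro Max_in) auto
      then obtain s where s: "s \<le> ?T n" "Max (ti n ` {..?T n}) = ti n s" by blast
      have ln: "0 \<le> ln (real n)" using elim by simp
      have le: "real s * ln (real n) \<le> real (?T n) * ln (real n)"
        using s(1) ln by (intro mult_right_mono) (simp_all only: of_nat_le_iff)
      have nn: "0 \<le> ?g n + real s * ln (real n)" using ln by simp
      have "real (ti n s) \<le> c * (?g n + real s * ln (real n))" using c[OF elim] .
      also have "\<dots> \<le> \<bar>c\<bar> * (?g n + real s * ln (real n))" using nn by (intro mult_right_mono) auto
      also have "\<dots> \<le> \<bar>c\<bar> * (?g n + real (?T n) * ln (real n))" using le by (intro mult_left_mono)
          auto
      also have "\<dots> \<le> \<bar>c\<bar> * norm (?g n + real (?T n) * ln (real n))" by (intro mult_left_mono) auto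
      finally show ?case using s(2) by simp
    qed
  qed
  also have "(\<lambda>n. ?g n + real (?T n) * ln (real n)) \<in> O(?g)" by real_asymp
  finally have M: "(\<lambda>n. real (Max (ti n ` {..?T n}))) \<in> O(?g)" .
  have "(\<lambda>n. real (?T n) + real (tc n) + real (Max (ti n ` {..?T n})) + real (?T n) * real (tq n))
      \<in> O(?g)"
    by (intro sum_in_bigo Tg tc M Tq)
  then show ?thesis by (simp only: decision_time_def Let_def of_nat_add of_nat_mult)
qed

lemma witness_time_bigo:
  assumes "subroutine_times tc ti tq"
  shows "(\<lambda>n. real (witness_time k tq n)) \<in> O(\<lambda>n. real n * ln (real n))"
proof -
  let ?T = "\<lambda>n::nat. 40 * (k + 1) * (n + 1)"
  have tq: "(\<lambda>n. real (tq n)) \<in> O(\<lambda>n. ln (real n))" using assms by (auto simp: subroutine_times_def)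
  have T1: "(\<lambda>n. real (?T n)) \<in> O(\<lambda>n. real n)" by real_asymp
  have Tg: "(\<lambda>n. real (?T n)) \<in> O(\<lambda>n. real n * ln (real n))" by real_asymp
  have "(\<lambda>n. real (?T n) + real (?T n) * real (tq n)) \<in> O(\<lambda>n. real n * ln (real n))"
    using Tg landau_o.big.mult[OF T1 tq] by (rule sum_in_bigo)
  then show ?thesis by (simp only: witness_time_def Let_def of_nat_add of_nat_mult)
qed

theorem theorem4p1:
  shows
    "(\<forall>k nv nl t e1 e2 i X Q.
        race_input k nv nl t e1 e2 \<longrightarrow> race_decision t e1 e2 i (Some (X, Q)) \<longrightarrow>
        read_is_initialised nv t X e1 e2 \<longrightarrow> predictable_race t e1 e2) \<and>
     (\<forall>nv nl t e1 e2 i.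
        race_input 2 nv nl t e1 e2 \<longrightarrow> predictable_race t e1 e2 \<longrightarrow> i \<in> {1, 2} \<longrightarrow>
        (\<exists>X Q. race_decision t e1 e2 i (Some (X, Q))) \<and> \<not> race_decision t e1 e2 i None) \<and>
     (\<exists>RD WIT. \<forall>k nv nl tc ti tq. subroutine_times tc ti tq \<longrightarrow>
        (\<exists>f g :: nat \<Rightarrow> nat.
           (\<lambda>n. real (f n)) \<in> O(\<lambda>n. real n ^ 2 * ln (real n)) \<and>
           (\<lambda>n. real (g n)) \<in> O(\<lambda>n. real n * ln (real n)) \<and>
           (\<forall>t j1 j2 i e1 e2. j1 < length t \<longrightarrow> j2 < length t \<longrightarrow> e1 = t ! j1 \<longrightarrow> e2 = t ! j2 \<longrightarrow>
              i \<in> {1, 2} \<longrightarrow> race_input k nv nl t e1 e2 \<longrightarrow>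
              (\<exists>s res. exec t RD (start_state (input_memory k nv nl t j1 j2 i) None) s \<and>
                 race_decision t e1 e2 i res \<and>
                 mem s ''result'' 0 = (if res = None then 0 else 1) \<and>
                 (res \<noteq> None \<longrightarrow> held s = res) \<and>
                 running_time tc ti tq (length t) s \<le> f (length t)) \<and>
              (\<forall>X Q. race_decision t e1 e2 i (Some (X, Q)) \<longrightarrow> read_is_initialised nv t X e1 e2 \<longrightarrow>
                 (\<exists>s. exec t WIT
                        (start_state (input_memory k nv nl t j1 j2 i) (Some (X, Q))) s \<and>
                    witness_trace t e1 e2 (output_events t s) \<and>
                    running_time tc ti tq (length t) s \<le> g (length t))))))"
proof (intro conjI, goal_cases)
  case 1
  show ?case
  proof (intro allI impI, goal_cases)
    case (1 k nv nl t e1 e2 i X Q)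
    then have e: "e1 \<in> set t" "e2 \<in> set t" by (auto simp: race_input_def)
    then obtain j1 j2 where j: "j1 < length t" "e1 = t ! j1" "j2 < length t" "e2 = t ! j2"
      by (metis in_set_conv_nth)
    \<comment> \<open>Soundness is read off from the output of the witness program, run with zero
      insertion times.\<close>
    have "\<exists>ts. witness_trace t e1 e2 ts"
      using witness_program_correct[OF j(1,3), of k nv nl i X Q "\<lambda>_ _. 0"] 1 j(2,4) by metis
    then show ?case using e by (simp add: predictable_race_def)
  qed
next
  case 2
  show ?case using race_decision_complete by blast
next
  case 3
  show ?case
  \<comment> \<open>The programs are fixed before \<open>k\<close>, the other bounds and the
    subroutine times; only the time functions depend on these.\<close>
  proof (rule exI[of _ decision_program], rule exI[of _ witness_program], intro allI impI,
      goal_cases)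
    case (1 k nv nl tc ti tq)
    then have ti: "ti m 0 = 0" for m by (simp add: subroutine_times_def)
    show ?case
    proof (rule exI[of _ "decision_time tc ti tq"], rule exI[of _ "witness_time k tq"],
        intro conjI allI impI, goal_cases)
      case 1
      show ?case using decision_time_bigo[OF \<open>subroutine_times tc ti tq\<close>] .
    next
      case 2
      show ?case using witness_time_bigo[OF \<open>subroutine_times tc ti tq\<close>] .
    next
      case (3 t j1 j2 i e1 e2)
      then show ?case using decision_program_correct[OF 3(1,2,5)] by simp
    next
      case (4 t j1 j2 i e1 e2 X Q)
      then show ?case using witness_program_correct[OF 4(1,2), of k nv nl i X Q ti] ti by simp
    qed
  qed
qed

end
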